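(* For every infinite binary sequence $\alpha$ the following are equivalent: (1) $\alpha$ is super deep; (2) for every recursive time bound $t:\mathbb{N}\to\mathbb{N}$ and every significance function $g=o(n)$, $\mathrm{depth}^t(\alpha_n)>g(n)$ for all but finitely many $n$; (3) for every recursive time bound $t:\mathbb{N}\to\mathbb{N}$ and every significance function $g=o(n)$, $Q_U(\alpha_n)\ge 2^{g(n)}Q^t_U(\alpha_n)$ for all but finitely many $n$.
   Context: $U$ is a fixed universal prefix Turing machine; $K(x)$ is prefix Kolmogorov complexity, $Q_U(x)=\sum_{U(p)=x}2^{-|p|}$, and for a time bound $t$, $K^t(x)=\min\{|p|:U(p)=x\text{ in at most }t(|x|)\text{ steps}\}$, $Q^t_U(x)=\sum_{p:\,U(p)=x\text{ within }t(|x|)\text{ steps}}2^{-|p|}$, and $\mathrm{depth}^t(x)=K^t(x)-K(x)$. The logical depth of a finite string $x$ at significance level $b$ is $\mathrm{ldepth}_b(x)=\min\{t(|x|):Q^t_U(x)/Q_U(x)\ge 2^{-b}\}$ over time-constructible $t$. $\alpha_n$ is the length-$n$ prefix of $\alpha$. A sequence $\alpha$ is super deep if for every significance level function $s:\mathbb{N}\to\mathbb{N}$ with $s=o(n)$ and every recursive $t:\mathbb{N}\to\mathbb{N}$, for all but finitely many $n$, $\mathrm{ldepth}_{s(n)}(\alpha_n)>t(n)$. *)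

theory Defs
  imports "HOL-Analysis.Infinite_Sum" "HOL-Library.Landau_Symbols"
    "HOL-Library.Extended_Nat" "HOL-Library.Sublist"
begin

text \<open>
  Deterministic multi-tape Turing machines with two-way infinite tapes. States and tape symbols are
  initial segments of the natural numbers, so the transition function, which only matters on those,
  is a finite object. The start state is 0; the machine halts when the transition function
  yields \<open>None\<close>.
\<close>

datatype dir = Lft | Stay | Rgt

fun shift :: "dir \<Rightarrow> int" where
  "shift Lft = -1"
| "shift Stay = 0"
| "shift Rgt = 1"

record tm =
  num_tapes :: nat
  num_states :: nat
  num_symbols :: nat
  delta :: "nat \<Rightarrow> nat list \<Rightarrow> (nat \<times> (nat \<times> dir) list) option"

definition turing_machine :: "tm \<Rightarrow> bool" where
  "turing_machine M \<longleftrightarrow>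
     1 \<le> num_tapes M \<and> 1 \<le> num_states M \<and> 3 \<le> num_symbols M \<and>
     (\<forall>q < num_states M. \<forall>as q' acts.
        length as = num_tapes M \<longrightarrow> set as \<subseteq> {..<num_symbols M} \<longrightarrow>
        delta M q as = Some (q', acts) \<longrightarrow>
          q' < num_states M \<and> length acts = num_tapes M \<and>
          fst ` set acts \<subseteq> {..<num_symbols M})"

text \<open>A tape is its contents together with the head position.\<close>

type_synonym tape = "(int \<Rightarrow> nat) \<times> int"

type_synonym config = "nat \<times> tape list"

fun scan :: "tape \<Rightarrow> nat" where
  "scan (f, h) = f h"

fun act :: "nat \<times> dir \<Rightarrow> tape \<Rightarrow> tape" where
  "act (a, d) (f, h) = (f(h := a), h + shift d)"

fun next_config :: "tm \<Rightarrow> config \<Rightarrow> config option" where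
  "next_config M (q, ts) =
     map_option (\<lambda>(q', acts). (q', map2 act acts ts)) (delta M q (map scan ts))"

definition halted :: "tm \<Rightarrow> config \<Rightarrow> bool" where
  "halted M c \<longleftrightarrow> next_config M c = None"

text \<open>A halted configuration is left unchanged by further steps.\<close>

definition step :: "tm \<Rightarrow> config \<Rightarrow> config" where
  "step M c = (case next_config M c of None \<Rightarrow> c | Some c' \<Rightarrow> c')"

text \<open>Symbol 0 is the blank, 1 and 2 are the two bits; further symbols are auxiliary.\<close>

definition bit_sym :: "bool \<Rightarrow> nat" where
  "bit_sym b = (if b then 2 else 1)"

definition blank_tape :: tape where
  "blank_tape = (\<lambda>_. 0, 0)"

definition input_tape :: "bool list \<Rightarrow> tape" where
  "input_tape p =
     (\<lambda>i. if 0 \<le> i \<and> i < int (length p) then bit_sym (p ! nat i) else 0, 0)"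

text \<open>The input is on the first tape, the output on the last one (the same if there is only one).\<close>

definition init_config :: "tm \<Rightarrow> bool list \<Rightarrow> config" where
  "init_config M p = (0, input_tape p # replicate (num_tapes M - 1) blank_tape)"

definition run :: "tm \<Rightarrow> bool list \<Rightarrow> nat \<Rightarrow> config" where
  "run M p s = (step M ^^ s) (init_config M p)"

text \<open>
  The output is the longest block of bits starting at cell 0 of the output tape, so that every
  halting computation has exactly one output.
\<close>

definition has_output :: "config \<Rightarrow> bool list \<Rightarrow> bool" where
  "has_output c x \<longleftrightarrow>
     (let f = fst (last (snd c)) in
        (\<forall>i < length x. f (int i) = bit_sym (x ! i)) \<and>
        f (int (length x)) \<notin> range bit_sym)"

definition halts_within :: "tm \<Rightarrow> bool list \<Rightarrow> nat \<Rightarrow> bool" where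
  "halts_within M p s \<longleftrightarrow> halted M (run M p s)"

definition halts_in_exactly :: "tm \<Rightarrow> bool list \<Rightarrow> nat \<Rightarrow> bool" where
  "halts_in_exactly M p s \<longleftrightarrow> halts_within M p s \<and> (\<forall>s' < s. \<not> halts_within M p s')"

definition computes_within :: "tm \<Rightarrow> bool list \<Rightarrow> bool list \<Rightarrow> nat \<Rightarrow> bool" where
  "computes_within M p x s \<longleftrightarrow> halts_within M p s \<and> has_output (run M p s) x"

definition computes :: "tm \<Rightarrow> bool list \<Rightarrow> bool list \<Rightarrow> bool" where
  "computes M p x \<longleftrightarrow> (\<exists>s. computes_within M p x s)"

definition recursive :: "(nat \<Rightarrow> nat) \<Rightarrow> bool" where
  "recursive t \<longleftrightarrow>
     (\<exists>M. turing_machine M \<and>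
        (\<forall>n. computes M (replicate n True) (replicate (t n) True)))"

definition time_constructible :: "(nat \<Rightarrow> nat) \<Rightarrow> bool" where
  "time_constructible t \<longleftrightarrow>
     (\<exists>M. turing_machine M \<and> (\<forall>p. halts_in_exactly M p (t (length p))))"

definition prefix_machine :: "tm \<Rightarrow> bool" where
  "prefix_machine M \<longleftrightarrow>
     turing_machine M \<and>
     (\<forall>p q s s'. halts_within M p s \<longrightarrow> halts_within M q s' \<longrightarrow> \<not> strict_prefix p q)"

definition universal_prefix_machine :: "tm \<Rightarrow> bool" where
  "universal_prefix_machine U \<longleftrightarrow>
     prefix_machine U \<and>
     (\<forall>M. prefix_machine M \<longrightarrow>
        (\<exists>w. \<forall>q x. computes U (w @ q) x \<longleftrightarrow> computes M q x))"

text \<open>Minima over possibly empty sets are taken in \<^typ>\<open>enat\<close>, where the empty infimum is \<open>\<infinity>\<close>.\<close>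

definition K :: "tm \<Rightarrow> bool list \<Rightarrow> enat" where
  "K U x = (INF p \<in> {p. computes U p x}. enat (length p))"

definition Kt :: "tm \<Rightarrow> (nat \<Rightarrow> nat) \<Rightarrow> bool list \<Rightarrow> enat" where
  "Kt U t x = (INF p \<in> {p. computes_within U p x (t (length x))}. enat (length p))"

text \<open>
  For a universal prefix machine \<open>K\<close> is finite and at most \<open>Kt\<close>, so this subtraction never
  truncates; it yields \<open>\<infinity>\<close> if no program produces \<open>x\<close> in time.
\<close>

definition depth :: "tm \<Rightarrow> (nat \<Rightarrow> nat) \<Rightarrow> bool list \<Rightarrow> enat" where
  "depth U t x = Kt U t x - K U x"

text \<open>For prefix machines the families below are summable by Kraft's inequality.\<close>

definition Q :: "tm \<Rightarrow> bool list \<Rightarrow> real" where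
  "Q U x = (\<Sum>\<^sub>\<infinity>p \<in> {p. computes U p x}. 1 / 2 ^ length p)"

definition Qt :: "tm \<Rightarrow> (nat \<Rightarrow> nat) \<Rightarrow> bool list \<Rightarrow> real" where
  "Qt U t x = (\<Sum>\<^sub>\<infinity>p \<in> {p. computes_within U p x (t (length x))}. 1 / 2 ^ length p)"

definition ldepth :: "tm \<Rightarrow> nat \<Rightarrow> bool list \<Rightarrow> enat" where
  "ldepth U b x =
     (INF t \<in> {t. time_constructible t \<and> Qt U t x / Q U x \<ge> 1 / 2 ^ b}. enat (t (length x)))"

definition significance :: "(nat \<Rightarrow> nat) \<Rightarrow> bool" where
  "significance g \<longleftrightarrow> (\<lambda>n. real (g n)) \<in> o(\<lambda>n. real n)"

definition seq_prefix :: "(nat \<Rightarrow> bool) \<Rightarrow> nat \<Rightarrow> bool list" where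
  "seq_prefix \<alpha> n = map \<alpha> [0..<n]"

definition super_deep :: "tm \<Rightarrow> (nat \<Rightarrow> bool) \<Rightarrow> bool" where
  "super_deep U \<alpha> \<longleftrightarrow>
     (\<forall>s t. significance s \<longrightarrow> recursive t \<longrightarrow>
        (\<forall>\<^sub>F n in sequentially. ldepth U (s n) (seq_prefix \<alpha> n) > enat (t n)))"

end

theory Submission
  imports Defs "HOL-Library.Nat_Bijection" "HOL-Library.Discrete_Functions"
begin

text \<open>
  For (1) and (3): every recursive bound \<open>t\<close> is dominated by the running time \<open>T\<close> of a machine that
  overwrites its input by ones, simulates the machine for \<open>t\<close> and counts its own steps in unary; such
  a \<open>T\<close> is both time-constructible and recursive.

  For (2) and (3) a coding theorem with error \<open>o(n)\<close> suffices. At most \<open>2^j\<close> strings \<open>y\<close> of length \<open>n\<close>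
  have \<open>Q(y) \<ge> 2^(-j)\<close>, and they can be enumerated, so \<open>y\<close> is determined by \<open>n\<close>, \<open>j\<close> and a block of \<open>j\<close>
  bits; writing \<open>n\<close> and \<open>j\<close> as pairs of unary numbers makes this a prefix code of length \<open>j + O(sqrt n)\<close>.
  Universality says nothing about the running time on these codewords, but a recursive bound for it is
  found by search: wait until every \<open>y\<close> that is heavy within time \<open>t(n)\<close> has been produced from a codeword.
  Programs that halt within time \<open>s\<close> have length at most \<open>s + 1\<close>, so heaviness is decidable.

  Computability is established by compiling structured tape programs, and with them primitive
  recursive functions under an unbounded search, to Turing machines. The fixed machines \<open>U\<close> and the one
  for \<open>t\<close> are simulated by table lookup, so no machine needs to be encoded.
\<close>

section \<open>Structured tape programs\<close>

text \<open>Both equivalences pass through (3). Between (2) and (3), \<open>K\<close> is compared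
  with -log of \<open>Q\<close>, and \<open>Kt\<close> with -log of \<open>Qt\<close>; program
  lengths exceed these logarithms by at most some h(n) = O(sqrt n). Since g ranges over all of o(n),
  which is closed under addition, passing from g to g + h absorbs the loss. The bound 2^j on the
  number of heavy strings is Kraft's inequality: programs for distinct outputs are disjoint and
  jointly prefix-free, so the probabilities of all strings add up to at most 1. Universality speaks
  about prefix machines only. The decoder therefore has to diverge on every input that is not a
  codeword, and this is why the search theorem controls divergence as well as output. The clock of
  the first equivalence returns in the second: a recursive \<open>t\<close> need not be primitive
  recursive, so the search cannot evaluate it, but it can check that a clock running for at least
  \<open>t n\<close> steps has stopped.\<close>

datatype com =
    Act "nat list \<Rightarrow> (nat \<times> dir) list"
  | Seq com com (infixr ";;" 60)
  | Cond "nat list \<Rightarrow> bool" com com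
  | While "nat list \<Rightarrow> bool" com

definition stay :: "nat list \<Rightarrow> (nat \<times> dir) list" where
  "stay as = map (\<lambda>a. (a, Stay)) as"

text \<open>The list is the continuation still to be executed. Control constructs also cost one
  step, which rewrites every scanned symbol by itself, so that program steps and machine steps
  correspond one to one.\<close>

fun com_delta :: "com list \<Rightarrow> nat list \<Rightarrow> (com list \<times> (nat \<times> dir) list) option" where
  "com_delta [] as = None"
| "com_delta (Act a # cs) as = Some (cs, a as)"
| "com_delta ((c ;; d) # cs) as = Some (c # d # cs, stay as)"
| "com_delta (Cond b c d # cs) as = Some ((if b as then c else d) # cs, stay as)"
| "com_delta (While b c # cs) as = Some (if b as then c # While b c # cs else cs, stay as)"

definition cstep :: "com list \<times> tape list \<Rightarrow> com list \<times> tape list" where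
  "cstep c = (case com_delta (fst c) (map scan (snd c)) of
     None \<Rightarrow> c | Some (cs, acts) \<Rightarrow> (cs, map2 act acts (snd c)))"

fun wf_com :: "nat \<Rightarrow> nat \<Rightarrow> com \<Rightarrow> bool" where
  "wf_com k m (Act a) \<longleftrightarrow> (\<forall>as. length as = k \<longrightarrow> set as \<subseteq> {..<m} \<longrightarrow>
     length (a as) = k \<and> fst ` set (a as) \<subseteq> {..<m})"
| "wf_com k m (c ;; d) \<longleftrightarrow> wf_com k m c \<and> wf_com k m d"
| "wf_com k m (Cond b c d) \<longleftrightarrow> wf_com k m c \<and> wf_com k m d"
| "wf_com k m (While b c) \<longleftrightarrow> wf_com k m c"

text \<open>The control states of the compiled machine are the continuations reachable from the program.\<close>

fun conts :: "com \<Rightarrow> com list \<Rightarrow> com list set" where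
  "conts (Act a) cs = {Act a # cs}"
| "conts (c ;; d) cs = insert ((c ;; d) # cs) (conts c (d # cs) \<union> conts d cs)"
| "conts (Cond b c d) cs = insert (Cond b c d # cs) (conts c cs \<union> conts d cs)"
| "conts (While b c) cs = insert (While b c # cs) (conts c (While b c # cs))"

lemma finite_conts: "finite (conts c cs)"
  by (induction c cs rule: conts.induct) auto

lemma conts_self: "c # cs \<in> conts c cs"
  by (cases c) auto

text \<open>The additional \<open>cs0\<close> is what remains when \<open>c\<close> is finished. For
  \<open>cs0 = []\<close> this makes a finite set closed under transitions, which can serve as the
  state set of a machine.\<close>

lemma conts_step:
  "cs \<in> conts c cs0 \<Longrightarrow> com_delta cs as = Some (cs', acts) \<Longrightarrow> cs' \<in> insert cs0 (conts c cs0)"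
proof (induction c cs0 rule: conts.induct)
  case (2 c d cs0)
  from 2(3) consider "cs = (c ;; d) # cs0" | "cs \<in> conts c (d # cs0)" | "cs \<in> conts d cs0" by auto
  then show ?case
  proof cases
    case 1
    then show ?thesis using 2(4) conts_self[of c "d # cs0"] by simp
  next
    case 2
    then show ?thesis using "2.IH"(1) "2.prems"(2) conts_self[of d cs0] by auto
  next
    case 3
    then show ?thesis using "2.IH"(2) "2.prems"(2) by auto
  qed
next
  case (3 b c d cs0)
  from 3(3) consider "cs = Cond b c d # cs0" | "cs \<in> conts c cs0" | "cs \<in> conts d cs0" by auto
  then show ?case
  proof cases
    case 1
    then show ?thesis using 3(4) conts_self[of c cs0] conts_self[of d cs0] by (simp split: if_splits)
  next
    case 2
    then show ?thesis using "3.IH"(1) "3.prems"(2) by auto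
  next
    case 3
    then show ?thesis using "3.IH"(2) "3.prems"(2) by auto
  qed
next
  case (4 b c cs0)
  from 4(2) consider "cs = While b c # cs0" | "cs \<in> conts c (While b c # cs0)" by auto
  then show ?case
  proof cases
    case 1
    then show ?thesis using 4(3) conts_self[of c "While b c # cs0"] by (simp split: if_splits)
  next
    case 2
    then show ?thesis using "4.IH" "4.prems"(2) by auto
  qed
qed simp

lemma conts_wf:
  "cs \<in> conts c cs0 \<Longrightarrow> wf_com k m c \<Longrightarrow> \<forall>c\<in>set cs0. wf_com k m c \<Longrightarrow> c' \<in> set cs \<Longrightarrow> wf_com k m c'"
proof (induction c cs0 rule: conts.induct)
  case (2 c d cs0)
  from 2(3) consider "cs = (c ;; d) # cs0" | "cs \<in> conts c (d # cs0)" | "cs \<in> conts d cs0" by auto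
  then show ?case using 2 by cases auto
next
  case (3 b c d cs0)
  from 3(3) consider "cs = Cond b c d # cs0" | "cs \<in> conts c cs0" | "cs \<in> conts d cs0" by auto
  then show ?case using 3 by cases auto
next
  case (4 b c cs0)
  from 4(2) consider "cs = While b c # cs0" | "cs \<in> conts c (While b c # cs0)" by auto
  then show ?case using 4 by cases auto
qed auto

lemma com_delta_wf:
  assumes "\<forall>c\<in>set cs. wf_com k m c" "length as = k" "set as \<subseteq> {..<m}" "com_delta cs as = Some (cs', acts)"
  shows "length acts = k \<and> fst ` set acts \<subseteq> {..<m}"
  using assms by (cases "(cs, as)" rule: com_delta.cases) (auto simp: stay_def)

text \<open>The map \<open>\<rho>\<close> merely numbers the continuations and the simulation runs
  in lockstep, so termination and divergence of programs carry over to the machine.\<close>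

theorem com_tm_exists:
  assumes wf: "wf_com k m c" and k: "1 \<le> k" and m: "3 \<le> m"
  shows "\<exists>M \<rho>. turing_machine M \<and> num_tapes M = k \<and>
     (\<forall>n ts. (step M ^^ n) (0, ts) = map_prod \<rho> id ((cstep ^^ n) ([c], ts)) \<and>
       (halted M ((step M ^^ n) (0, ts)) \<longleftrightarrow> fst ((cstep ^^ n) ([c], ts)) = []))"
proof -
  define R where "R = insert [] (conts c [])"
  have finR: "finite R" by (simp add: R_def finite_conts)
  \<comment> \<open>The initial continuation is put at the head of the enumeration because the start
    state of a machine is 0.\<close>
  obtain xs where xs: "set xs = R - {[c]}" "distinct xs" using finite_distinct_list finR by blast
  define L where "L = [c] # xs"
  have cR: "[c] \<in> R" using conts_self[of c "[]"] by (simp add: R_def)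
  have L: "set L = R" "distinct L" using xs cR by (auto simp: L_def)
  define \<rho> where "\<rho> = inv_into {..<length L} (nth L)"
  have bij: "bij_betw (nth L) {..<length L} R" using L bij_betw_nth by blast
  have \<rho>1: "\<rho> cs < length L" "L ! \<rho> cs = cs" if "cs \<in> R" for cs
    using that bij inv_into_into[of cs "nth L" "{..<length L}"] f_inv_into_f[of cs "nth L" "{..<length L}"]
    by (simp_all add: \<rho>_def bij_betw_def)
  have \<rho>0: "\<rho> [c] = 0"
  proof -
    have "L ! 0 = [c]" "0 < length L" by (auto simp: L_def)
    then show ?thesis using \<rho>1[OF cR] L(2) nth_eq_iff_index_eq by metis
  qed
  have closed: "cs' \<in> R" if "cs \<in> R" "com_delta cs as = Some (cs', acts)" for cs as cs' acts
    using that conts_step[of cs c "[]" as cs' acts] by (auto simp: R_def)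
  define M where "M = \<lparr>num_tapes = k, num_states = length L, num_symbols = m,
     delta = (\<lambda>q as. map_option (map_prod \<rho> id) (com_delta (L ! q) as))\<rparr>"
  have Lin: "L ! q \<in> R" if "q < length L" for q using nth_mem[OF that] L(1) by simp
  have tm: "turing_machine M"
    unfolding turing_machine_def
  proof (intro conjI allI impI)
    show "1 \<le> num_states M" by (simp add: M_def L_def)
    fix q as q' acts
    assume a: "q < num_states M" "length as = num_tapes M" "set as \<subseteq> {..<num_symbols M}"
      "delta M q as = Some (q', acts)"
    then obtain cs' where cs': "com_delta (L ! q) as = Some (cs', acts)" "q' = \<rho> cs'"
      by (auto simp: M_def)
    have q: "q < length L" using a by (simp add: M_def)
    show "q' < num_states M" using cs' closed[OF Lin[OF q] cs'(1)] \<rho>1 by (simp add: M_def)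
    have "\<forall>c\<in>set (L ! q). wf_com k m c"
      using Lin[OF q] conts_wf[of "L ! q" c "[]" k m] wf by (auto simp: R_def)
    from com_delta_wf[OF this _ _ cs'(1)] a
    show "length acts = num_tapes M" "fst ` set acts \<subseteq> {..<num_symbols M}" by (auto simp: M_def)
  qed (use k m in \<open>auto simp: M_def\<close>)
  have nc: "next_config M (\<rho> cs, ts) =
      map_option (\<lambda>(cs', acts). (\<rho> cs', map2 act acts ts)) (com_delta cs (map scan ts))"
    if "cs \<in> R" for cs ts
    using \<rho>1[OF that] by (simp add: M_def option.map_comp o_def case_prod_unfold)
  have tapes_of: "step M (map_prod \<rho> id c) = map_prod \<rho> id (cstep c) \<and> fst (cstep c) \<in> R"
    if "fst c \<in> R" for c
  proof -
    obtain cs ts where c: "c = (cs, ts)" by (cases c)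
    show ?thesis
    proof (cases "com_delta cs (map scan ts)")
      case None
      then show ?thesis using nc[of cs ts] that by (simp add: c step_def cstep_def del: next_config.simps)
    next
      case (Some r)
      then show ?thesis using nc[of cs ts] that closed[of cs "map scan ts" "fst r" "snd r"]
        by (simp add: c step_def cstep_def case_prod_unfold del: next_config.simps)
    qed
  qed
  have run: "(step M ^^ n) (0, ts) = map_prod \<rho> id ((cstep ^^ n) ([c], ts)) \<and>
      fst ((cstep ^^ n) ([c], ts)) \<in> R" for n ts
  proof (induction n)
    case 0
    show ?case using \<rho>0 cR by simp
  next
    case (Suc n)
    then show ?case using tapes_of[of "(cstep ^^ n) ([c], ts)"] by (simp only: funpow.simps comp_apply)
  qed
  have none: "com_delta cs as = None \<longleftrightarrow> cs = []" for cs as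
    by (cases "(cs, as)" rule: com_delta.cases) auto
  have hal: "halted M (map_prod \<rho> id c) \<longleftrightarrow> fst c = []" if "fst c \<in> R" for c
    using nc[OF that, of "snd c"] none[of "fst c"] by (cases c) (simp add: halted_def del: next_config.simps)
  show ?thesis
  proof (intro exI[of _ M] exI[of _ \<rho>] conjI allI)
    show "turing_machine M" by (rule tm)
    show "num_tapes M = k" by (simp add: M_def)
    fix n ts
    show "(step M ^^ n) (0, ts) = map_prod \<rho> id ((cstep ^^ n) ([c], ts))"
      using run[of n ts] by blast
    then show "halted M ((step M ^^ n) (0, ts)) \<longleftrightarrow> fst ((cstep ^^ n) ([c], ts)) = []"
      using hal[of "(cstep ^^ n) ([c], ts)"] run[of n ts] by simp
  qed
qed

text \<open>Big-step termination, with an arbitrary continuation so that it composes.\<close>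

definition exec :: "com \<Rightarrow> tape list \<Rightarrow> tape list \<Rightarrow> bool" where
  "exec c ts ts' \<longleftrightarrow> (\<forall>cs. \<exists>n>0. (cstep ^^ n) (c # cs, ts) = (cs, ts'))"

lemma act_stay: "map2 act (stay (map scan ts)) ts = ts"
  by (induction ts) (auto simp: stay_def)

lemma cstep_Cons:
  "cstep (Act a # cs, ts) = (cs, map2 act (a (map scan ts)) ts)"
  "cstep ((c ;; d) # cs, ts) = (c # d # cs, ts)"
  "cstep (Cond b c d # cs, ts) = ((if b (map scan ts) then c else d) # cs, ts)"
  "cstep (While b c # cs, ts) = (if b (map scan ts) then c # While b c # cs else cs, ts)"
  by (simp_all add: cstep_def act_stay)

lemma funpow_trans: "(f ^^ m) a = b \<Longrightarrow> (f ^^ n) b = c \<Longrightarrow> (f ^^ (n + m)) a = c"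
  by (simp add: funpow_add)

lemma exec_Act: "ts' = map2 act (a (map scan ts)) ts \<Longrightarrow> exec (Act a) ts ts'"
  unfolding exec_def by (intro allI exI[of _ 1]) (simp add: cstep_Cons)

lemma exec_unfold:
  assumes "\<And>cs. cstep (c # cs, ts) = (d # cs, ts)" "exec d ts ts'"
  shows "exec c ts ts'"
  unfolding exec_def
proof
  fix cs
  obtain n where "(cstep ^^ n) (d # cs, ts) = (cs, ts')" using assms(2) unfolding exec_def by blast
  then have "(cstep ^^ Suc n) (c # cs, ts) = (cs, ts')"
    by (simp add: funpow_Suc_right assms(1) del: funpow.simps)
  then show "\<exists>n>0. (cstep ^^ n) (c # cs, ts) = (cs, ts')" by blast
qed

lemma exec_Seq:
  assumes "exec c ts ts'" "exec d ts' ts''"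
  shows "exec (c ;; d) ts ts''"
  unfolding exec_def
proof
  fix cs
  obtain n where n: "(cstep ^^ n) (c # d # cs, ts) = (d # cs, ts')"
    using assms(1) unfolding exec_def by blast
  obtain m where m: "(cstep ^^ m) (d # cs, ts') = (cs, ts'')"
    using assms(2) unfolding exec_def by blast
  have "(cstep ^^ Suc (m + n)) ((c ;; d) # cs, ts) = (cs, ts'')"
    using funpow_trans[OF n m] by (simp add: funpow_Suc_right cstep_Cons del: funpow.simps)
  then show "\<exists>n>0. (cstep ^^ n) ((c ;; d) # cs, ts) = (cs, ts'')" by blast
qed

lemma exec_Cond:
  "exec (if b (map scan ts) then c else d) ts ts' \<Longrightarrow> exec (Cond b c d) ts ts'"
  by (erule exec_unfold[rotated]) (simp add: cstep_Cons)

lemma exec_While_done: "\<not> b (map scan ts) \<Longrightarrow> exec (While b c) ts ts"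
  unfolding exec_def by (intro allI exI[of _ 1]) (simp add: cstep_Cons)

lemma While_iter:
  assumes "b (map scan ts)" "exec c ts ts'"
  shows "\<exists>n>0. (cstep ^^ n) (While b c # cs, ts) = (While b c # cs, ts')"
proof -
  obtain n where "(cstep ^^ n) (c # While b c # cs, ts) = (While b c # cs, ts')"
    using assms unfolding exec_def by blast
  then have "(cstep ^^ Suc n) (While b c # cs, ts) = (While b c # cs, ts')"
    using assms(1) by (simp add: funpow_Suc_right cstep_Cons del: funpow.simps)
  then show ?thesis by blast
qed

lemma exec_While_step:
  assumes "b (map scan ts)" "exec c ts ts'" "exec (While b c) ts' ts''"
  shows "exec (While b c) ts ts''"
  unfolding exec_def
proof
  fix cs
  obtain n where n: "n > 0" "(cstep ^^ n) (While b c # cs, ts) = (While b c # cs, ts')"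
    using While_iter[where b=b and c=c, OF assms(1,2)] by blast
  obtain m where m: "(cstep ^^ m) (While b c # cs, ts') = (cs, ts'')"
    using assms(3) unfolding exec_def by blast
  have "(cstep ^^ (m + n)) (While b c # cs, ts) = (cs, ts'')" "m + n > 0"
    using funpow_trans[OF n(2) m] n(1) by simp_all
  then show "\<exists>n>0. (cstep ^^ n) (While b c # cs, ts) = (cs, ts'')" by blast
qed

text \<open>Every pass costs at least the step that tests the condition, so unboundedly many passes
  place the program at the loop head after arbitrarily many steps.\<close>

lemma While_diverges:
  assumes "\<And>i. b (map scan (S i))" "\<And>i. exec c (S i) (S (Suc i))"
  shows "\<exists>n\<ge>i. (cstep ^^ n) (While b c # cs, S 0) = (While b c # cs, S i)"
proof (induction i)
  case 0
  show ?case by (intro exI[of _ 0]) simp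
next
  case (Suc i)
  then obtain n where n: "n \<ge> i" "(cstep ^^ n) (While b c # cs, S 0) = (While b c # cs, S i)" by blast
  obtain m where m: "m > 0" "(cstep ^^ m) (While b c # cs, S i) = (While b c # cs, S (Suc i))"
    using While_iter[where b=b and c=c, OF assms(1,2)] by blast
  show ?case using funpow_trans[OF n(2) m(2)] n m by (intro exI[of _ "m + n"]) auto
qed

lemma cstep_Nil: "(cstep ^^ n) ([], ts) = ([], ts)"
  by (induction n) (auto simp: cstep_def)

section \<open>Counters on tapes\<close>

text \<open>A counter is a tape carrying a marker in cell 0 only; the head position is the value.\<close>

definition counter :: "nat \<Rightarrow> tape" where
  "counter n = (\<lambda>i. if i = 0 then 1 else 0, int n)"

text \<open>This order matches \<open>init_config\<close> and \<open>has_output\<close>, which use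
  the first and the last tape; hence register \<open>r\<close> lives on tape
  \<open>Suc r\<close>.\<close>

definition tapes_of :: "nat \<Rightarrow> tape \<Rightarrow> (nat \<Rightarrow> nat) \<Rightarrow> tape \<Rightarrow> tape list" where
  "tapes_of m I \<sigma> J = I # map (\<lambda>r. counter (\<sigma> r)) [0..<m] @ [J]"

definition modify :: "nat \<Rightarrow> (nat \<Rightarrow> nat \<times> dir) \<Rightarrow> com" where
  "modify i f = Act (\<lambda>as. (stay as)[i := f (as ! i)])"

definition Inc :: "nat \<Rightarrow> com" where "Inc r = modify (Suc r) (\<lambda>a. (a, Rgt))"
definition Dec :: "nat \<Rightarrow> com" where "Dec r = modify (Suc r) (\<lambda>a. (a, Lft))"

text \<open>The marker occupies only cell 0, so scanning a blank means that the head has left it and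
  the value is positive.\<close>

definition nz :: "nat \<Rightarrow> nat list \<Rightarrow> bool" where "nz r as \<longleftrightarrow> as ! Suc r = 0"

lemma wf_modify: "(\<And>a. a < s \<Longrightarrow> fst (f a) < s) \<Longrightarrow> wf_com k s (modify i f)"
proof -
  assume f: "\<And>a. a < s \<Longrightarrow> fst (f a) < s"
  have "fst ` set ((stay as)[i := f (as ! i)]) \<subseteq> {..<s}" if "set as \<subseteq> {..<s}" for as
  proof (cases "i < length as")
    case True
    then have "as ! i < s" using that nth_mem by blast
    then show ?thesis using f set_update_subset_insert[of "stay as" i "f (as ! i)"] that
      by (fastforce simp: stay_def)
  next
    case False
    then show ?thesis using that by (auto simp: stay_def list_update_beyond)
  qed
  then show ?thesis by (simp add: modify_def stay_def)
qed

lemma wf_Inc [simp]: "wf_com k s (Inc r)" and wf_Dec [simp]: "wf_com k s (Dec r)"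
  by (simp_all add: Inc_def Dec_def wf_modify)

lemma map2_act_update:
  "i < length ts \<Longrightarrow> map2 act ((stay (map scan ts))[i := x]) ts = ts[i := act x (ts ! i)]"
proof (rule nth_equalityI)
  fix j assume i: "i < length ts" and "j < length (map2 act ((stay (map scan ts))[i := x]) ts)"
  then have j: "j < length ts" by (simp add: stay_def)
  show "map2 act ((stay (map scan ts))[i := x]) ts ! j = ts[i := act x (ts ! i)] ! j"
    using i j by (cases "ts ! j") (auto simp: stay_def nth_list_update)
qed (simp add: stay_def)

lemma exec_modify:
  "i < length ts \<Longrightarrow> exec (modify i f) ts (ts[i := act (f (scan (ts ! i))) (ts ! i)])"
  unfolding modify_def by (rule exec_Act) (simp add: map2_act_update)

lemma length_tapes_of [simp]: "length (tapes_of m I \<sigma> J) = m + 2"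
  by (simp add: tapes_of_def)

lemma tapes_of_nth [simp]: "r < m \<Longrightarrow> tapes_of m I \<sigma> J ! Suc r = counter (\<sigma> r)"
  by (simp add: tapes_of_def nth_append)

lemma tapes_of_nth_0 [simp]: "tapes_of m I \<sigma> J ! 0 = I" "tapes_of m I \<sigma> J ! Suc m = J"
  by (simp_all add: tapes_of_def nth_append)

lemma tapes_of_update [simp]: "r < m \<Longrightarrow> (tapes_of m I \<sigma> J)[Suc r := counter v] = tapes_of m I (\<sigma>(r := v)) J"
  by (rule nth_equalityI) (auto simp: tapes_of_def nth_Cons nth_append nth_list_update split: nat.split)

lemma tapes_of_update_0 [simp]: "(tapes_of m I \<sigma> J)[0 := I'] = tapes_of m I' \<sigma> J" "(tapes_of m I \<sigma> J)[Suc m := J'] = tapes_of m I \<sigma> J'"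
  by (simp_all add: tapes_of_def list_update_append)

lemma nz_tapes_of [simp]: "r < m \<Longrightarrow> nz r (map scan (tapes_of m I \<sigma> J)) \<longleftrightarrow> \<sigma> r \<noteq> 0"
  by (simp add: nz_def counter_def)

text \<open>Quantifying over both outer tapes allows register code to run at any moment while input
  is being read or output is being written.\<close>

definition reg_exec :: "nat \<Rightarrow> com \<Rightarrow> (nat \<Rightarrow> nat) \<Rightarrow> (nat \<Rightarrow> nat) \<Rightarrow> bool" where
  "reg_exec m c \<sigma> \<sigma>' \<longleftrightarrow> (\<forall>I J. exec c (tapes_of m I \<sigma> J) (tapes_of m I \<sigma>' J))"

lemma reg_exec_Inc: "r < m \<Longrightarrow> reg_exec m (Inc r) \<sigma> (\<sigma>(r := Suc (\<sigma> r)))"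
  unfolding reg_exec_def
proof (intro allI)
  fix I J assume r: "r < m"
  have "act (scan (counter (\<sigma> r)), Rgt) (counter (\<sigma> r)) = counter (Suc (\<sigma> r))"
    by (simp add: counter_def fun_upd_idem)
  then show "exec (Inc r) (tapes_of m I \<sigma> J) (tapes_of m I (\<sigma>(r := Suc (\<sigma> r))) J)"
    using exec_modify[of "Suc r" "tapes_of m I \<sigma> J" "\<lambda>a. (a, Rgt)"] r by (simp add: Inc_def)
qed

lemma reg_exec_Dec: "r < m \<Longrightarrow> \<sigma> r \<noteq> 0 \<Longrightarrow> reg_exec m (Dec r) \<sigma> (\<sigma>(r := \<sigma> r - 1))"
  unfolding reg_exec_def
proof (intro allI)
  fix I J assume r: "r < m" "\<sigma> r \<noteq> 0"
  then have "act (scan (counter (\<sigma> r)), Lft) (counter (\<sigma> r)) = counter (\<sigma> r - 1)"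
    by (simp add: counter_def fun_upd_idem)
  then show "exec (Dec r) (tapes_of m I \<sigma> J) (tapes_of m I (\<sigma>(r := \<sigma> r - 1)) J)"
    using exec_modify[of "Suc r" "tapes_of m I \<sigma> J" "\<lambda>a. (a, Lft)"] r by (simp add: Dec_def)
qed

lemma reg_exec_Seq: "reg_exec m c \<sigma> \<sigma>' \<Longrightarrow> reg_exec m d \<sigma>' \<sigma>'' \<Longrightarrow> reg_exec m (c ;; d) \<sigma> \<sigma>''"
  unfolding reg_exec_def using exec_Seq by blast

lemma reg_exec_Cond: "r < m \<Longrightarrow> (\<sigma> r \<noteq> 0 \<Longrightarrow> reg_exec m c \<sigma> \<sigma>') \<Longrightarrow> (\<sigma> r = 0 \<Longrightarrow> reg_exec m d \<sigma> \<sigma>') \<Longrightarrow>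
    reg_exec m (Cond (nz r) c d) \<sigma> \<sigma>'"
  unfolding reg_exec_def by (intro allI exec_Cond) auto

lemma reg_exec_cong: "reg_exec m c \<sigma> \<sigma>' \<Longrightarrow> \<sigma>' = \<sigma>'' \<Longrightarrow> reg_exec m c \<sigma> \<sigma>''"
  by simp

text \<open>The index is the number of passes still to be made. A loop is thus verified by one
  family of states that counts down, with no separate invariant and measure.\<close>

lemma exec_While_family:
  assumes "\<And>i. i \<le> n \<Longrightarrow> b (map scan (S i)) \<longleftrightarrow> i \<noteq> 0"
    and "\<And>i. i < n \<Longrightarrow> exec c (S (Suc i)) (S i)"
  shows "exec (While b c) (S n) (S 0)"
proof -
  have "i \<le> n \<Longrightarrow> exec (While b c) (S i) (S 0)" for i
  proof (induction i)
    case 0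
    show ?case by (rule exec_While_done) (use assms(1)[of 0] in simp)
  next
    case (Suc i)
    show ?case
      by (rule exec_While_step[where ts' = "S i"]) (use Suc assms(1)[of "Suc i"] assms(2)[of i] in auto)
  qed
  then show ?thesis by simp
qed

lemma reg_exec_While_family:
  assumes "\<And>i I J. i \<le> n \<Longrightarrow> b (map scan (tapes_of m I (S i) J)) \<longleftrightarrow> i \<noteq> 0"
    and "\<And>i. i < n \<Longrightarrow> reg_exec m c (S (Suc i)) (S i)"
  shows "reg_exec m (While b c) (S n) (S 0)"
  unfolding reg_exec_def using assms
  by (auto simp: reg_exec_def intro!: exec_While_family[where S = "\<lambda>i. tapes_of m _ (S i) _"])

lemma reg_exec_loop:
  assumes "r < m" "\<And>i. i \<le> n \<Longrightarrow> S i r = i" "\<And>i. i < n \<Longrightarrow> reg_exec m c ((S (Suc i))(r := i)) (S i)"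
  shows "reg_exec m (While (nz r) (Dec r ;; c)) (S n) (S 0)"
proof (rule reg_exec_While_family)
  fix i assume i: "i < n"
  have "reg_exec m (Dec r) (S (Suc i)) ((S (Suc i))(r := i))"
    using reg_exec_Dec[of r m "S (Suc i)"] assms(1,2) i by simp
  then show "reg_exec m (Dec r ;; c) (S (Suc i)) (S i)" using assms(3)[OF i] reg_exec_Seq by blast
qed (use assms in simp)

section \<open>Transfers between registers and the Cantor pairing on registers\<close>

definition zero :: "nat \<Rightarrow> com" where "zero a = While (nz a) (Dec a)"

lemma reg_exec_zero:
  assumes "a < m"
  shows "reg_exec m (zero a) \<sigma> (\<sigma>(a := 0))"
proof -
  have "reg_exec m (zero a) (\<sigma>(a := \<sigma> a)) (\<sigma>(a := 0))"
    unfolding zero_def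
  proof (rule reg_exec_While_family[where S = "\<lambda>i. \<sigma>(a := i)"])
    fix i show "reg_exec m (Dec a) (\<sigma>(a := Suc i)) (\<sigma>(a := i))"
      using reg_exec_Dec[of a m "\<sigma>(a := Suc i)"] assms by simp
  qed (use assms in simp)
  then show ?thesis by simp
qed

definition move :: "nat \<Rightarrow> nat \<Rightarrow> com" where "move a b = While (nz a) (Dec a ;; Inc b)"

lemma reg_exec_move:
  assumes "a < m" "b < m" "a \<noteq> b"
  shows "reg_exec m (move a b) \<sigma> (\<sigma>(a := 0, b := \<sigma> b + \<sigma> a))"
proof -
  have "reg_exec m (move a b) (\<sigma>(a := \<sigma> a, b := \<sigma> b + (\<sigma> a - \<sigma> a))) (\<sigma>(a := 0, b := \<sigma> b + (\<sigma> a - 0)))"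
    unfolding move_def
  proof (rule reg_exec_loop[where S = "\<lambda>i. \<sigma>(a := i, b := \<sigma> b + (\<sigma> a - i))"])
    fix i assume "i < \<sigma> a"
    then show "reg_exec m (Inc b) ((\<sigma>(a := Suc i, b := \<sigma> b + (\<sigma> a - Suc i)))(a := i)) (\<sigma>(a := i, b := \<sigma> b + (\<sigma> a - i)))"
      using assms by (intro reg_exec_cong[OF reg_exec_Inc]) (auto simp: fun_eq_iff)
  qed (use assms in auto)
  then show ?thesis by simp
qed

definition dup :: "nat \<Rightarrow> nat \<Rightarrow> nat \<Rightarrow> com" where
  "dup a b c = While (nz a) (Dec a ;; Inc b ;; Inc c) ;; move c a"

lemma reg_exec_dup:
  assumes "a < m" "b < m" "c < m" "a \<noteq> b" "a \<noteq> c" "b \<noteq> c" "\<sigma> b = 0" "\<sigma> c = 0"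
  shows "reg_exec m (dup a b c) \<sigma> (\<sigma>(b := \<sigma> a))"
proof -
  have "reg_exec m (While (nz a) (Dec a ;; Inc b ;; Inc c))
      (\<sigma>(a := \<sigma> a, b := \<sigma> a - \<sigma> a, c := \<sigma> a - \<sigma> a)) (\<sigma>(a := 0, b := \<sigma> a - 0, c := \<sigma> a - 0))"
  proof (rule reg_exec_loop[where S = "\<lambda>i. \<sigma>(a := i, b := \<sigma> a - i, c := \<sigma> a - i)"])
    fix i assume "i < \<sigma> a"
    then show "reg_exec m (Inc b ;; Inc c) ((\<sigma>(a := Suc i, b := \<sigma> a - Suc i, c := \<sigma> a - Suc i))(a := i))
        (\<sigma>(a := i, b := \<sigma> a - i, c := \<sigma> a - i))"
      using assms by (intro reg_exec_cong[OF reg_exec_Seq[OF reg_exec_Inc reg_exec_Inc]]) (auto simp: fun_eq_iff)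
  qed (use assms in auto)
  moreover have "\<sigma>(a := \<sigma> a, b := \<sigma> a - \<sigma> a, c := \<sigma> a - \<sigma> a) = \<sigma>" using assms by (auto simp: fun_eq_iff)
  ultimately have 1: "reg_exec m (While (nz a) (Dec a ;; Inc b ;; Inc c)) \<sigma> (\<sigma>(a := 0, b := \<sigma> a, c := \<sigma> a))"
    by simp
  show ?thesis unfolding dup_def
    using assms by (intro reg_exec_cong[OF reg_exec_Seq[OF 1 reg_exec_move]]) (auto simp: fun_eq_iff)
qed

definition swap :: "nat \<Rightarrow> nat \<Rightarrow> nat \<Rightarrow> com" where
  "swap a b c = move a c ;; move b a ;; move c b"

lemma reg_exec_swap:
  assumes "a < m" "b < m" "c < m" "a \<noteq> b" "a \<noteq> c" "b \<noteq> c" "\<sigma> c = 0"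
  shows "reg_exec m (swap a b c) \<sigma> (\<sigma>(a := \<sigma> b, b := \<sigma> a))"
  unfolding swap_def using assms
  by (intro reg_exec_cong[OF reg_exec_Seq[OF reg_exec_move reg_exec_Seq[OF reg_exec_move reg_exec_move]]]) (auto simp: fun_eq_iff)

lemma prod_encode_0: "prod_encode (a, b) = 0 \<longleftrightarrow> a = 0 \<and> b = 0"
proof -
  have "prod_encode (0, 0) = 0" by (simp add: prod_encode_def)
  then show ?thesis using prod_encode_eq[of "(a, b)" "(0, 0)"] by simp
qed

text \<open>The Cantor enumeration walks along an antidiagonal from (a, b + 1) to (a + 1, b) and
  jumps from (b, 0) to (0, b + 1). Pairing and unpairing become step-by-step walks, so the registers
  need no arithmetic.\<close>

lemma prod_encode_next:
  "prod_encode (Suc a, b) = Suc (prod_encode (a, Suc b))" "prod_encode (0, Suc b) = Suc (prod_encode (b, 0))"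
  by (simp_all add: prod_encode_def)

definition unpair :: "nat \<Rightarrow> nat \<Rightarrow> nat \<Rightarrow> com" where
  "unpair r a b = While (nz r) (Dec r ;; Cond (nz b) (Dec b ;; Inc a) (move a b ;; Inc b))"

lemma reg_exec_unpair:
  assumes "a < m" "b < m" "r < m" "a \<noteq> b" "a \<noteq> r" "b \<noteq> r" "\<sigma> a = 0" "\<sigma> b = 0" "\<sigma> r = prod_encode (x, y)"
  shows "reg_exec m (unpair r a b) \<sigma> (\<sigma>(r := 0, a := x, b := y))"
proof -
  \<comment> \<open>While \<open>i\<close> steps remain to be counted down, \<open>a\<close> and
    \<open>b\<close> hold the pair with number \<open>\<sigma> r - i\<close>.\<close>
  define S where "S i = \<sigma>(r := i, a := fst (prod_decode (\<sigma> r - i)), b := snd (prod_decode (\<sigma> r - i)))" for i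
  have "prod_decode 0 = (0, 0)" using prod_encode_0[of 0 0] by (metis prod_encode_inverse)
  then have "S (\<sigma> r) = \<sigma>" using assms by (auto simp: S_def fun_eq_iff)
  moreover have "S 0 = \<sigma>(r := 0, a := x, b := y)" using assms by (simp add: S_def)
  moreover have "reg_exec m (unpair r a b) (S (\<sigma> r)) (S 0)"
    unfolding unpair_def
  proof (rule reg_exec_loop)
    fix i assume i: "i < \<sigma> r"
    obtain u v where uv: "prod_decode (\<sigma> r - Suc i) = (u, v)" by fastforce
    have *: "prod_encode (u, v) = \<sigma> r - Suc i" using uv by (metis prod_decode_inverse)
    have "\<sigma> r - i = Suc (prod_encode (u, v))" using * i by simp
    also have "\<dots> = prod_encode (if v = 0 then (0, Suc u) else (Suc u, v - 1))"
      by (cases v) (simp_all add: prod_encode_next)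
    finally have uv': "prod_decode (\<sigma> r - i) = (if v = 0 then (0, Suc u) else (Suc u, v - 1))" by simp
    show "reg_exec m (Cond (nz b) (Dec b ;; Inc a) (move a b ;; Inc b)) ((S (Suc i))(r := i)) (S i)"
    proof (rule reg_exec_Cond)
      assume "((S (Suc i))(r := i)) b \<noteq> 0"
      then have "v \<noteq> 0" using assms uv by (simp add: S_def)
      then show "reg_exec m (Dec b ;; Inc a) ((S (Suc i))(r := i)) (S i)"
        using assms uv uv' by (intro reg_exec_cong[OF reg_exec_Seq[OF reg_exec_Dec reg_exec_Inc]]) (auto simp: fun_eq_iff S_def)
    next
      assume "((S (Suc i))(r := i)) b = 0"
      then have "v = 0" using assms uv by (simp add: S_def)
      then show "reg_exec m (move a b ;; Inc b) ((S (Suc i))(r := i)) (S i)"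
        using assms uv uv' by (intro reg_exec_cong[OF reg_exec_Seq[OF reg_exec_move reg_exec_Inc]]) (auto simp: fun_eq_iff S_def)
    qed (use assms in simp)
  qed (use assms in \<open>auto simp: S_def\<close>)
  ultimately show ?thesis by simp
qed

text \<open>The same walk taken backwards to (0, 0); the number of steps, counted in
  \<open>r\<close>, is the code of the pair.\<close>

definition join :: "nat \<Rightarrow> nat \<Rightarrow> nat \<Rightarrow> com" where
  "join a b r = While (\<lambda>as. nz a as \<or> nz b as)
     (Inc r ;; Cond (nz a) (Dec a ;; Inc b) (Dec b ;; move b a))"

lemma reg_exec_join:
  assumes "a < m" "b < m" "r < m" "a \<noteq> b" "a \<noteq> r" "b \<noteq> r" "\<sigma> r = 0"
  shows "reg_exec m (join a b r) \<sigma> (\<sigma>(a := 0, b := 0, r := prod_encode (\<sigma> a, \<sigma> b)))"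
proof -
  define N where "N = prod_encode (\<sigma> a, \<sigma> b)"
  define S where "S i = \<sigma>(a := fst (prod_decode i), b := snd (prod_decode i), r := N - i)" for i
  have d0: "prod_decode 0 = (0, 0)" using prod_encode_0[of 0 0] by (metis prod_encode_inverse)
  then have "S 0 = \<sigma>(a := 0, b := 0, r := N)" by (auto simp: S_def fun_eq_iff)
  moreover have "S N = \<sigma>" using assms by (auto simp: S_def N_def fun_eq_iff)
  moreover have "reg_exec m (join a b r) (S N) (S 0)"
    unfolding join_def
  proof (rule reg_exec_While_family)
    fix i I J
    have "i = 0 \<longleftrightarrow> prod_decode i = (0, 0)" using d0 by (metis prod_decode_inverse)
    then show "(nz a (map scan (tapes_of m I (S i) J)) \<or> nz b (map scan (tapes_of m I (S i) J))) \<longleftrightarrow> i \<noteq> 0"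
      using assms by (cases "prod_decode i") (auto simp: S_def)
  next
    fix i assume i: "i < N"
    obtain u v where uv: "prod_decode i = (u, v)" by fastforce
    have *: "prod_encode (u, v) = i" using uv by (metis prod_decode_inverse)
    have "Suc i = prod_encode (if v = 0 then (0, Suc u) else (Suc u, v - 1))"
      using * by (cases v) (simp_all add: prod_encode_next)
    then have uv': "prod_decode (Suc i) = (if v = 0 then (0, Suc u) else (Suc u, v - 1))"
      by (metis prod_encode_inverse)
    let ?s = "(S (Suc i))(r := N - i)"
    have 1: "reg_exec m (Inc r) (S (Suc i)) ?s"
      using assms i by (intro reg_exec_cong[OF reg_exec_Inc]) (auto simp: S_def fun_eq_iff)
    have "reg_exec m (Cond (nz a) (Dec a ;; Inc b) (Dec b ;; move b a)) ?s (S i)"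
    proof (rule reg_exec_Cond)
      assume "?s a \<noteq> 0"
      then have "v \<noteq> 0" using assms uv' by (auto simp: S_def split: if_splits)
      then show "reg_exec m (Dec a ;; Inc b) ?s (S i)"
        using assms uv uv' by (intro reg_exec_cong[OF reg_exec_Seq[OF reg_exec_Dec reg_exec_Inc]]) (auto simp: fun_eq_iff S_def)
    next
      assume "?s a = 0"
      then have "v = 0" using assms uv' by (auto simp: S_def split: if_splits)
      then show "reg_exec m (Dec b ;; move b a) ?s (S i)"
        using assms uv uv' by (intro reg_exec_cong[OF reg_exec_Seq[OF reg_exec_Dec reg_exec_move]]) (auto simp: fun_eq_iff S_def)
    qed (use assms in simp)
    then show "reg_exec m (Inc r ;; Cond (nz a) (Dec a ;; Inc b) (Dec b ;; move b a)) (S (Suc i)) (S i)"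
      using reg_exec_Seq 1 by blast
  qed
  ultimately show ?thesis by (simp add: N_def)
qed

section \<open>Primitive recursive functions\<close>

text \<open>A unary presentation of primitive recursion: arguments are packed by Cantor pairing, and
  iteration takes the place of the recursion scheme. Each clause translates into a few register
  macros.\<close>

inductive prim :: "(nat \<Rightarrow> nat) \<Rightarrow> bool" where
  prim_id: "prim (\<lambda>x. x)"
| prim_zero: "prim (\<lambda>x. 0)"
| prim_Suc: "prim Suc"
| prim_fst: "prim (\<lambda>x. fst (prod_decode x))"
| prim_snd: "prim (\<lambda>x. snd (prod_decode x))"
| prim_comp: "prim f \<Longrightarrow> prim g \<Longrightarrow> prim (\<lambda>x. f (g x))"
| prim_pair: "prim f \<Longrightarrow> prim g \<Longrightarrow> prim (\<lambda>x. prod_encode (f x, g x))"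
| prim_iter: "prim f \<Longrightarrow> prim (\<lambda>x. (f ^^ fst (prod_decode x)) (snd (prod_decode x)))"

text \<open>Registers are used as a stack: the function acts on register \<open>r\<close>, all later ones are scratch.\<close>

definition implements :: "(nat \<Rightarrow> com) \<Rightarrow> nat \<Rightarrow> (nat \<Rightarrow> nat) \<Rightarrow> bool" where
  "implements c d f \<longleftrightarrow> (\<forall>r. (\<forall>k s. wf_com k s (c r)) \<and>
     (\<forall>m \<sigma>. r + d < m \<longrightarrow> (\<forall>i>r. \<sigma> i = 0) \<longrightarrow> reg_exec m (c r) \<sigma> (\<sigma>(r := f (\<sigma> r)))))"

lemma implements_wf: "implements c d f \<Longrightarrow> wf_com k s (c r)"
  by (simp add: implements_def)

lemma implements_rx:
  "implements c d f \<Longrightarrow> r + d < m \<Longrightarrow> (\<And>i. i > r \<Longrightarrow> \<sigma> i = 0) \<Longrightarrow> reg_exec m (c r) \<sigma> (\<sigma>(r := f (\<sigma> r)))"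
  by (simp add: implements_def)

lemma implementsI:
  assumes "\<And>r k s. wf_com k s (c r)"
    and "\<And>r m \<sigma>. r + d < m \<Longrightarrow> (\<And>i. i > r \<Longrightarrow> \<sigma> i = 0) \<Longrightarrow> reg_exec m (c r) \<sigma> (\<sigma>(r := f (\<sigma> r)))"
  shows "\<exists>c d. implements c d f"
  using assms unfolding implements_def by blast

lemma wf_macros [simp]:
  "wf_com k s (zero a)" "wf_com k s (move a b)" "wf_com k s (dup a b r)" "wf_com k s (swap a b r)"
  "wf_com k s (unpair r a b)" "wf_com k s (join a b r)"
  by (simp_all add: zero_def move_def dup_def swap_def unpair_def join_def)

text \<open>Scratch registers are returned as 0, so subprograms can share them one after the other;
  \<open>d\<close> counts how many lie above \<open>r\<close>.\<close>

lemma prim_implemented: "prim f \<Longrightarrow> \<exists>c d. implements c d f"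
proof (induction rule: prim.induct)
  case prim_id
  show ?case
    \<comment> \<open>A program without effect: register \<open>Suc r\<close> is already 0.\<close>
    by (rule implementsI[where c = "\<lambda>r. zero (Suc r)" and d = 1]) (auto intro!: reg_exec_cong[OF reg_exec_zero] simp: fun_eq_iff)
next
  case prim_zero
  show ?case by (rule implementsI[where c = zero and d = 1]) (auto intro!: reg_exec_zero)
next
  case prim_Suc
  show ?case by (rule implementsI[where c = Inc and d = 1]) (auto intro!: reg_exec_Inc)
next
  case prim_fst
  show ?case
  proof (rule implementsI[where c = "\<lambda>r. unpair r (r+1) (r+2) ;; zero (r+2) ;; move (r+1) r" and d = 2])
    fix r m :: nat and \<sigma> assume a: "r + 2 < m" "\<And>i. r < i \<Longrightarrow> \<sigma> i = (0::nat)"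
    obtain x y where xy: "prod_decode (\<sigma> r) = (x, y)" by fastforce
    then have e: "\<sigma> r = prod_encode (x, y)" by (metis prod_decode_inverse)
    show "reg_exec m (unpair r (r+1) (r+2) ;; zero (r+2) ;; move (r+1) r) \<sigma> (\<sigma>(r := fst (prod_decode (\<sigma> r))))"
      by (rule reg_exec_cong[OF reg_exec_Seq[OF reg_exec_unpair[where r = r and x = x and y = y] reg_exec_Seq[OF reg_exec_zero reg_exec_move]]])
        (use a xy e in \<open>auto simp: fun_eq_iff\<close>)
  qed simp
next
  case prim_snd
  show ?case
  proof (rule implementsI[where c = "\<lambda>r. unpair r (r+1) (r+2) ;; zero (r+1) ;; move (r+2) r" and d = 2])
    fix r m :: nat and \<sigma> assume a: "r + 2 < m" "\<And>i. r < i \<Longrightarrow> \<sigma> i = (0::nat)"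
    obtain x y where xy: "prod_decode (\<sigma> r) = (x, y)" by fastforce
    then have e: "\<sigma> r = prod_encode (x, y)" by (metis prod_decode_inverse)
    show "reg_exec m (unpair r (r+1) (r+2) ;; zero (r+1) ;; move (r+2) r) \<sigma> (\<sigma>(r := snd (prod_decode (\<sigma> r))))"
      by (rule reg_exec_cong[OF reg_exec_Seq[OF reg_exec_unpair[where r = r and x = x and y = y] reg_exec_Seq[OF reg_exec_zero reg_exec_move]]])
        (use a xy e in \<open>auto simp: fun_eq_iff\<close>)
  qed simp
next
  case (prim_comp f g)
  obtain c d where f: "implements c d f" using prim_comp.IH(1) by blast
  obtain c' d' where g: "implements c' d' g" using prim_comp.IH(2) by blast
  show ?case
  proof (rule implementsI[where c = "\<lambda>r. c' r ;; c r" and d = "d + d'"])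
    fix r m :: nat and \<sigma> assume a: "r + (d + d') < m" "\<And>i. r < i \<Longrightarrow> \<sigma> i = (0::nat)"
    have "reg_exec m (c' r) \<sigma> (\<sigma>(r := g (\<sigma> r)))" by (rule implements_rx[OF g]) (use a in auto)
    moreover have "reg_exec m (c r) (\<sigma>(r := g (\<sigma> r))) (\<sigma>(r := f (g (\<sigma> r))))"
      by (rule reg_exec_cong[OF implements_rx[OF f]]) (use a in auto)
    ultimately show "reg_exec m (c' r ;; c r) \<sigma> (\<sigma>(r := f (g (\<sigma> r))))" by (rule reg_exec_Seq)
  qed (simp add: implements_wf[OF f] implements_wf[OF g])
next
  case (prim_pair f g)
  obtain c d where f: "implements c d f" using prim_pair.IH(1) by blast
  obtain c' d' where g: "implements c' d' g" using prim_pair.IH(2) by blast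
  show ?case
  proof (rule implementsI[where d = "d + d' + 3" and
        c = "\<lambda>r. dup r (r+1) (r+2) ;; c' (r+1) ;; swap r (r+1) (r+2) ;; c (r+1) ;;
                join (r+1) r (r+2) ;; move (r+2) r"])
    fix r m :: nat and \<sigma> assume a: "r + (d + d' + 3) < m" "\<And>i. r < i \<Longrightarrow> \<sigma> i = (0::nat)"
    define x where "x = \<sigma> r"
    have 1: "reg_exec m (dup r (r+1) (r+2)) \<sigma> (\<sigma>(r+1 := x))"
      by (rule reg_exec_cong[OF reg_exec_dup]) (use a in \<open>auto simp: x_def\<close>)
    have 2: "reg_exec m (c' (r+1)) (\<sigma>(r+1 := x)) (\<sigma>(r+1 := g x))"
      by (rule reg_exec_cong[OF implements_rx[OF g]]) (use a in auto)
    \<comment> \<open>Subprograms require everything above their register to be 0, so the argument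
      is moved above the finished value \<open>g x\<close> before \<open>f\<close> runs.\<close>
    have 3: "reg_exec m (swap r (r+1) (r+2)) (\<sigma>(r+1 := g x)) (\<sigma>(r := g x, r+1 := x))"
      by (rule reg_exec_cong[OF reg_exec_swap]) (use a in \<open>auto simp: x_def\<close>)
    have 4: "reg_exec m (c (r+1)) (\<sigma>(r := g x, r+1 := x)) (\<sigma>(r := g x, r+1 := f x))"
      by (rule reg_exec_cong[OF implements_rx[OF f]]) (use a in auto)
    have 5: "reg_exec m (join (r+1) r (r+2)) (\<sigma>(r := g x, r+1 := f x)) (\<sigma>(r := 0, r+2 := prod_encode (f x, g x)))"
      by (rule reg_exec_cong[OF reg_exec_join]) (use a in \<open>auto simp: fun_eq_iff\<close>)
    have 6: "reg_exec m (move (r+2) r) (\<sigma>(r := 0, r+2 := prod_encode (f x, g x))) (\<sigma>(r := prod_encode (f x, g x)))"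
      by (rule reg_exec_cong[OF reg_exec_move]) (use a in \<open>auto simp: fun_eq_iff\<close>)
    show "reg_exec m (dup r (r+1) (r+2) ;; c' (r+1) ;; swap r (r+1) (r+2) ;; c (r+1) ;;
        join (r+1) r (r+2) ;; move (r+2) r) \<sigma> (\<sigma>(r := prod_encode (f (\<sigma> r), g (\<sigma> r))))"
      using reg_exec_Seq[OF 1 reg_exec_Seq[OF 2 reg_exec_Seq[OF 3 reg_exec_Seq[OF 4 reg_exec_Seq[OF 5 6]]]]] by (simp add: x_def)
  qed (simp add: implements_wf[OF f] implements_wf[OF g])
next
  case (prim_iter f)
  obtain c d where f: "implements c d f" using prim_iter.IH by blast
  show ?case
  proof (rule implementsI[where d = "d + 3" and
        c = "\<lambda>r. unpair r (r+1) (r+2) ;; While (nz (r+1)) (Dec (r+1) ;; c (r+2)) ;; move (r+2) r"])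
    fix r m :: nat and \<sigma> assume a: "r + (d + 3) < m" "\<And>i. r < i \<Longrightarrow> \<sigma> i = (0::nat)"
    obtain x y where xy: "prod_decode (\<sigma> r) = (x, y)" by fastforce
    then have e: "\<sigma> r = prod_encode (x, y)" by (metis prod_decode_inverse)
    have 1: "reg_exec m (unpair r (r+1) (r+2)) \<sigma> (\<sigma>(r := 0, r+1 := x, r+2 := y))"
      by (rule reg_exec_unpair) (use a e in auto)
    define S where "S i = \<sigma>(r := 0, r+1 := i, r+2 := (f ^^ (x - i)) y)" for i
    have "reg_exec m (While (nz (r+1)) (Dec (r+1) ;; c (r+2))) (S x) (S 0)"
    proof (rule reg_exec_loop)
      fix i assume i: "i < x"
      then have "x - i = Suc (x - Suc i)" by simp
      then show "reg_exec m (c (r+2)) ((S (Suc i))(r+1 := i)) (S i)"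
        using a by (intro reg_exec_cong[OF implements_rx[OF f]]) (auto simp: S_def fun_eq_iff)
    qed (use a in \<open>auto simp: S_def\<close>)
    then have 2: "reg_exec m (While (nz (r+1)) (Dec (r+1) ;; c (r+2))) (\<sigma>(r := 0, r+1 := x, r+2 := y))
        (\<sigma>(r := 0, r+1 := 0, r+2 := (f ^^ x) y))"
      by (simp add: S_def)
    show "reg_exec m (unpair r (r+1) (r+2) ;; While (nz (r+1)) (Dec (r+1) ;; c (r+2)) ;; move (r+2) r) \<sigma>
        (\<sigma>(r := (f ^^ fst (prod_decode (\<sigma> r))) (snd (prod_decode (\<sigma> r)))))"
      by (rule reg_exec_cong[OF reg_exec_Seq[OF 1 reg_exec_Seq[OF 2 reg_exec_move]]]) (use a xy in \<open>auto simp: fun_eq_iff\<close>)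
  qed (simp add: implements_wf[OF f])
qed

section \<open>Primitive recursive functions on encoded types\<close>

class enc =
  fixes enc :: "'a \<Rightarrow> nat"
  assumes enc_inject: "enc x = enc y \<longleftrightarrow> x = y"

instantiation nat :: enc
begin
definition enc_nat :: "nat \<Rightarrow> nat" where "enc_nat n = n"
instance by standard (simp add: enc_nat_def)
end

instantiation bool :: enc
begin
definition enc_bool :: "bool \<Rightarrow> nat" where "enc_bool b = (if b then 1 else 0)"
instance by standard (simp add: enc_bool_def)
end

instantiation prod :: (enc, enc) enc
begin
definition enc_prod :: "'a \<times> 'b \<Rightarrow> nat" where "enc_prod p = prod_encode (enc (fst p), enc (snd p))"
instance by standard (auto simp: enc_prod_def enc_inject)
end

instantiation option :: (enc) enc
begin
definition enc_option :: "'a option \<Rightarrow> nat" where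
  "enc_option x = (case x of None \<Rightarrow> 0 | Some y \<Rightarrow> Suc (enc y))"
instance by standard (auto simp: enc_option_def enc_inject split: option.splits)
end

instantiation list :: (enc) enc
begin
primrec enc_list :: "'a list \<Rightarrow> nat" where
  "enc_list [] = 0"
| "enc_list (x # xs) = Suc (prod_encode (enc x, enc_list xs))"
instance
proof
  fix xs ys :: "'a list"
  show "enc xs = enc ys \<longleftrightarrow> xs = ys"
  proof (induction xs arbitrary: ys)
    case Nil
    show ?case by (cases ys) auto
  next
    case (Cons x xs)
    then show ?case by (cases ys) (auto simp: enc_inject)
  qed
qed
end

instantiation int :: enc
begin
definition enc_int :: "int \<Rightarrow> nat" where "enc_int i = prod_encode (nat i, nat (- i))"
instance by standard (auto simp: enc_int_def)
end

instantiation dir :: enc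
begin
definition enc_dir :: "dir \<Rightarrow> nat" where "enc_dir d = (case d of Lft \<Rightarrow> 0 | Stay \<Rightarrow> 1 | Rgt \<Rightarrow> 2)"
instance by standard (auto simp: enc_dir_def split: dir.splits)
end

text \<open>The witness is constrained only on codes and may do anything elsewhere. Encodings that
  are not onto, such as those of \<open>bool\<close> and \<open>int\<close>, are therefore
  harmless.\<close>

definition pr :: "('a::enc \<Rightarrow> 'b::enc) \<Rightarrow> bool" where
  "pr f \<longleftrightarrow> (\<exists>g. prim g \<and> (\<forall>x. g (enc x) = enc (f x)))"

lemma prI: "prim g \<Longrightarrow> (\<And>x. g (enc x) = enc (f x)) \<Longrightarrow> pr f"
  unfolding pr_def by blast

lemma prim_const: "prim (\<lambda>x. k)"
proof (induction k)
  case (Suc k)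
  then show ?case using prim_comp[OF prim_Suc Suc] by simp
qed (rule prim_zero)

named_theorems pr_intros

lemma pr_const [pr_intros]: "pr (\<lambda>x. c)"
  by (rule prI[OF prim_const[of "enc c"]]) simp

lemma pr_id [pr_intros]: "pr (\<lambda>x. x)"
  by (rule prI[OF prim_id]) simp

lemma pr_comp: "pr f \<Longrightarrow> pr g \<Longrightarrow> pr (\<lambda>x. f (g x))"
  unfolding pr_def
proof (elim exE conjE)
  fix f' g' assume "prim f'" "\<forall>x. f' (enc x) = enc (f x)" "prim g'" "\<forall>x. g' (enc x) = enc (g x)"
  then show "\<exists>h. prim h \<and> (\<forall>x. h (enc x) = enc (f (g x)))"
    by (intro exI[of _ "\<lambda>x. f' (g' x)"]) (simp add: prim_comp)
qed

lemma pr_Pair [pr_intros]: "pr f \<Longrightarrow> pr g \<Longrightarrow> pr (\<lambda>x. (f x, g x))"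
  unfolding pr_def
proof (elim exE conjE)
  fix f' g' assume "prim f'" "\<forall>x. f' (enc x) = enc (f x)" "prim g'" "\<forall>x. g' (enc x) = enc (g x)"
  then show "\<exists>h. prim h \<and> (\<forall>x. h (enc x) = enc (f x, g x))"
    by (intro exI[of _ "\<lambda>x. prod_encode (f' x, g' x)"]) (simp add: prim_pair enc_prod_def)
qed

lemma pr_fst [pr_intros]: "pr f \<Longrightarrow> pr (\<lambda>x. fst (f x))"
  by (erule pr_comp[rotated]) (rule prI[OF prim_fst], simp add: enc_prod_def)

lemma pr_snd [pr_intros]: "pr f \<Longrightarrow> pr (\<lambda>x. snd (f x))"
  by (erule pr_comp[rotated]) (rule prI[OF prim_snd], simp add: enc_prod_def)

lemma pr_Suc [pr_intros]: "pr f \<Longrightarrow> pr (\<lambda>x. Suc (f x))"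
  by (erule pr_comp[rotated]) (rule prI[OF prim_Suc], simp add: enc_nat_def)

text \<open>Only codes matter, so a function may be replaced by one of another type whose values
  have the same codes. Constructors and coercions are obtained this way.\<close>

lemma pr_recode:
  assumes "pr (f :: 'a::enc \<Rightarrow> 'b::enc)" "\<And>x. enc (f x) = enc (g x :: 'c::enc)"
  shows "pr g"
  using assms unfolding pr_def by simp

lemma pr_funpow [pr_intros]:
  fixes f :: "'a::enc \<Rightarrow> 'b::enc \<Rightarrow> 'b"
  assumes f: "pr (\<lambda>p. f (fst p) (snd p))" and n: "pr n" and a: "pr a"
  shows "pr (\<lambda>x. (f x ^^ n x) (a x))"
proof -
  \<comment> \<open>The iteration clause of \<open>prim\<close> has no parameters, so
    \<open>x\<close> travels along unchanged in the iterated pair.\<close>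
  define F where "F p = (fst p, f (fst p) (snd p))" for p
  have "pr F" unfolding F_def by (intro pr_Pair pr_fst pr_id f)
  then obtain G where G: "prim G" "\<And>p. G (enc p) = enc (F p)" unfolding pr_def by blast
  have it: "(G ^^ k) (enc p) = enc ((F ^^ k) p)" for k p
    by (induction k) (simp_all add: G(2))
  have "pr (\<lambda>p. (F ^^ fst p) (snd p))"
  proof (rule prI[OF prim_iter[OF G(1)]])
    fix p :: "nat \<times> 'a \<times> 'b"
    have "prod_decode (enc p) = (fst p, enc (snd p))"
      by (simp only: enc_prod_def[of p] enc_nat_def prod_encode_inverse)
    then show "(G ^^ fst (prod_decode (enc p))) (snd (prod_decode (enc p))) = enc ((F ^^ fst p) (snd p))"
      using it by simp
  qed
  moreover have "pr (\<lambda>x. (n x, (x, a x)))" by (intro pr_Pair n pr_id a)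
  ultimately have "pr (\<lambda>x. (\<lambda>p. (F ^^ fst p) (snd p)) (n x, (x, a x)))" by (rule pr_comp)
  from pr_snd[OF this] have pr: "pr (\<lambda>x. snd ((F ^^ n x) (x, a x)))" by simp
  have "(F ^^ k) (x, b) = (x, (f x ^^ k) b)" for k x b
    by (induction k) (simp_all add: F_def)
  with pr show ?thesis by simp
qed

section \<open>Arithmetic, truth values and case distinctions\<close>

lemma pr_pred: "pr (\<lambda>n::nat. n - 1)"
proof -
  \<comment> \<open>Kleene's device: iterating (a, b) -> (a + 1, a) leaves the predecessor of the
    counter in the second component; the start (0, 0) gives the truncated value at 0.\<close>
  have "pr (\<lambda>n::nat. snd (((\<lambda>p. (Suc (fst p), fst p)) ^^ n) (0::nat, 0::nat)))" by (intro pr_intros)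
  moreover have "((\<lambda>p. (Suc (fst p), fst p)) ^^ n) (0::nat, 0::nat) = (n, n - 1)" for n
    by (induction n) auto
  ultimately show ?thesis by simp
qed

lemma pr_add [pr_intros]:
  assumes "pr f" "pr g" shows "pr (\<lambda>x. f x + g x :: nat)"
proof -
  have "pr (\<lambda>x. (Suc ^^ f x) (g x))" by (intro pr_intros assms)
  moreover have "(Suc ^^ m) n = m + n" for m n by (induction m) auto
  ultimately show ?thesis by simp
qed

lemma pr_diff [pr_intros]:
  assumes "pr f" "pr g" shows "pr (\<lambda>x. f x - g x :: nat)"
proof -
  have "pr (\<lambda>x. ((\<lambda>n. n - 1) ^^ g x) (f x))" by (intro pr_intros assms pr_comp[OF pr_pred])
  moreover have "((\<lambda>n. n - 1) ^^ m) n = n - m" for m n :: nat by (induction m) auto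
  ultimately show ?thesis by simp
qed

lemma pr_mult [pr_intros]:
  assumes "pr f" "pr g" shows "pr (\<lambda>x. f x * g x :: nat)"
proof -
  have "pr (\<lambda>x. ((\<lambda>n. n + f x) ^^ g x) 0)" by (intro pr_intros assms pr_comp[OF assms(1)])
  moreover have "((\<lambda>n. n + a) ^^ m) 0 = a * m" for m a :: nat by (induction m) auto
  ultimately show ?thesis by simp
qed

lemma pr_power2 [pr_intros]:
  assumes "pr f" shows "pr (\<lambda>x. 2 ^ f x :: nat)"
proof -
  have "pr (\<lambda>x. ((\<lambda>n. n + n) ^^ f x) (1::nat))" by (intro pr_intros assms)
  moreover have "((\<lambda>n. n + n) ^^ m) 1 = (2::nat) ^ m" for m by (induction m) auto
  ultimately show ?thesis by simp
qed

lemma pr_enc: "pr (\<lambda>x. enc x)"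
  by (rule prI[OF prim_id]) (simp add: enc_nat_def)

lemma pr_is_zero: "pr (\<lambda>n::nat. n = 0)"
proof -
  have "pr (\<lambda>n::nat. 1 - n)" by (intro pr_intros)
  then show ?thesis by (rule pr_recode) (simp add: enc_nat_def enc_bool_def)
qed

lemma pr_if [pr_intros]:
  assumes b: "pr b" and f: "pr f" and g: "pr g"
  shows "pr (\<lambda>x. if b x then f x else g x)"
proof -
  have e: "pr (\<lambda>x. enc (b x))" by (rule pr_comp[OF pr_enc b])
  \<comment> \<open>The code of the test is an iteration count, 0 or 1, which decides whether
    \<open>f x\<close> is moved over the default \<open>g x\<close>.\<close>
  have "pr (\<lambda>x. fst (((\<lambda>p. (snd p, snd p)) ^^ enc (b x)) (g x, f x)))"
    by (intro pr_intros f g e)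
  moreover have "fst (((\<lambda>p. (snd p, snd p)) ^^ enc (b x)) (g x, f x)) = (if b x then f x else g x)" for x
    by (simp add: enc_bool_def)
  ultimately show ?thesis by simp
qed

lemma pr_not [pr_intros]: "pr b \<Longrightarrow> pr (\<lambda>x. \<not> b x)"
proof -
  assume "pr b"
  then have "pr (\<lambda>x. enc (b x) = 0)" by (rule pr_comp[OF pr_is_zero pr_comp[OF pr_enc]])
  moreover have "enc (b x) = 0 \<longleftrightarrow> \<not> b x" for x by (simp add: enc_bool_def)
  ultimately show ?thesis by simp
qed

lemma pr_conj [pr_intros]: "pr b \<Longrightarrow> pr c \<Longrightarrow> pr (\<lambda>x. b x \<and> c x)"
proof -
  assume "pr b" "pr c"
  then have "pr (\<lambda>x. if b x then c x else False)" by (intro pr_intros)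
  moreover have "(if b x then c x else False) \<longleftrightarrow> b x \<and> c x" for x by simp
  ultimately show ?thesis by simp
qed

lemma pr_disj [pr_intros]:
  assumes "pr b" "pr c" shows "pr (\<lambda>x. b x \<or> c x)"
proof -
  have "pr (\<lambda>x. \<not> (\<not> b x \<and> \<not> c x))" by (intro pr_intros assms)
  then show ?thesis by simp
qed

lemma pr_imp [pr_intros]:
  assumes "pr b" "pr c" shows "pr (\<lambda>x. b x \<longrightarrow> c x)"
proof -
  have "pr (\<lambda>x. \<not> b x \<or> c x)" by (intro pr_intros assms)
  then show ?thesis by (simp only: imp_conv_disj)
qed

lemma pr_le [pr_intros]:
  assumes "pr f" "pr g" shows "pr (\<lambda>x. f x \<le> (g x :: nat))"
proof -
  have "pr (\<lambda>x. f x - g x = 0)" by (rule pr_comp[OF pr_is_zero, where g = "\<lambda>x. f x - g x"]) (intro pr_intros assms)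
  then show ?thesis by simp
qed

lemma pr_eq [pr_intros]:
  assumes "pr f" "pr g" shows "pr (\<lambda>x. f x = g x)"
proof -
  have "pr (\<lambda>x. enc (f x) \<le> enc (g x) \<and> enc (g x) \<le> enc (f x))"
    by (intro pr_intros pr_comp[OF pr_enc] assms)
  moreover have "enc (f x) \<le> enc (g x) \<and> enc (g x) \<le> enc (f x) \<longleftrightarrow> f x = g x" for x
    using enc_inject[of "f x" "g x"] by auto
  ultimately show ?thesis by simp
qed

section \<open>Options and lists\<close>

lemma pr_Some [pr_intros]: "pr f \<Longrightarrow> pr (\<lambda>x. Some (f x))"
proof -
  assume "pr f"
  then have "pr (\<lambda>x. Suc (enc (f x)))" by (intro pr_intros pr_comp[OF pr_enc])
  then show ?thesis by (rule pr_recode) (simp add: enc_nat_def enc_option_def)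
qed

lemma pr_the: "pr (\<lambda>x. case x of None \<Rightarrow> c | Some y \<Rightarrow> y)"
proof -
  obtain n where n: "enc c = n" by simp
  have "pr (\<lambda>x::'a option. if enc x = 0 then n else enc x - 1)"
    by (intro pr_intros pr_comp[OF pr_enc])
  then show ?thesis
    by (rule pr_recode) (auto simp: n enc_nat_def enc_option_def split: option.splits)
qed

lemma pr_case_option [pr_intros]:
  assumes f: "pr f" and g: "pr g" and h: "pr (\<lambda>p. h (fst p) (snd p))"
  shows "pr (\<lambda>x. case f x of None \<Rightarrow> g x | Some y \<Rightarrow> h x y)"
proof -
  have "pr (\<lambda>x. case f x of None \<Rightarrow> undefined | Some y \<Rightarrow> y)" by (rule pr_comp[OF pr_the f])
  then have "pr (\<lambda>x. (\<lambda>p. h (fst p) (snd p)) (x, case f x of None \<Rightarrow> undefined | Some y \<Rightarrow> y))"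
    by (intro pr_comp[OF h] pr_Pair pr_id)
  then have "pr (\<lambda>x. if f x = None then g x else h x (case f x of None \<Rightarrow> undefined | Some y \<Rightarrow> y))"
    by (intro pr_if pr_eq f g pr_const) simp
  moreover have "(if f x = None then g x else h x (case f x of None \<Rightarrow> undefined | Some y \<Rightarrow> y)) =
      (case f x of None \<Rightarrow> g x | Some y \<Rightarrow> h x y)" for x
    by (auto split: option.splits)
  ultimately show ?thesis by simp
qed

lemma pr_Cons [pr_intros]: "pr f \<Longrightarrow> pr g \<Longrightarrow> pr (\<lambda>x. f x # g x)"
proof -
  assume "pr f" "pr g"
  then have "pr (\<lambda>x. Suc (enc (f x, g x)))" by (intro pr_intros pr_comp[OF pr_enc])
  then show ?thesis by (rule pr_recode) (simp add: enc_nat_def enc_prod_def)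
qed

lemma pr_uncons: "pr (\<lambda>xs. case xs of [] \<Rightarrow> None | y # ys \<Rightarrow> Some (y, ys))"
  by (rule pr_recode[OF pr_enc]) (auto simp: enc_option_def enc_nat_def enc_prod_def split: list.splits)

lemma pr_case_list [pr_intros]:
  assumes f: "pr f" and g: "pr g" and h: "pr (\<lambda>p. h (fst p) (fst (snd p)) (snd (snd p)))"
  shows "pr (\<lambda>x. case f x of [] \<Rightarrow> g x | y # ys \<Rightarrow> h x y ys)"
proof -
  have "pr (\<lambda>x. case (case f x of [] \<Rightarrow> None | y # ys \<Rightarrow> Some (y, ys)) of None \<Rightarrow> g x | Some p \<Rightarrow> h x (fst p) (snd p))"
    by (intro pr_case_option pr_comp[OF pr_uncons f] g) (use h in simp)
  moreover have "(case (case f x of [] \<Rightarrow> None | y # ys \<Rightarrow> Some (y, ys)) of None \<Rightarrow> g x | Some p \<Rightarrow> h x (fst p) (snd p)) =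
      (case f x of [] \<Rightarrow> g x | y # ys \<Rightarrow> h x y ys)" for x
    by (auto split: list.splits)
  ultimately show ?thesis by simp
qed

text \<open>This provides an iteration count for \<open>pr_fold\<close> before \<open>length\<close>
  is available: the code of a list is at least its length, and surplus iterations leave the empty
  list alone.\<close>

lemma length_le_enc: "length xs \<le> enc xs"
proof (induction xs)
  case (Cons x xs)
  have "enc xs \<le> prod_encode (enc x, enc xs)" by (rule le_prod_encode_2)
  then show ?case using Cons by simp
qed simp

lemma pr_fold [pr_intros]:
  assumes f: "pr (\<lambda>p. f (fst p) (fst (snd p)) (snd (snd p)))" and xs: "pr xs" and a: "pr a"
  shows "pr (\<lambda>x. fold (f x) (xs x) (a x))"
proof -
  define F where "F x s = (case fst s of [] \<Rightarrow> s | y # ys \<Rightarrow> (ys, f x y (snd s)))" for x s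
  have "pr (\<lambda>p. F (fst p) (snd p))"
  proof -
    have "pr (\<lambda>p. (\<lambda>p. f (fst p) (fst (snd p)) (snd (snd p)))
        (fst (fst p), fst (snd p), snd (snd (fst p))))"
      by (rule pr_comp[OF f]) (intro pr_intros)
    then show ?thesis unfolding F_def
      by (intro pr_case_list pr_Pair pr_fst pr_snd pr_id) simp
  qed
  then have pr: "pr (\<lambda>x. snd ((F x ^^ enc (xs x)) (xs x, a x)))"
    by (intro pr_intros xs a pr_comp[OF pr_enc])
  have "length l \<le> n \<Longrightarrow> (F x ^^ n) (l, b) = ([], fold (f x) l b)" for x l b n
  proof (induction n arbitrary: l b)
    case (Suc n)
    have nil: "(F x ^^ k) ([], b) = ([], b)" for k by (induction k) (auto simp: F_def)
    have step: "F x (y # ys, b) = (ys, f x y b)" for y ys by (simp add: F_def)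
    show ?case
    proof (cases l)
      case (Cons y ys)
      then have "(F x ^^ n) (ys, f x y b) = ([], fold (f x) ys (f x y b))" using Suc by simp
      then show ?thesis using Cons by (simp add: funpow_Suc_right step del: funpow.simps)
    qed (use nil[of "Suc n"] in simp)
  qed simp
  from this[OF length_le_enc] have "snd ((F x ^^ enc (xs x)) (xs x, a x)) = fold (f x) (xs x) (a x)" for x
    by simp
  with pr show ?thesis by simp
qed

lemma pr_comp2:
  assumes h: "pr (\<lambda>p. h (fst p) (snd p))" and f: "pr f" and g: "pr g"
  shows "pr (\<lambda>x. h (f x) (g x))"
proof -
  have "pr (\<lambda>x. (\<lambda>p. h (fst p) (snd p)) (f x, g x))" by (rule pr_comp[OF h pr_Pair[OF f g]])
  then show ?thesis by simp
qed

lemma pr_length [pr_intros]: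
  assumes "pr xs" shows "pr (\<lambda>x. length (xs x))"
proof -
  have "pr (\<lambda>x. fold (\<lambda>_ n. Suc n) (xs x) 0)" by (intro pr_intros assms)
  moreover have "fold (\<lambda>_ n. Suc n) l n = n + length l" for l :: "'b list" and n
    by (induction l arbitrary: n) auto
  ultimately show ?thesis by simp
qed

lemma pr_rev [pr_intros]:
  assumes "pr xs" shows "pr (\<lambda>x. rev (xs x))"
proof -
  have "pr (\<lambda>x. fold Cons (xs x) [])" by (intro pr_intros assms)
  then show ?thesis by (simp add: fold_Cons_rev)
qed

lemma pr_append [pr_intros]:
  assumes "pr xs" "pr ys" shows "pr (\<lambda>x. xs x @ ys x)"
proof -
  have "pr (\<lambda>x. fold Cons (rev (xs x)) (ys x))" by (intro pr_intros assms)
  then show ?thesis by (simp add: fold_Cons_rev)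
qed

lemma pr_map [pr_intros]:
  assumes f: "pr (\<lambda>p. f (fst p) (snd p))" and xs: "pr xs"
  shows "pr (\<lambda>x. map (f x) (xs x))"
proof -
  have "pr (\<lambda>p. f (fst p) (fst (snd p)))"
    by (rule pr_comp2[OF f]) (intro pr_intros)+
  then have "pr (\<lambda>x. rev (fold (\<lambda>y acc. f x y # acc) (xs x) []))" by (intro pr_intros xs)
  moreover have "fold (\<lambda>y acc. f x y # acc) l a = rev (map (f x) l) @ a" for x l a
    by (induction l arbitrary: a) auto
  ultimately show ?thesis by simp
qed

lemma pr_filter [pr_intros]:
  assumes f: "pr (\<lambda>p. P (fst p) (snd p))" and xs: "pr xs"
  shows "pr (\<lambda>x. filter (P x) (xs x))"
proof -
  have "pr (\<lambda>p. P (fst p) (fst (snd p)))"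
    by (rule pr_comp2[OF f]) (intro pr_intros)+
  then have "pr (\<lambda>x. rev (fold (\<lambda>y acc. if P x y then y # acc else acc) (xs x) []))" by (intro pr_intros xs)
  moreover have "fold (\<lambda>y acc. if P x y then y # acc else acc) l a = rev (filter (P x) l) @ a" for x l a
    by (induction l arbitrary: a) auto
  ultimately show ?thesis by simp
qed

lemma pr_ball [pr_intros]:
  assumes f: "pr (\<lambda>p. P (fst p) (snd p))" and xs: "pr xs"
  shows "pr (\<lambda>x. \<forall>y\<in>set (xs x). P x y)"
proof -
  have "pr (\<lambda>x. filter (\<lambda>y. \<not> P x y) (xs x) = [])" by (intro pr_intros f xs)
  then show ?thesis by (simp add: filter_empty_conv)
qed

lemma pr_bex [pr_intros]:
  assumes f: "pr (\<lambda>p. P (fst p) (snd p))" and xs: "pr xs"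
  shows "pr (\<lambda>x. \<exists>y\<in>set (xs x). P x y)"
proof -
  have "pr (\<lambda>x. \<not> (\<forall>y\<in>set (xs x). \<not> P x y))" by (intro pr_intros f xs)
  then show ?thesis by simp
qed

lemma pr_mem [pr_intros]:
  assumes f: "pr f" and xs: "pr xs"
  shows "pr (\<lambda>x. f x \<in> set (xs x))"
proof -
  have "pr (\<lambda>x. \<exists>y\<in>set (xs x). y = f x)" by (intro pr_intros xs pr_comp[OF f])
  then show ?thesis by simp
qed

lemma pr_concat [pr_intros]:
  assumes "pr xs" shows "pr (\<lambda>x. concat (xs x))"
proof -
  have "pr (\<lambda>x. fold (\<lambda>l a. a @ l) (xs x) [])" by (intro pr_intros assms)
  moreover have "fold (\<lambda>l a. a @ l) ls a = a @ concat ls" for ls and a :: "'b list"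
    by (induction ls arbitrary: a) auto
  ultimately show ?thesis by simp
qed

lemma pr_sum_list [pr_intros]:
  assumes "pr xs" shows "pr (\<lambda>x. sum_list (xs x) :: nat)"
proof -
  have "pr (\<lambda>x. fold (\<lambda>l a. l + a) (xs x) (0::nat))" by (intro pr_intros assms)
  moreover have "fold (\<lambda>l a. l + a) ls a = sum_list ls + a" for ls and a :: nat
    by (induction ls arbitrary: a) auto
  ultimately show ?thesis by simp
qed

lemma pr_upt [pr_intros]:
  assumes "pr n" shows "pr (\<lambda>x. [0..<n x])"
proof -
  have "pr (\<lambda>x. ((\<lambda>l. l @ [length l]) ^^ n x) [])" by (intro pr_intros assms)
  moreover have "((\<lambda>l. l @ [length l]) ^^ k) [] = [0..<k]" for k
    by (induction k) auto
  ultimately show ?thesis by simp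
qed

lemma pr_replicate [pr_intros]:
  assumes "pr n" "pr c" shows "pr (\<lambda>x. replicate (n x) (c x))"
proof -
  have "pr (\<lambda>x. ((\<lambda>l. c x # l) ^^ n x) [])" by (intro pr_intros assms pr_comp[OF assms(2)])
  moreover have "((\<lambda>l. b # l) ^^ k) [] = replicate k b" for k and b :: 'b
    by (induction k) auto
  ultimately show ?thesis by simp
qed

lemma pr_zip [pr_intros]:
  assumes "pr xs" "pr ys" shows "pr (\<lambda>x. zip (xs x) (ys x))"
proof -
  define F where "F a s = (case fst s of [] \<Rightarrow> s | y # ys \<Rightarrow> (ys, (a, y) # snd s))"
    for a :: 'b and s :: "'c list \<times> ('b \<times> 'c) list"
  have "pr (\<lambda>x. rev (snd (fold F (xs x) (ys x, []))))"
    unfolding F_def by (intro pr_intros assms)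
  moreover have "snd (fold F l (l', a)) = rev (zip l l') @ a" for l l' a
  proof (induction l arbitrary: l' a)
    case (Cons b l)
    have "fold F l ([], a) = ([], a)" for a by (induction l) (auto simp: F_def)
    then show ?case using Cons by (cases l') (auto simp: F_def)
  qed simp
  ultimately show ?thesis by simp
qed

lemma pr_map_of [pr_intros]:
  fixes xs :: "'a::enc \<Rightarrow> ('b::enc \<times> 'c::enc) list"
  assumes "pr xs" "pr k" shows "pr (\<lambda>x. map_of (xs x) (k x))"
proof -
  have "pr (\<lambda>x. fold (\<lambda>p a. if a = None \<and> fst p = k x then Some (snd p) else a) (xs x) None)"
    by (intro pr_intros assms pr_comp[OF assms(2)])
  moreover have "fold (\<lambda>p a. if a = None \<and> fst p = c then Some (snd p) else a) l a =
      (if a = None then map_of l c else a)" for l :: "('b \<times> 'c) list" and a c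
    by (induction l arbitrary: a) (auto split: option.splits)
  ultimately show ?thesis by simp
qed

section \<open>Integers and head movements\<close>

lemma pr_int [pr_intros]:
  assumes "pr f" shows "pr (\<lambda>x. int (f x))"
proof -
  have "pr (\<lambda>x. (f x, 0::nat))" by (intro pr_intros assms)
  then show ?thesis by (rule pr_recode) (simp add: enc_prod_def enc_int_def enc_nat_def)
qed

lemma pr_nat [pr_intros]: "pr f \<Longrightarrow> pr (\<lambda>x. nat (f x))"
  by (erule pr_comp[rotated]) (rule prI[OF prim_fst], simp add: enc_int_def enc_nat_def)

lemma pr_nat_uminus [pr_intros]: "pr f \<Longrightarrow> pr (\<lambda>x. nat (- f x))"
  by (erule pr_comp[rotated]) (rule prI[OF prim_snd], simp add: enc_int_def enc_nat_def)

text \<open>One of the two truncated differences is always 0, so the pair of both is already the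
  code of the integer difference.\<close>

lemma pr_int_diff:
  assumes "pr f" "pr g" shows "pr (\<lambda>x. int (f x) - int (g x))"
proof -
  have "pr (\<lambda>x. (f x - g x, g x - f x))" by (intro pr_intros assms)
  moreover have "nat (int a - int b) = a - b" "nat (- (int a - int b)) = b - a" for a b by simp_all
  then have "enc (a - b, b - a) = enc (int a - int b)" for a b
    unfolding enc_prod_def enc_int_def enc_nat_def by simp
  ultimately show ?thesis by (rule pr_recode)
qed

lemma pr_shift [pr_intros]:
  assumes "pr f" "pr d" shows "pr (\<lambda>x. f x + shift (d x))"
proof -
  have "pr (\<lambda>x. int (nat (f x) + (if d x = Rgt then 1 else 0)) - int (nat (- f x) + (if d x = Lft then 1 else 0)))"
    by (intro pr_int_diff pr_intros assms)
  moreover have "int (nat i + (if e = Rgt then 1 else 0)) - int (nat (- i) + (if e = Lft then 1 else 0)) = i + shift e" for i e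
    by (cases e) auto
  ultimately show ?thesis by simp
qed

section \<open>Turing machines are primitive recursively simulable\<close>

text \<open>A tape is represented by the list of its write operations (latest first) and the head position.\<close>

type_synonym rtape = "(int \<times> nat) list \<times> int"

definition cell :: "(int \<times> nat) list \<Rightarrow> int \<Rightarrow> nat" where
  "cell l i = (case map_of l i of None \<Rightarrow> 0 | Some a \<Rightarrow> a)"

definition abs_tape :: "rtape \<Rightarrow> tape" where
  "abs_tape t = (cell (fst t), snd t)"

definition abs_config :: "nat \<times> rtape list \<Rightarrow> config" where
  "abs_config c = (fst c, map abs_tape (snd c))"

definition rscan :: "rtape \<Rightarrow> nat" where
  "rscan t = cell (fst t) (snd t)"

definition ract :: "nat \<times> dir \<Rightarrow> rtape \<Rightarrow> rtape" where
  "ract x t = ((snd t, fst x) # fst t, snd t + shift (snd x))"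

type_synonym table = "((nat \<times> nat list) \<times> (nat \<times> (nat \<times> dir) list)) list"

definition rnext :: "table \<Rightarrow> nat \<times> rtape list \<Rightarrow> (nat \<times> (nat \<times> dir) list) option" where
  "rnext tbl c = map_of tbl (fst c, map rscan (snd c))"

definition rstep :: "table \<Rightarrow> nat \<times> rtape list \<Rightarrow> nat \<times> rtape list" where
  "rstep tbl c = (case rnext tbl c of None \<Rightarrow> c
     | Some x \<Rightarrow> (fst x, map (\<lambda>p. ract (fst p) (snd p)) (zip (snd x) (snd c))))"

definition rinit :: "nat \<Rightarrow> bool list \<Rightarrow> nat \<times> rtape list" where
  "rinit k p = (0, (zip (map int [0..<length p]) (map bit_sym p), 0) # replicate (k - 1) ([], 0))"

definition rrun :: "nat \<Rightarrow> table \<Rightarrow> bool list \<Rightarrow> nat \<Rightarrow> nat \<times> rtape list" where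
  "rrun k tbl p s = (rstep tbl ^^ s) (rinit k p)"

text \<open>Phrased so that the closure rules apply: the fold yields the last tape, the quantifier
  ranges over a list, and the range of \<open>bit_sym\<close> is spelt out as 1 and 2.\<close>

definition routput :: "nat \<times> rtape list \<Rightarrow> bool list \<Rightarrow> bool" where
  "routput c y \<longleftrightarrow> (let l = fst (fold (\<lambda>t _. t) (snd c) ([], 0)) in
     (\<forall>p\<in>set (zip [0..<length y] y). cell l (int (fst p)) = bit_sym (snd p)) \<and>
     cell l (int (length y)) \<noteq> 1 \<and> cell l (int (length y)) \<noteq> 2)"

lemma pr_cell [pr_intros]: "pr l \<Longrightarrow> pr i \<Longrightarrow> pr (\<lambda>x. cell (l x) (i x))"
  unfolding cell_def by (intro pr_intros)

lemma pr_rscan [pr_intros]: "pr t \<Longrightarrow> pr (\<lambda>x. rscan (t x))"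
  unfolding rscan_def by (intro pr_intros)

lemma pr_ract [pr_intros]: "pr a \<Longrightarrow> pr t \<Longrightarrow> pr (\<lambda>x. ract (a x) (t x))"
  unfolding ract_def by (intro pr_intros)

lemma pr_bit_sym [pr_intros]: "pr b \<Longrightarrow> pr (\<lambda>x. bit_sym (b x))"
  unfolding bit_sym_def by (intro pr_intros)

lemma pr_rnext [pr_intros]: "pr c \<Longrightarrow> pr (\<lambda>x. rnext tbl (c x))"
  unfolding rnext_def by (intro pr_intros)

lemma pr_rstep [pr_intros]:
  assumes c: "pr c" shows "pr (\<lambda>x. rstep tbl (c x))"
  unfolding rstep_def by (intro pr_intros c pr_comp[OF c])

lemma pr_rrun [pr_intros]:
  assumes "pr p" "pr s" shows "pr (\<lambda>x. rrun k tbl (p x) (s x))"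
  unfolding rrun_def rinit_def by (intro pr_intros assms)

lemma pr_routput [pr_intros]:
  assumes c: "pr c" and y: "pr y" shows "pr (\<lambda>x. routput (c x) (y x))"
  unfolding routput_def Let_def by (intro pr_intros c y pr_comp[OF c])

section \<open>Correctness of the table simulation\<close>

definition legal :: "tm \<Rightarrow> config \<Rightarrow> bool" where
  "legal M c \<longleftrightarrow> fst c < num_states M \<and> length (snd c) = num_tapes M \<and>
     (\<forall>t\<in>set (snd c). \<forall>i. fst t i < num_symbols M)"

lemma scan_eq: "scan t = fst t (snd t)"
  by (cases t) simp

lemma act_eq: "act a t = ((fst t)(snd t := fst a), snd t + shift (snd a))"
  by (cases a; cases t) simp

lemma next_config_eq:
  "next_config M c = map_option (\<lambda>x. (fst x, map2 act (snd x) (snd c))) (delta M (fst c) (map scan (snd c)))"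
  by (cases c) (simp add: case_prod_unfold)

lemma delta_legal:
  assumes M: "turing_machine M" and c: "legal M c" and d: "delta M (fst c) (map scan (snd c)) = Some (q', acts)"
  shows "q' < num_states M" "length acts = num_tapes M" "fst ` set acts \<subseteq> {..<num_symbols M}"
proof -
  have "set (map scan (snd c)) \<subseteq> {..<num_symbols M}" "length (map scan (snd c)) = num_tapes M" "fst c < num_states M"
    using c by (auto simp: legal_def scan_eq)
  with M d show "q' < num_states M" "length acts = num_tapes M" "fst ` set acts \<subseteq> {..<num_symbols M}"
    unfolding turing_machine_def by blast+
qed

lemma legal_step:
  assumes M: "turing_machine M" and c: "legal M c"
  shows "legal M (step M c)"
proof (cases "delta M (fst c) (map scan (snd c))")
  case None
  then show ?thesis using c by (simp add: step_def next_config_eq)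
next
  case (Some x)
  obtain q' acts where x: "x = (q', acts)" by (cases x)
  note d = delta_legal[OF M c Some[unfolded x]]
  have "fst t i < num_symbols M" if "t \<in> set (map2 act acts (snd c))" for t i
  proof -
    obtain a u where au: "t = act a u" "a \<in> set acts" "u \<in> set (snd c)"
    proof -
      obtain p where p: "t = act (fst p) (snd p)" "p \<in> set (zip acts (snd c))"
        using \<open>t \<in> set (map2 act acts (snd c))\<close> by (auto simp: case_prod_unfold)
      then have "(fst p, snd p) \<in> set (zip acts (snd c))" by simp
      then show thesis using that[OF p(1)] set_zip_leftD set_zip_rightD by metis
    qed
    then have "fst a < num_symbols M" "fst u i < num_symbols M" using d(3) c by (auto simp: legal_def)
    then show ?thesis by (simp add: au(1) act_eq)
  qed
  then show ?thesis using c d(1,2) Some x by (simp add: step_def next_config_eq legal_def)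
qed

lemma legal_init: "turing_machine M \<Longrightarrow> legal M (init_config M p)"
  by (auto simp: turing_machine_def legal_def init_config_def input_tape_def blank_tape_def bit_sym_def)

lemma legal_run: "turing_machine M \<Longrightarrow> legal M (run M p s)"
  unfolding run_def by (induction s) (auto simp: legal_init legal_step)

text \<open>Outside the legal states and symbols \<open>delta\<close> may be an uncomputable
  function. On the finitely many legal arguments it is a finite list, which enters the simulation as
  a constant.\<close>

lemma table_exists:
  "\<exists>tbl::table. \<forall>c. legal M c \<longrightarrow> map_of tbl (fst c, map scan (snd c)) = delta M (fst c) (map scan (snd c))"
proof -
  define A where "A = {..<num_states M} \<times> {as. set as \<subseteq> {..<num_symbols M} \<and> length as = num_tapes M}"
  have "finite A" by (simp add: A_def finite_lists_length_eq)
  then obtain xs where xs: "set xs = {x \<in> A. delta M (fst x) (snd x) \<noteq> None}"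
    using finite_list[of "{x \<in> A. delta M (fst x) (snd x) \<noteq> None}"] by auto
  define tbl where "tbl = map (\<lambda>x. (x, the (delta M (fst x) (snd x)))) xs"
  have "map_of tbl (fst c, map scan (snd c)) = delta M (fst c) (map scan (snd c))" if "legal M c" for c
  proof -
    have "(fst c, map scan (snd c)) \<in> A" using that by (auto simp: A_def legal_def scan_eq)
    then show ?thesis using xs
      by (cases "delta M (fst c) (map scan (snd c))") (simp_all add: tbl_def map_of_map_restrict restrict_map_def)
  qed
  then show ?thesis by blast
qed

lemma scan_abs: "scan (abs_tape t) = rscan t"
  by (simp add: abs_tape_def rscan_def)

lemma act_abs: "act a (abs_tape t) = abs_tape (ract a t)"
  by (simp add: abs_tape_def ract_def act_eq cell_def fun_eq_iff)

context
  fixes M :: tm and tbl :: table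
  assumes M: "turing_machine M"
    and tbl: "\<And>c. legal M c \<Longrightarrow> map_of tbl (fst c, map scan (snd c)) = delta M (fst c) (map scan (snd c))"
begin

lemma delta_abs:
  assumes "legal M (abs_config c)"
  shows "delta M (fst c) (map scan (map abs_tape (snd c))) = rnext tbl c"
  using tbl[OF assms] by (simp add: rnext_def abs_config_def scan_abs o_def)

lemma halted_abs: "legal M (abs_config c) \<Longrightarrow> halted M (abs_config c) \<longleftrightarrow> rnext tbl c = None"
  using delta_abs[of c] by (simp add: halted_def next_config_eq abs_config_def)

lemma step_abs:
  assumes "legal M (abs_config c)"
  shows "step M (abs_config c) = abs_config (rstep tbl c)"
proof -
  have "map2 act as (map abs_tape ts) = map abs_tape (map (\<lambda>p. ract (fst p) (snd p)) (zip as ts))" for as ts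
    by (simp add: zip_map2 act_abs case_prod_unfold)
  then show ?thesis using delta_abs[OF assms]
    by (simp add: step_def next_config_eq abs_config_def rstep_def split: option.split)
qed

lemma input_tape_abs: "input_tape p = abs_tape (zip (map int [0..<length p]) (map bit_sym p), 0)"
proof -
  have "cell (zip (map int [0..<length p]) (map bit_sym p)) i =
      (if 0 \<le> i \<and> i < int (length p) then bit_sym (p ! nat i) else 0)" for i
  proof (cases "0 \<le> i \<and> i < int (length p)")
    case True
    then have "map_of (zip (map int [0..<length p]) (map bit_sym p)) (map int [0..<length p] ! nat i) =
        Some (map bit_sym p ! nat i)"
      by (intro map_of_zip_nth) (auto simp: distinct_map)
    then show ?thesis using True by (simp add: cell_def nat_less_iff)
  next
    case False
    have n: "map_of (zip (map int [0..<length p]) (map bit_sym p)) i = None"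
      using False by (subst map_of_zip_is_None) auto
    show ?thesis unfolding cell_def n using False by auto
  qed
  then show ?thesis by (simp add: input_tape_def abs_tape_def fun_eq_iff)
qed

lemma run_abs: "run M p s = abs_config (rrun (num_tapes M) tbl p s)"
proof (induction s)
  case 0
  have "blank_tape = abs_tape ([], 0)" by (simp add: blank_tape_def abs_tape_def cell_def fun_eq_iff)
  then show ?case
    by (simp add: run_def rrun_def rinit_def init_config_def abs_config_def input_tape_abs)
next
  case (Suc s)
  have "legal M (run M p s)" using legal_run M by blast
  then show ?case using Suc step_abs[of "rrun (num_tapes M) tbl p s"] by (simp add: run_def rrun_def)
qed

lemma halts_within_abs: "halts_within M p s \<longleftrightarrow> rnext tbl (rrun (num_tapes M) tbl p s) = None"
  using halted_abs[of "rrun (num_tapes M) tbl p s"] legal_run[OF M, of p s]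
  by (simp add: halts_within_def run_abs)

lemma has_output_abs:
  assumes "snd c \<noteq> []"
  shows "has_output (abs_config c) y \<longleftrightarrow> routput c y"
proof -
  have l: "ts \<noteq> [] \<Longrightarrow> fold (\<lambda>t _. t) ts a = last ts" for ts :: "rtape list" and a
    by (induction ts arbitrary: a) auto
  have "fst (last (map abs_tape (snd c))) = cell (fst (last (snd c)))"
    using assms by (simp add: last_map abs_tape_def)
  moreover have "(\<forall>p\<in>set (zip [0..<length y] y). f (int (fst p)) = bit_sym (snd p)) \<longleftrightarrow>
      (\<forall>i<length y. f (int i) = bit_sym (y ! i))" for f :: "int \<Rightarrow> nat"
    by (simp add: all_set_conv_all_nth)
  moreover have "range bit_sym = {1, 2}" by (auto simp: bit_sym_def)
  ultimately show ?thesis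
    by (simp add: has_output_def routput_def l[OF assms] abs_config_def Let_def)
qed

lemma computes_within_abs:
  "computes_within M p y s \<longleftrightarrow> rnext tbl (rrun (num_tapes M) tbl p s) = None \<and>
     routput (rrun (num_tapes M) tbl p s) y"
proof -
  have "length (snd (run M p s)) = num_tapes M" "num_tapes M \<ge> 1"
    using legal_run[OF M, of p s] M by (auto simp: legal_def turing_machine_def)
  then have "snd (rrun (num_tapes M) tbl p s) \<noteq> []" by (auto simp: run_abs abs_config_def)
  then show ?thesis using halts_within_abs by (simp add: computes_within_def run_abs has_output_abs)
qed

end

lemma pr_halts_within [pr_intros]:
  assumes "turing_machine M" "pr p" "pr s"
  shows "pr (\<lambda>x. halts_within M (p x) (s x))"
proof -
  obtain tbl where tbl: "\<And>c. legal M c \<Longrightarrow> map_of tbl (fst c, map scan (snd c)) = delta M (fst c) (map scan (snd c))"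
    using table_exists[of M] by blast
  have "halts_within M p s \<longleftrightarrow> rnext tbl (rrun (num_tapes M) tbl p s) = None" for p s
    by (rule halts_within_abs[OF assms(1)]) (rule tbl)
  then show ?thesis by (simp only:) (intro pr_intros assms)
qed

lemma pr_computes_within [pr_intros]:
  assumes "turing_machine M" "pr p" "pr y" "pr s"
  shows "pr (\<lambda>x. computes_within M (p x) (y x) (s x))"
proof -
  obtain tbl where tbl: "\<And>c. legal M c \<Longrightarrow> map_of tbl (fst c, map scan (snd c)) = delta M (fst c) (map scan (snd c))"
    using table_exists[of M] by blast
  have "computes_within M p y s \<longleftrightarrow> rnext tbl (rrun (num_tapes M) tbl p s) = None \<and> routput (rrun (num_tapes M) tbl p s) y" for p y s
    by (rule computes_within_abs[OF assms(1)]) (rule tbl)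
  then show ?thesis by (simp only:) (intro pr_intros assms)
qed

section \<open>Unbounded search by a Turing machine\<close>

definition reg_computes :: "(nat \<Rightarrow> com) \<Rightarrow> nat \<Rightarrow> ('a::enc \<Rightarrow> 'b::enc) \<Rightarrow> bool" where
  "reg_computes c d f \<longleftrightarrow> (\<forall>r. (\<forall>k s. wf_com k s (c r)) \<and>
     (\<forall>m \<sigma> x. r + d < m \<longrightarrow> (\<forall>i>r. \<sigma> i = 0) \<longrightarrow> \<sigma> r = enc x \<longrightarrow> reg_exec m (c r) \<sigma> (\<sigma>(r := enc (f x)))))"

lemma pr_reg_computes: "pr f \<Longrightarrow> \<exists>c d. reg_computes c d f"
proof -
  assume "pr f"
  then obtain g where g: "prim g" "\<And>x. g (enc x) = enc (f x)" unfolding pr_def by blast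
  obtain c d where "implements c d g" using prim_implemented[OF g(1)] by blast
  then have "reg_computes c d f" unfolding reg_computes_def implements_def using g(2) by metis
  then show ?thesis by blast
qed

lemma reg_computes_wf: "reg_computes c d f \<Longrightarrow> wf_com k s (c r)"
  by (simp add: reg_computes_def)

lemma reg_computes_rx:
  "reg_computes c d f \<Longrightarrow> r + d < m \<Longrightarrow> \<sigma> r = enc x \<Longrightarrow> (\<And>i. i > r \<Longrightarrow> \<sigma> i = 0) \<Longrightarrow>
    reg_exec m (c r) \<sigma> (\<sigma>(r := enc (f x)))"
  by (simp add: reg_computes_def)

lemma reg_execD: "reg_exec m c \<sigma> \<sigma>' \<Longrightarrow> exec c (tapes_of m I \<sigma> J) (tapes_of m I \<sigma>' J)"
  unfolding reg_exec_def by blast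

text \<open>Work tapes start blank, whereas a counter needs its marker in cell 0. One transition
  marks all \<open>m\<close> of them and leaves the outer tapes alone.\<close>

definition mark :: "nat \<Rightarrow> com" where
  "mark m = Act (\<lambda>as. map (\<lambda>i. (if 0 < i \<and> i \<le> m then 1 else as ! i, Stay)) [0..<m + 2])"

lemma wf_mark: "3 \<le> s \<Longrightarrow> wf_com (m + 2) s (mark m)"
  by (auto simp: mark_def subset_iff)

lemma exec_mark: "exec (mark m) (I # replicate (m + 1) blank_tape) (tapes_of m I (\<lambda>_. 0) blank_tape)"
  unfolding mark_def
proof (rule exec_Act, rule nth_equalityI)
  let ?ts = "I # replicate (m + 1) blank_tape"
  let ?a = "\<lambda>as. map (\<lambda>i. (if 0 < i \<and> i \<le> m then 1 else as ! i, Stay)) [0..<m + 2]"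
  fix i assume "i < length (tapes_of m I (\<lambda>_. 0) blank_tape)"
  then consider "i = 0" | j where "i = Suc j" "j < m" | "i = Suc m"
    by (cases i) (auto simp: less_Suc_eq)
  then show "tapes_of m I (\<lambda>_. 0) blank_tape ! i = map2 act (?a (map scan ?ts)) ?ts ! i"
    by cases (auto simp: act_eq scan_eq blank_tape_def counter_def nth_append fun_eq_iff simp del: replicate.simps)
qed simp

text \<open>The head first runs to the right end; reading the bits backwards lets repeated
  \<open>Cons\<close> build the list in the right order.\<close>

definition read_input :: "(nat \<Rightarrow> com) \<Rightarrow> (nat \<Rightarrow> com) \<Rightarrow> com" where
  "read_input ct cf = While (\<lambda>as. as ! 0 \<noteq> 0) (modify 0 (\<lambda>a. (a, Rgt))) ;; modify 0 (\<lambda>a. (a, Lft)) ;;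
     While (\<lambda>as. as ! 0 \<noteq> 0) (Cond (\<lambda>as. as ! 0 = 2) (ct 0) (cf 0) ;; modify 0 (\<lambda>a. (a, Lft)))"

definition input_at :: "bool list \<Rightarrow> int \<Rightarrow> tape" where
  "input_at q h = (fst (input_tape q), h)"

lemma scan_input_at:
  "scan (input_at q h) = (if 0 \<le> h \<and> h < int (length q) then bit_sym (q ! nat h) else 0)"
  by (simp add: input_at_def input_tape_def)

lemma scan_tapes_of_0: "map scan (tapes_of m I \<sigma> J) ! 0 = scan I"
  by (simp add: tapes_of_def)

lemma exec_move_input:
  "exec (modify 0 (\<lambda>a. (a, d))) (tapes_of m (input_at q h) \<sigma> J) (tapes_of m (input_at q (h + shift d)) \<sigma> J)"
proof -
  have "act (scan (input_at q h), d) (input_at q h) = input_at q (h + shift d)"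
    by (simp add: act_eq scan_eq input_at_def)
  then show ?thesis using exec_modify[of 0 "tapes_of m (input_at q h) \<sigma> J" "\<lambda>a. (a, d)"] by simp
qed

lemma exec_read_input:
  assumes ct: "reg_computes ct dt (\<lambda>q. True # q)" and cf: "reg_computes cf df (\<lambda>q. False # q)"
    and m: "dt < m" "df < m"
  shows "exec (read_input ct cf) (tapes_of m (input_tape q) (\<lambda>_. 0) J) (tapes_of m (input_at q (-1)) ((\<lambda>_. 0)(0 := enc q)) J)"
proof -
  let ?n = "length q"
  let ?z = "\<lambda>_. 0 :: nat"
  have 1: "exec (While (\<lambda>as. as ! 0 \<noteq> 0) (modify 0 (\<lambda>a. (a, Rgt))))
      (tapes_of m (input_at q (int (?n - ?n))) ?z J) (tapes_of m (input_at q (int (?n - 0))) ?z J)"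
  proof (rule exec_While_family[where S = "\<lambda>i. tapes_of m (input_at q (int (?n - i))) ?z J"])
    fix i assume "i < ?n"
    then have "int (?n - i) = int (?n - Suc i) + shift Rgt" by simp
    then show "exec (modify 0 (\<lambda>a. (a, Rgt))) (tapes_of m (input_at q (int (?n - Suc i))) ?z J) (tapes_of m (input_at q (int (?n - i))) ?z J)"
      using exec_move_input[where d = Rgt and h = "int (?n - Suc i)"] by simp
  next
    fix i assume "i \<le> ?n"
    then show "map scan (tapes_of m (input_at q (int (?n - i))) ?z J) ! 0 \<noteq> 0 \<longleftrightarrow> i \<noteq> 0"
      unfolding scan_tapes_of_0 scan_input_at by (auto simp: bit_sym_def)
  qed
  have 2: "exec (modify 0 (\<lambda>a. (a, Lft))) (tapes_of m (input_at q (int (?n - 0))) ?z J) (tapes_of m (input_at q (int ?n - 1)) ?z J)"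
    using exec_move_input[where d = Lft and h = "int ?n"] by simp
  have 3: "exec (While (\<lambda>as. as ! 0 \<noteq> 0) (Cond (\<lambda>as. as ! 0 = 2) (ct 0) (cf 0) ;; modify 0 (\<lambda>a. (a, Lft))))
      (tapes_of m (input_at q (int ?n - 1)) (?z(0 := enc (drop ?n q))) J)
      (tapes_of m (input_at q (int 0 - 1)) (?z(0 := enc (drop 0 q))) J)"
  \<comment> \<open>There are \<open>i\<close> bits still unread, and the register holds the suffix
    behind them; the head comes to rest on the blank at cell -1.\<close>
  proof (rule exec_While_family[where S = "\<lambda>i. tapes_of m (input_at q (int i - 1)) (?z(0 := enc (drop i q))) J"])
    fix i assume i: "i < ?n"
    let ?s = "\<lambda>i. ?z(0 := enc (drop i q))"
    have d: "drop i q = (q ! i) # drop (Suc i) q" using i by (simp add: Cons_nth_drop_Suc)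
    have sc: "scan (input_at q (int (Suc i) - 1)) = bit_sym (q ! i)" using i by (simp add: scan_input_at)
    have "exec (Cond (\<lambda>as. as ! 0 = 2) (ct 0) (cf 0))
        (tapes_of m (input_at q (int (Suc i) - 1)) (?s (Suc i)) J) (tapes_of m (input_at q (int (Suc i) - 1)) (?s i) J)"
    proof (rule exec_Cond)
      have t: "reg_exec m (ct 0) (?s (Suc i)) (?z(0 := enc (True # drop (Suc i) q)))"
        by (rule reg_exec_cong[OF reg_computes_rx[OF ct, where x = "drop (Suc i) q"]]) (use m in auto)
      have f: "reg_exec m (cf 0) (?s (Suc i)) (?z(0 := enc (False # drop (Suc i) q)))"
        by (rule reg_exec_cong[OF reg_computes_rx[OF cf, where x = "drop (Suc i) q"]]) (use m in auto)
      show "exec (if map scan (tapes_of m (input_at q (int (Suc i) - 1)) (?s (Suc i)) J) ! 0 = 2 then ct 0 else cf 0)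
          (tapes_of m (input_at q (int (Suc i) - 1)) (?s (Suc i)) J) (tapes_of m (input_at q (int (Suc i) - 1)) (?s i) J)"
        unfolding scan_tapes_of_0 sc d using reg_execD[OF t] reg_execD[OF f] by (cases "q ! i") (simp_all add: bit_sym_def)
    qed
    moreover have "exec (modify 0 (\<lambda>a. (a, Lft))) (tapes_of m (input_at q (int (Suc i) - 1)) (?s i) J)
        (tapes_of m (input_at q (int i - 1)) (?s i) J)"
      using exec_move_input[where d = Lft and h = "int i"] by simp
    ultimately show "exec (Cond (\<lambda>as. as ! 0 = 2) (ct 0) (cf 0) ;; modify 0 (\<lambda>a. (a, Lft)))
        (tapes_of m (input_at q (int (Suc i) - 1)) (?s (Suc i)) J) (tapes_of m (input_at q (int i - 1)) (?s i) J)"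
      by (rule exec_Seq)
  next
    fix i assume "i \<le> ?n"
    then show "map scan (tapes_of m (input_at q (int i - 1)) (?z(0 := enc (drop i q))) J) ! 0 \<noteq> 0 \<longleftrightarrow> i \<noteq> 0"
      unfolding scan_tapes_of_0 scan_input_at by (auto simp: bit_sym_def)
  qed
  have "input_at q 0 = input_tape q" by (simp add: input_at_def input_tape_def)
  moreover have "?z(0 := enc (drop ?n q)) = ?z" by auto
  ultimately show ?thesis using exec_Seq[OF 1 exec_Seq[OF 2 3[unfolded \<open>?z(0 := enc (drop ?n q)) = ?z\<close>]]]
    by (simp add: read_input_def)
qed

text \<open>The code of a nonempty list is the successor of a pair code. \<open>Dec\<close> and
  \<open>unpair\<close> split off the first bit, whose code 0 or 1 selects the symbol to print, and
  the tail is moved back for the next pass.\<close>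

definition write_output :: "nat \<Rightarrow> com" where
  "write_output m = While (nz 0) (Dec 0 ;; unpair 0 1 2 ;;
     Cond (nz 1) (modify (Suc m) (\<lambda>_. (2, Rgt))) (modify (Suc m) (\<lambda>_. (1, Rgt))) ;; zero 1 ;; move 2 0)"

definition written :: "bool list \<Rightarrow> tape" where
  "written u = (fst (input_tape u), int (length u))"

lemma act_written: "act (bit_sym b, Rgt) (written u) = written (u @ [b])"
  by (auto simp: act_eq written_def input_tape_def fun_eq_iff nth_append)

lemma exec_write_output:
  assumes m: "2 < m"
  shows "exec (write_output m) (tapes_of m I ((\<lambda>_. 0)(0 := enc v)) (written u)) (tapes_of m I (\<lambda>_. 0) (written (u @ v)))"
proof (induction v arbitrary: u)
  case Nil
  have z: "(\<lambda>_. 0)(0 := enc ([] :: bool list)) = (\<lambda>_. 0 :: nat)" by auto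
  show ?case unfolding write_output_def z append_Nil2 by (rule exec_While_done) (use m in simp)
next
  case (Cons b v)
  let ?z = "\<lambda>_. 0 :: nat"
  have 1: "reg_exec m (Dec 0) (?z(0 := enc (b # v))) (?z(0 := prod_encode (enc b, enc v)))"
    by (rule reg_exec_cong[OF reg_exec_Dec]) (use m in \<open>auto simp: fun_eq_iff\<close>)
  have 2: "reg_exec m (unpair 0 1 2) (?z(0 := prod_encode (enc b, enc v))) (?z(1 := enc b, 2 := enc v))"
    by (rule reg_exec_cong[OF reg_exec_unpair[where x = "enc b" and y = "enc v"]]) (use m in \<open>auto simp: fun_eq_iff\<close>)
  let ?s = "?z(1 := enc b, 2 := enc v)"
  have w: "exec (modify (Suc m) (\<lambda>_. (bit_sym b, Rgt))) (tapes_of m I ?s (written u)) (tapes_of m I ?s (written (u @ [b])))"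
    using exec_modify[of "Suc m" "tapes_of m I ?s (written u)" "\<lambda>_. (bit_sym b, Rgt)"] act_written[of b u] by simp
  have 3: "exec (Cond (nz 1) (modify (Suc m) (\<lambda>_. (2, Rgt))) (modify (Suc m) (\<lambda>_. (1, Rgt))))
      (tapes_of m I ?s (written u)) (tapes_of m I ?s (written (u @ [b])))"
    by (rule exec_Cond) (use w m in \<open>cases b, simp_all add: enc_bool_def bit_sym_def\<close>)
  have 4: "reg_exec m (zero 1 ;; move 2 0) ?s (?z(0 := enc v))"
    by (rule reg_exec_cong[OF reg_exec_Seq[OF reg_exec_zero reg_exec_move]]) (use m in \<open>auto simp: fun_eq_iff\<close>)
  have body: "exec (Dec 0 ;; unpair 0 1 2 ;;
     Cond (nz 1) (modify (Suc m) (\<lambda>_. (2, Rgt))) (modify (Suc m) (\<lambda>_. (1, Rgt))) ;; zero 1 ;; move 2 0)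
     (tapes_of m I (?z(0 := enc (b # v))) (written u)) (tapes_of m I (?z(0 := enc v)) (written (u @ [b])))"
    by (intro exec_Seq[OF reg_execD[OF 1]] exec_Seq[OF reg_execD[OF 2]] exec_Seq[OF 3] reg_execD[OF 4])
  show ?case unfolding write_output_def
    by (rule exec_While_step[OF _ body Cons[of "u @ [b]", unfolded write_output_def append_assoc append_Cons append_Nil]])
      (use m in simp)
qed

text \<open>Kleene's normal form: a least witness is sought for a primitive recursive predicate, and
  a primitive recursive function reads off the output. The last conjunct turns a missing witness
  into divergence, from which the domain of a constructed machine can be shown to be
  prefix-free.\<close>

theorem search_machine:
  fixes P :: "bool list \<times> nat \<Rightarrow> bool" and g :: "bool list \<times> nat \<Rightarrow> bool list"
  assumes P: "pr P" and g: "pr g"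
  shows "\<exists>M. turing_machine M \<and>
    (\<forall>q z. P (q, z) \<longrightarrow> (\<forall>z'<z. \<not> P (q, z')) \<longrightarrow> computes M q (g (q, z))) \<and>
    (\<forall>q s. halts_within M q s \<longrightarrow> (\<exists>z. P (q, z)))"
proof -
  have "pr (\<lambda>q. True # q)" "pr (\<lambda>q. False # q)" "pr (\<lambda>q::bool list. (q, 0::nat))"
    "pr (\<lambda>x::bool list \<times> nat. (fst x, Suc (snd x)))"
    by (intro pr_intros)+
  note p = this[THEN pr_reg_computes]
  obtain ct dt where ct: "reg_computes ct dt (\<lambda>q. True # q)" using p(1) by blast
  obtain cf df where cf: "reg_computes cf df (\<lambda>q. False # q)" using p(2) by blast
  obtain c0 d0 where c0: "reg_computes c0 d0 (\<lambda>q::bool list. (q, 0::nat))" using p(3) by blast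
  \<comment> \<open>The negated test is computed, so that \<open>nz 1\<close> keeps the loop running
    exactly as long as no witness has appeared.\<close>
  obtain cn dn where cn: "reg_computes cn dn (\<lambda>x. \<not> P x)" using pr_reg_computes[OF pr_not[OF P]] by blast
  obtain cs ds where cs: "reg_computes cs ds (\<lambda>x::bool list \<times> nat. (fst x, Suc (snd x)))"
    using p(4) by blast
  obtain cg dg where cg: "reg_computes cg dg g" using pr_reg_computes[OF g] by blast
  \<comment> \<open>Room for the scratch registers of all subprograms, and three more for the
    registers 0, 1 and 2 that are addressed directly.\<close>
  define m where "m = dt + df + d0 + dn + ds + dg + 3"
  define test where "test = dup 0 1 2 ;; cn 1"
  define pre where "pre = mark m ;; read_input ct cf ;; c0 0 ;; test"
  define body where "body = zero 1 ;; cs 0 ;; test"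
  define post where "post = cg 0 ;; write_output m"
  define c where "c = pre ;; While (nz 1) body ;; post"
  have wf: "wf_com (m + 2) 3 c"
    by (simp add: c_def pre_def body_def post_def test_def read_input_def write_output_def
        reg_computes_wf[OF ct] reg_computes_wf[OF cf] reg_computes_wf[OF c0] reg_computes_wf[OF cn] reg_computes_wf[OF cs] reg_computes_wf[OF cg]
        wf_mark[of 3, simplified] wf_modify)
  obtain M \<rho> where M: "turing_machine M" "num_tapes M = m + 2"
    and run: "\<And>n ts. (step M ^^ n) (0, ts) = map_prod \<rho> id ((cstep ^^ n) ([c], ts))"
    and halt: "\<And>n ts. halted M ((step M ^^ n) (0, ts)) \<longleftrightarrow> fst ((cstep ^^ n) ([c], ts)) = []"
    using com_tm_exists[OF wf] by fastforce
  let ?z = "\<lambda>_. 0 :: nat"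
  define ini where "ini q = input_tape q # replicate (m + 1) blank_tape" for q
  have init: "init_config M q = (0, ini q)" for q by (simp add: init_config_def M(2) ini_def)
  define T where "T q z = tapes_of m (input_at q (-1)) (?z(0 := enc (q, z), 1 := enc (\<not> P (q, z)))) blank_tape" for q z
  have test: "reg_exec m test (?z(0 := enc (q, z))) (?z(0 := enc (q, z), 1 := enc (\<not> P (q, z))))" for q z
  proof -
    have "reg_exec m (dup 0 1 2) (?z(0 := enc (q, z))) (?z(0 := enc (q, z), 1 := enc (q, z)))"
      by (rule reg_exec_cong[OF reg_exec_dup]) (auto simp: m_def)
    moreover have "reg_exec m (cn 1) (?z(0 := enc (q, z), 1 := enc (q, z))) (?z(0 := enc (q, z), 1 := enc (\<not> P (q, z))))"
      by (rule reg_exec_cong[OF reg_computes_rx[OF cn, where x = "(q, z)"]]) (auto simp: m_def)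
    ultimately show ?thesis unfolding test_def by (rule reg_exec_Seq)
  qed
  have pre: "exec pre (ini q) (T q 0)" for q
  proof -
    have 1: "exec (mark m) (ini q) (tapes_of m (input_tape q) ?z blank_tape)" unfolding ini_def by (rule exec_mark)
    have 2: "exec (read_input ct cf) (tapes_of m (input_tape q) ?z blank_tape) (tapes_of m (input_at q (-1)) (?z(0 := enc q)) blank_tape)"
      by (rule exec_read_input[OF ct cf]) (auto simp: m_def)
    have "reg_exec m (c0 0) (?z(0 := enc q)) (?z(0 := enc (q, 0::nat)))"
      by (rule reg_exec_cong[OF reg_computes_rx[OF c0, where x = q]]) (auto simp: m_def)
    from reg_execD[OF reg_exec_Seq[OF this test]]
    show ?thesis unfolding pre_def T_def by (intro exec_Seq[OF 1] exec_Seq[OF 2])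
  qed
  have body: "exec body (T q z) (T q (Suc z))" for q z
  proof -
    have 1: "reg_exec m (zero 1) (?z(0 := enc (q, z), 1 := enc (\<not> P (q, z)))) (?z(0 := enc (q, z)))"
      by (rule reg_exec_cong[OF reg_exec_zero]) (auto simp: m_def fun_eq_iff)
    have 2: "reg_exec m (cs 0) (?z(0 := enc (q, z))) (?z(0 := enc (q, Suc z)))"
      by (rule reg_exec_cong[OF reg_computes_rx[OF cs, where x = "(q, z)"]]) (auto simp: m_def)
    show ?thesis unfolding T_def body_def by (rule reg_execD[OF reg_exec_Seq[OF 1 reg_exec_Seq[OF 2 test]]])
  qed
  have cond: "nz 1 (map scan (T q z)) \<longleftrightarrow> \<not> P (q, z)" for q z
    unfolding T_def by (subst nz_tapes_of) (auto simp: m_def enc_bool_def)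
  have post: "exec post (T q z) (tapes_of m (input_at q (-1)) ?z (written (g (q, z))))" if "P (q, z)" for q z
  proof -
    have T: "T q z = tapes_of m (input_at q (-1)) (?z(0 := enc (q, z))) blank_tape"
      unfolding T_def using that by (intro arg_cong[where f = "\<lambda>s. tapes_of m _ s _"]) (auto simp: enc_bool_def)
    have 1: "reg_exec m (cg 0) (?z(0 := enc (q, z))) (?z(0 := enc (g (q, z))))"
      by (rule reg_exec_cong[OF reg_computes_rx[OF cg, where x = "(q, z)"]]) (auto simp: m_def)
    have w: "blank_tape = written []" by (auto simp: blank_tape_def written_def input_tape_def)
    have 2: "exec (write_output m) (tapes_of m (input_at q (-1)) (?z(0 := enc (g (q, z)))) blank_tape)
       (tapes_of m (input_at q (-1)) ?z (written (g (q, z))))"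
      unfolding w using exec_write_output[of m _ _ "[]"] by (simp add: m_def)
    show ?thesis unfolding T post_def by (rule exec_Seq[OF reg_execD[OF 1] 2])
  qed
  have comp: "computes M q (g (q, z))" if z: "P (q, z)" "\<forall>z'<z. \<not> P (q, z')" for q z
  proof -
    have "exec (While (nz 1) body) (T q (z - z)) (T q (z - 0))"
    proof (rule exec_While_family[where S = "\<lambda>i. T q (z - i)"])
      fix i assume "i < z"
      then show "exec body (T q (z - Suc i)) (T q (z - i))" using body[of q "z - Suc i"] by (simp add: Suc_diff_Suc)
    next
      fix i assume "i \<le> z"
      then show "nz 1 (map scan (T q (z - i))) \<longleftrightarrow> i \<noteq> 0" unfolding cond using z by (cases i) auto
    qed
    then have "exec c (ini q) (tapes_of m (input_at q (-1)) ?z (written (g (q, z))))"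
      unfolding c_def using post[OF z(1)] by (intro exec_Seq[OF pre] exec_Seq) auto
    then obtain n where n: "(cstep ^^ n) ([c], ini q) = ([], tapes_of m (input_at q (-1)) ?z (written (g (q, z))))"
      unfolding exec_def by blast
    have h: "halts_within M q n" by (simp add: halts_within_def run_def init halt n)
    have "run M q n = (\<rho> [], tapes_of m (input_at q (-1)) ?z (written (g (q, z))))"
      by (simp add: run_def init run n)
    moreover have "0 \<notin> range bit_sym" by (auto simp: bit_sym_def)
    ultimately have "has_output (run M q n) (g (q, z))"
      by (simp add: has_output_def tapes_of_def written_def input_tape_def)
    then show ?thesis using h unfolding computes_def computes_within_def by blast
  qed
  have div: "\<exists>z. P (q, z)" if s: "halts_within M q s" for q s
  proof (rule ccontr)
    assume "\<nexists>z. P (q, z)"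
    then have "nz 1 (map scan (T q z))" for z using cond by blast
    from While_diverges[where b = "nz 1" and S = "T q" and c = body and cs = "[post]" and i = s, OF this body]
    obtain n where n: "n \<ge> s" "(cstep ^^ n) ([While (nz 1) body, post], T q 0) = ([While (nz 1) body, post], T q s)"
      by blast
    obtain n0 where n0: "(cstep ^^ n0) ([pre, While (nz 1) body ;; post], ini q) = ([While (nz 1) body ;; post], T q 0)"
      using pre unfolding exec_def by blast
    have "(cstep ^^ Suc n0) ([c], ini q) = ([While (nz 1) body ;; post], T q 0)"
      using n0 by (simp add: c_def funpow_Suc_right cstep_Cons del: funpow.simps)
    then have "(cstep ^^ Suc (Suc n0)) ([c], ini q) = ([While (nz 1) body, post], T q 0)"
      by (simp add: cstep_Cons)
    from funpow_trans[OF this n(2)]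
    have N: "(cstep ^^ (n + Suc (Suc n0))) ([c], ini q) = ([While (nz 1) body, post], T q s)" .
    \<comment> \<open>Had the machine halted by step \<open>s\<close>, the continuation would stay
      empty from then on; yet at a later step the loop is still pending.\<close>
    have "fst ((cstep ^^ s) ([c], ini q)) = []" using s by (simp add: halts_within_def run_def init halt)
    then obtain ts where "(cstep ^^ s) ([c], ini q) = ([], ts)" by (metis prod.collapse)
    from funpow_trans[OF this cstep_Nil[of "n + Suc (Suc n0) - s"]] n(1) N show False by simp
  qed
  show ?thesis using M(1) comp div by blast
qed

section \<open>Running times\<close>

lemma halted_step: "halted M c \<Longrightarrow> step M c = c"
  by (simp add: halted_def step_def)

lemma run_Suc: "run M p (Suc s) = step M (run M p s)"
  by (simp add: run_def)

lemma run_halted: "halts_within M p s \<Longrightarrow> run M p (s + k) = run M p s"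
  by (induction k) (simp_all add: run_Suc halts_within_def halted_step)

lemma halts_within_mono: "halts_within M p s \<Longrightarrow> s \<le> s' \<Longrightarrow> halts_within M p s'"
  using run_halted[of M p s "s' - s"] by (simp add: halts_within_def)

lemma computes_within_mono: "computes_within M p x s \<Longrightarrow> s \<le> s' \<Longrightarrow> computes_within M p x s'"
  using run_halted[of M p s "s' - s"] halts_within_mono[of M p s s'] by (auto simp: computes_within_def)

lemma has_output_unique:
  assumes "has_output c x" "has_output c y"
  shows "x = y"
proof -
  define f where "f = fst (last (snd c))"
  have *: "\<And>i. i < length x \<Longrightarrow> f (int i) = bit_sym (x ! i)" "f (int (length x)) \<notin> range bit_sym"
    "\<And>i. i < length y \<Longrightarrow> f (int i) = bit_sym (y ! i)" "f (int (length y)) \<notin> range bit_sym"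
    using assms by (auto simp: has_output_def f_def Let_def)
  have l: "length x = length y"
    using *(1)[of "length y"] *(3)[of "length x"] *(2,4) by (metis linorder_neqE_nat rangeI)
  show ?thesis
  proof (rule nth_equalityI[OF l])
    fix i assume "i < length x"
    then have "bit_sym (x ! i) = bit_sym (y ! i)" using *(1)[of i] *(3)[of i] l by simp
    then show "x ! i = y ! i" by (simp add: bit_sym_def split: if_splits)
  qed
qed

lemma computes_within_unique:
  assumes "computes_within M p x s" "computes_within M p y s'"
  shows "x = y"
proof -
  have "computes_within M p x (max s s')" "computes_within M p y (max s s')"
    using assms computes_within_mono by (meson max.cobounded1 max.cobounded2)+
  then show ?thesis using has_output_unique unfolding computes_within_def by blast
qed

lemma set_map2_act: "t \<in> set (map2 act as ts) \<Longrightarrow> \<exists>a u. u \<in> set ts \<and> t = act a u"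
  by (auto simp: case_prod_unfold) (metis prod.collapse set_zip_rightD)

lemma step_eq:
  "step M c = (case delta M (fst c) (map scan (snd c)) of None \<Rightarrow> c
     | Some x \<Rightarrow> (fst x, map2 act (snd x) (snd c)))"
  by (simp add: step_def next_config_eq split: option.split)

text \<open>A step moves each head by at most one cell and changes only the scanned cell. This
  limits both how much of a program is read and how long an output can be.\<close>

lemma run_bounds:
  assumes "t \<in> set (snd (run M p s))"
  shows "snd t \<le> int s" "x \<ge> int (length p + s) \<Longrightarrow> fst t x = 0"
proof -
  have "\<forall>t\<in>set (snd (run M p s)). snd t \<le> int s \<and> (\<forall>x \<ge> int (length p + s). fst t x = 0)"
  proof (induction s)
    case 0
    then show ?case by (auto simp: run_def init_config_def input_tape_def blank_tape_def)
  next
    case (Suc s)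
    show ?case
    proof (cases "delta M (fst (run M p s)) (map scan (snd (run M p s)))")
      case None
      then show ?thesis using Suc by (auto simp: run_Suc step_eq)
    next
      case (Some r)
      have "snd t \<le> int (Suc s) \<and> (\<forall>x \<ge> int (length p + Suc s). fst t x = 0)"
        if t: "t \<in> set (map2 act (snd r) (snd (run M p s)))" for t
      proof -
        obtain a u where u: "u \<in> set (snd (run M p s))" "t = act a u" using set_map2_act[OF t] by blast
        then have "snd u \<le> int s" "\<forall>x \<ge> int (length p + s). fst u x = 0" using Suc by auto
        then show ?thesis by (cases "snd a") (auto simp: u(2) act_eq)
      qed
      then show ?thesis using Some by (simp add: run_Suc step_eq)
    qed
  qed
  with assms show "snd t \<le> int s" "x \<ge> int (length p + s) \<Longrightarrow> fst t x = 0" by auto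
qed

text \<open>The heads move one cell per step, so cells beyond position \<open>s\<close> are never inspected.\<close>

lemma halts_within_take:
  assumes "halts_within M p s"
  shows "halts_within M (take (Suc s) p) s"
proof -
  let ?q = "take (Suc s) p"
  define agree where "agree t u \<longleftrightarrow> snd t = snd u \<and> (\<forall>x\<le>int s. fst t x = fst u x)" for t u :: tape
  have scan: "map scan (snd c) = map scan (snd d)"
    if "list_all2 agree (snd c) (snd d)" "\<And>t. t \<in> set (snd c) \<Longrightarrow> snd t \<le> int s" for c d :: config
  proof (rule nth_equalityI)
    fix i assume "i < length (map scan (snd c))"
    then have i: "i < length (snd c)" by simp
    then have "snd (snd c ! i) \<le> int s" "agree (snd c ! i) (snd d ! i)" "i < length (snd d)"
      using that by (auto simp: list_all2_conv_all_nth)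
    then show "map scan (snd c) ! i = map scan (snd d) ! i" using i by (simp add: agree_def scan_eq)
  qed (use that in \<open>simp add: list_all2_conv_all_nth\<close>)
  have inv: "i \<le> s \<Longrightarrow> fst (run M p i) = fst (run M ?q i) \<and> list_all2 agree (snd (run M p i)) (snd (run M ?q i))" for i
  proof (induction i)
    case 0
    have "agree (input_tape p) (input_tape ?q)" by (auto simp: agree_def input_tape_def)
    moreover have "agree t t" for t by (simp add: agree_def)
    ultimately show ?case by (simp add: run_def init_config_def list.rel_refl)
  next
    case (Suc i)
    then have a: "fst (run M p i) = fst (run M ?q i)" "list_all2 agree (snd (run M p i)) (snd (run M ?q i))" by auto
    have "snd t \<le> int s" if "t \<in> set (snd (run M p i))" for t
      using run_bounds(1)[OF that] Suc.prems by simp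
    from scan[OF a(2) this]
    have sc: "map scan (snd (run M p i)) = map scan (snd (run M ?q i))" by simp
    have "list_all2 agree (map2 act as (snd (run M p i))) (map2 act as (snd (run M ?q i)))" for as
      using a(2) by (auto simp: list_all2_conv_all_nth act_eq agree_def)
    then show ?case using a by (auto simp: run_Suc step_eq sc split: option.split)
  qed
  have "snd t \<le> int s" if "t \<in> set (snd (run M p s))" for t using run_bounds(1)[OF that] by simp
  then have "map scan (snd (run M p s)) = map scan (snd (run M ?q s))" using scan inv[of s] by simp
  then show ?thesis using assms inv[of s] by (simp add: halts_within_def halted_def next_config_eq)
qed

text \<open>A longer program would make the machine halt on its proper prefix of
  \<open>Suc s\<close> bits as well, against prefix-freeness. Consequently only finitely many
  programs matter for a given time bound.\<close>

lemma prefix_machine_length: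
  assumes "prefix_machine U" "halts_within U p s"
  shows "length p \<le> Suc s"
proof (rule ccontr)
  assume "\<not> length p \<le> Suc s"
  then have "strict_prefix (take (Suc s) p) p"
    by (metis linorder_linear nat_less_le not_less take_all take_is_prefix strict_prefixI length_take min.absorb2)
  then show False using assms halts_within_take unfolding prefix_machine_def by blast
qed

section \<open>Recursive bounds are dominated by time-constructible recursive ones\<close>

definition clock :: "nat \<Rightarrow> tape" where
  "clock n = written (replicate n True)"

lemma act_clock: "act (2, Rgt) (clock n) = clock (Suc n)"
  using act_written[of True "replicate n True"] by (simp add: clock_def bit_sym_def replicate_append_same)

text \<open>
  The padded machine first overwrites its input by ones, which makes the running time depend only on
  the input length, and then simulates \<open>M\<close>. It counts all its steps in unary on an extra output tape.
\<close>

definition pad_delta :: "tm \<Rightarrow> nat \<Rightarrow> nat list \<Rightarrow> (nat \<times> (nat \<times> dir) list) option" where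
  "pad_delta M q as =
     (if q = 0 then Some (if hd as = 0 then (1, (0, Lft) # stay (tl as)) else (0, (2, Rgt) # stay (tl as)))
      else if q = 1 then Some (if hd as = 0 then (2, (0, Rgt) # stay (tl as)) else (1, (hd as, Lft) # stay (tl as)))
      else map_option (\<lambda>x. (fst x + 2, snd x)) (delta M (q - 2) as))"

text \<open>States 0 and 1 are the passes to the right and back, so the states of \<open>M\<close>
  are shifted by 2. \<open>butlast\<close> hides the counting tape, so \<open>M\<close> behaves as
  it does without it.\<close>

definition pad :: "tm \<Rightarrow> tm" where
  "pad M = \<lparr>num_tapes = Suc (num_tapes M), num_states = num_states M + 2, num_symbols = num_symbols M,
     delta = (\<lambda>q as. map_option (\<lambda>x. (fst x, snd x @ [(2, Rgt)])) (pad_delta M q (butlast as)))\<rparr>"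

lemma turing_machine_pad:
  assumes M: "turing_machine M"
  shows "turing_machine (pad M)"
  unfolding turing_machine_def
proof (intro conjI allI impI)
  show "1 \<le> num_tapes (pad M)" "1 \<le> num_states (pad M)" "3 \<le> num_symbols (pad M)"
    using M by (auto simp: pad_def turing_machine_def)
  fix q as q' acts
  assume a: "q < num_states (pad M)" "length as = num_tapes (pad M)" "set as \<subseteq> {..<num_symbols (pad M)}"
    "delta (pad M) q as = Some (q', acts)"
  define bs where "bs = butlast as"
  have bs: "length bs = num_tapes M" "set bs \<subseteq> {..<num_symbols M}"
    using a(2,3) in_set_butlastD[of _ as] by (auto simp: bs_def pad_def)
  from a(4) obtain acts' where d: "pad_delta M q bs = Some (q', acts')" and acts: "acts = acts' @ [(2, Rgt)]"
    by (auto simp: pad_def bs_def)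
  obtain b bs' where b: "bs = b # bs'" using bs(1) M by (cases bs) (auto simp: turing_machine_def)
  have s: "num_symbols M \<ge> 3" "num_states M \<ge> 1" using M by (auto simp: turing_machine_def)
  have "q' < num_states (pad M) \<and> length acts' = num_tapes M \<and> fst ` set acts' \<subseteq> {..<num_symbols M}"
  proof (cases "q < 2")
    case True
    then have "q = 0 \<or> q = 1" by auto
    then show ?thesis using d bs s unfolding b
      by (auto simp: pad_delta_def stay_def pad_def split: if_splits)
  next
    case False
    then obtain r where r: "delta M (q - 2) bs = Some (r, acts')" "q' = r + 2"
      using d by (auto simp: pad_delta_def)
    have "q - 2 < num_states M" using a(1) False by (auto simp: pad_def)
    then have "r < num_states M \<and> length acts' = num_tapes M \<and> fst ` set acts' \<subseteq> {..<num_symbols M}"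
      using M bs r(1) unfolding turing_machine_def by blast
    then show ?thesis by (simp add: r(2) pad_def)
  qed
  then show "q' < num_states (pad M)" "length acts = num_tapes (pad M)"
    "fst ` set acts \<subseteq> {..<num_symbols (pad M)}"
    using s by (auto simp: acts pad_def)
qed

lemma step_pad:
  assumes "pad_delta M q (map scan ts) = Some (q', acts)" "length acts = length ts"
  shows "step (pad M) (q, ts @ [clock n]) = (q', map2 act acts ts @ [clock (Suc n)])"
  using assms by (simp add: step_eq pad_def act_clock)

context
  fixes M :: tm and p :: "bool list"
  assumes M: "turing_machine M"
begin

definition overwritten :: "nat \<Rightarrow> int \<Rightarrow> nat" where
  "overwritten i x = (if 0 \<le> x \<and> x < int (length p) then if x < int i then 2 else bit_sym (p ! nat x) else 0)"

definition blanks :: "tape list" where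
  "blanks = replicate (num_tapes M - 1) blank_tape"

lemma run_pad_right: "i \<le> length p \<Longrightarrow>
    run (pad M) p i = (0, (overwritten i, int i) # blanks @ [clock i])"
proof (induction i)
  case 0
  have "input_tape p = (overwritten 0, int 0)" by (auto simp: input_tape_def overwritten_def)
  moreover have "blank_tape = clock 0" by (auto simp: blank_tape_def clock_def written_def input_tape_def)
  moreover have "num_tapes M = Suc (num_tapes M - 1)" using M by (auto simp: turing_machine_def)
  ultimately show ?case
    by (metis (no_types, lifting) run_def funpow_0 init_config_def blanks_def pad_def tm.select_convs(1) diff_Suc_1
        replicate_append_same replicate_Suc)
next
  case (Suc i)
  have "overwritten i (int i) \<noteq> 0" using Suc.prems by (auto simp: overwritten_def bit_sym_def)
  then have "pad_delta M 0 (map scan ((overwritten i, int i) # blanks)) =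
      Some (0, (2, Rgt) # stay (map scan blanks))"
    by (simp add: pad_delta_def)
  from step_pad[OF this, of i] Suc
  have "run (pad M) p (Suc i) = (0, ((overwritten i)(int i := 2), int i + 1) # blanks @ [clock (Suc i)])"
    by (simp add: run_Suc act_stay) (simp add: stay_def)
  moreover have "(overwritten i)(int i := 2) = overwritten (Suc i)"
    using Suc.prems by (auto simp: overwritten_def fun_eq_iff)
  ultimately show ?case by (simp add: add.commute)
qed

lemma run_pad_left: "i \<le> length p \<Longrightarrow>
    run (pad M) p (length p + 1 + i) =
      (1, (overwritten (length p), int (length p) - 1 - int i) # blanks @ [clock (length p + 1 + i)])"
proof (induction i)
  case 0
  let ?n = "length p"
  have 0: "overwritten ?n (int ?n) = 0" by (simp add: overwritten_def)
  then have "pad_delta M 0 (map scan ((overwritten ?n, int ?n) # blanks)) =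
      Some (1, (0, Lft) # stay (map scan blanks))"
    by (simp add: pad_delta_def)
  from step_pad[OF this, of ?n] run_pad_right[of ?n] 0
  show ?case by (simp add: run_Suc act_stay fun_upd_idem) (simp add: stay_def)
next
  case (Suc i)
  let ?n = "length p"
  let ?h = "int ?n - 1 - int i"
  have "0 \<le> ?h" "?h < int ?n" using Suc.prems by auto
  then have "overwritten ?n ?h \<noteq> 0" by (simp add: overwritten_def)
  then have "pad_delta M 1 (map scan ((overwritten ?n, ?h) # blanks)) =
      Some (1, (overwritten ?n ?h, Lft) # stay (map scan blanks))"
    by (simp add: pad_delta_def)
  from step_pad[OF this, of "?n + 1 + i"] Suc
  show ?case by (simp add: run_Suc act_stay fun_upd_idem algebra_simps) (simp add: stay_def)
qed

text \<open>The count is \<open>length p\<close> steps to overwrite, one to turn around at the first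
  blank, \<open>length p\<close> steps back, and one from cell -1 onto cell 0.\<close>

lemma run_pad_start: "run (pad M) p (2 * length p + 2) =
    (2, snd (init_config M (replicate (length p) True)) @ [clock (2 * length p + 2)])"
proof -
  let ?n = "length p"
  have 0: "overwritten ?n (- 1) = 0" by (simp add: overwritten_def)
  then have "pad_delta M 1 (map scan ((overwritten ?n, - 1) # blanks)) =
      Some (2, (0, Rgt) # stay (map scan blanks))"
    by (simp add: pad_delta_def)
  from step_pad[OF this, of "?n + 1 + ?n"] run_pad_left[of ?n] 0
  have "run (pad M) p (Suc (?n + 1 + ?n)) = (2, (overwritten ?n, 0) # blanks @ [clock (Suc (?n + 1 + ?n))])"
    by (simp add: run_Suc act_stay fun_upd_idem) (simp add: stay_def)
  moreover have "Suc (?n + 1 + ?n) = 2 * ?n + 2" by simp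
  moreover have "(overwritten ?n, 0) = input_tape (replicate ?n True)"
    by (auto simp: overwritten_def input_tape_def bit_sym_def fun_eq_iff nat_less_iff)
  ultimately show ?thesis by (simp add: init_config_def blanks_def mult_2)
qed

lemma run_pad_main:
  assumes "\<And>s'. s' < s \<Longrightarrow> \<not> halts_within M (replicate (length p) True) s'"
  shows "run (pad M) p (2 * length p + 2 + s) =
    (fst (run M (replicate (length p) True) s) + 2,
     snd (run M (replicate (length p) True) s) @ [clock (2 * length p + 2 + s)])"
  using assms
proof (induction s)
  case 0
  then show ?case using run_pad_start by (simp add: run_def init_config_def)
next
  case (Suc s)
  let ?c = "run M (replicate (length p) True) s"
  have "\<not> halts_within M (replicate (length p) True) s" using Suc.prems by simp
  then obtain r where r: "delta M (fst ?c) (map scan (snd ?c)) = Some r"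
    by (auto simp: halts_within_def halted_def next_config_eq)
  have l: "legal M ?c" by (rule legal_run[OF M])
  have "length (snd r) = length (snd ?c)" using delta_legal(2)[OF M l, of "fst r" "snd r"] r l by (simp add: legal_def)
  moreover have "pad_delta M (fst ?c + 2) (map scan (snd ?c)) = Some (fst r + 2, snd r)"
    using r by (simp add: pad_delta_def)
  ultimately have "step (pad M) (fst ?c + 2, snd ?c @ [clock (2 * length p + 2 + s)]) =
      (fst r + 2, map2 act (snd r) (snd ?c) @ [clock (Suc (2 * length p + 2 + s))])"
    by (intro step_pad)
  then show ?case using Suc r by (simp add: run_Suc step_eq)
qed

text \<open>From state 2 on the padded machine is in lockstep with \<open>M\<close> on the all-ones
  input. Its exact running time therefore depends on the length of \<open>p\<close> alone, as
  time-constructibility demands.\<close>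

lemma halts_pad:
  assumes T: "halts_in_exactly M (replicate (length p) True) T"
  shows "halts_in_exactly (pad M) p (2 * length p + 2 + T)"
    and "snd (run (pad M) p (2 * length p + 2 + T)) \<noteq> []"
    and "last (snd (run (pad M) p (2 * length p + 2 + T))) = clock (2 * length p + 2 + T)"
proof -
  let ?n = "length p"
  have r: "run (pad M) p (2 * ?n + 2 + s) = (fst (run M (replicate ?n True) s) + 2,
     snd (run M (replicate ?n True) s) @ [clock (2 * ?n + 2 + s)])" if "s \<le> T" for s
    by (rule run_pad_main) (use T that in \<open>auto simp: halts_in_exactly_def\<close>)
  show "snd (run (pad M) p (2 * length p + 2 + T)) \<noteq> []"
    "last (snd (run (pad M) p (2 * length p + 2 + T))) = clock (2 * length p + 2 + T)"
    unfolding r[OF order_refl] by simp_all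
  have h: "halts_within (pad M) p (2 * ?n + 2 + s) \<longleftrightarrow> halts_within M (replicate ?n True) s" if "s \<le> T" for s
    unfolding halts_within_def r[OF that]
    by (simp add: halted_def next_config_eq pad_def pad_delta_def)
  have "\<not> halts_within (pad M) p s" if "s < 2 * ?n + 2 + T" for s
  proof (cases "s < 2 * ?n + 2")
    case False
    then obtain s' where "s = 2 * ?n + 2 + s'" using le_Suc_ex not_less by blast
    then show ?thesis using h[of s'] that T by (simp add: halts_in_exactly_def)
  next
    case True
    \<comment> \<open>Halting persists, so excluding it at the last step before the simulation
      excludes it at all earlier steps.\<close>
    have "\<not> halts_within (pad M) p (2 * ?n + 1)"
    proof -
      have "run (pad M) p (2 * ?n + 1) = (1, (overwritten ?n, -1) # blanks @ [clock (2 * ?n + 1)])"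
        using run_pad_left[of ?n] by (simp add: mult_2)
      then show ?thesis by (simp add: halts_within_def halted_def next_config_eq pad_def pad_delta_def)
    qed
    then show ?thesis using True halts_within_mono[of "pad M" p s "2 * ?n + 1"] by auto
  qed
  then show "halts_in_exactly (pad M) p (2 * length p + 2 + T)"
    using h[of T] T by (simp add: halts_in_exactly_def)
qed

end

text \<open>Output cells carry bits, whereas by \<open>run_bounds\<close> all cells from position
  \<open>length p + s\<close> on are blank.\<close>

lemma output_length_bound:
  assumes "turing_machine M" "computes_within M p x s"
  shows "length x \<le> length p + s"
proof (rule ccontr)
  assume "\<not> length x \<le> length p + s"
  then have l: "length p + s < length x" by simp
  let ?t = "last (snd (run M p s))"
  have "snd (run M p s) \<noteq> []" using legal_run[OF assms(1), of p s] assms(1)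
    by (auto simp: legal_def turing_machine_def)
  then have "fst ?t (int (length p + s)) = 0" using run_bounds(2)[of ?t M p s] by simp
  moreover have "fst ?t (int (length p + s)) = bit_sym (x ! (length p + s))"
    using assms(2) l by (simp add: computes_within_def has_output_def Let_def del: of_nat_add)
  ultimately show False by (simp add: bit_sym_def split: if_splits)
qed

text \<open>Printing \<open>t n\<close> ones takes time: the running time plus the input length
  bounds \<open>t n\<close>, and padding adds more than the input length. The unary step count is
  itself the output, so the new bound is recursive.\<close>

theorem recursive_padded:
  assumes "recursive t"
  shows "\<exists>M T. turing_machine M \<and> (\<forall>n. t n \<le> T n) \<and> (\<forall>p. halts_in_exactly M p (T (length p))) \<and> recursive T"
proof -
  obtain M where M: "turing_machine M"
    and t: "\<And>n. computes M (replicate n True) (replicate (t n) True)"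
    using assms unfolding recursive_def by blast
  define T where "T n = (LEAST s. halts_within M (replicate n True) s)" for n
  have T: "halts_in_exactly M (replicate n True) (T n)" for n
  proof -
    obtain s where "halts_within M (replicate n True) s"
      using t[of n] unfolding computes_def computes_within_def by blast
    then show ?thesis unfolding halts_in_exactly_def T_def using LeastI not_less_Least by metis
  qed
  have le0: "t n \<le> n + T n" for n
  proof -
    obtain s where s: "computes_within M (replicate n True) (replicate (t n) True) s"
      using t[of n] unfolding computes_def by blast
    have "T n \<le> s" using s Least_le unfolding T_def computes_within_def by blast
    then have "run M (replicate n True) s = run M (replicate n True) (T n)"
      using run_halted[of M "replicate n True" "T n" "s - T n"] T[of n] by (simp add: halts_in_exactly_def)
    then have "computes_within M (replicate n True) (replicate (t n) True) (T n)"
      using s T[of n] by (simp add: computes_within_def halts_in_exactly_def)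
    from output_length_bound[OF M this] show ?thesis by simp
  qed
  have le: "t n \<le> 2 * n + 2 + T n" for n using le0[of n] by simp
  have "computes (pad M) (replicate n True) (replicate (2 * n + 2 + T n) True)" for n
  proof -
    have n: "halts_in_exactly M (replicate (length (replicate n True)) True) (T n)" using T by simp
    note h = halts_pad[OF M n, simplified]
    have "fst (clock k) (int k) \<notin> range bit_sym" for k
      by (auto simp: clock_def written_def input_tape_def bit_sym_def)
    moreover have "i < k \<Longrightarrow> fst (clock k) (int i) = bit_sym True" for i k
      by (auto simp: clock_def written_def input_tape_def)
    ultimately have "last (snd c) = clock k \<Longrightarrow> has_output c (replicate k True)" for c k
      by (simp add: has_output_def Let_def)
    from this[OF h(3)]
    have "has_output (run (pad M) (replicate n True) (2 * n + 2 + T n)) (replicate (2 * n + 2 + T n) True)" by simp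
    then show ?thesis using h(1) unfolding computes_def computes_within_def halts_in_exactly_def by auto
  qed
  then have "recursive (\<lambda>n. 2 * n + 2 + T n)"
    unfolding recursive_def using turing_machine_pad[OF M] by blast
  moreover have "halts_in_exactly (pad M) p (2 * length p + 2 + T (length p))" for p
    by (rule halts_pad(1)[OF M T])
  ultimately show ?thesis using turing_machine_pad[OF M] le
    by (intro exI[of _ "pad M"] exI[of _ "\<lambda>n. 2 * n + 2 + T n"]) simp
qed

section \<open>Kraft's inequality and output probabilities\<close>

definition strings :: "nat \<Rightarrow> bool list list" where
  "strings n = ((\<lambda>l. map (Cons True) l @ map (Cons False) l) ^^ n) [[]]"

lemma strings_Suc: "strings (Suc n) = map (Cons True) (strings n) @ map (Cons False) (strings n)"
  by (simp add: strings_def)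

lemma set_strings: "set (strings n) = {x. length x = n}"
proof (induction n)
  case 0
  show ?case by (simp add: strings_def)
next
  case (Suc n)
  show ?case
  proof (intro set_eqI iffI)
    fix x assume "x \<in> {x :: bool list. length x = Suc n}"
    then obtain b y where "x = b # y" "length y = n" by (cases x) auto
    then show "x \<in> set (strings (Suc n))" using Suc by (cases b) (auto simp: strings_Suc)
  qed (use Suc in \<open>auto simp: strings_Suc\<close>)
qed

lemma distinct_strings: "distinct (strings n)"
  by (induction n) (auto simp: strings_Suc distinct_map, simp add: strings_def)

lemma length_strings: "length (strings n) = 2 ^ n"
  by (induction n) (simp_all add: strings_Suc, simp add: strings_def)

lemma finite_length_eq: "finite {x :: bool list. length x = n}"
  using set_strings[of n] by (metis finite_set)

lemma card_length_eq: "card {x :: bool list. length x = n} = 2 ^ n"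
  using distinct_card[OF distinct_strings, of n] by (simp add: set_strings length_strings)

text \<open>Each codeword is extended in all ways to a common length \<open>L\<close>.
  Prefix-freeness keeps the sets of extensions disjoint, and together they fit into the
  \<open>2 ^ L\<close> strings of that length.\<close>

lemma kraft:
  fixes A :: "bool list set"
  assumes A: "finite A" and pf: "\<And>p q. p \<in> A \<Longrightarrow> q \<in> A \<Longrightarrow> \<not> strict_prefix p q"
  shows "(\<Sum>p\<in>A. 1 / 2 ^ length p :: real) \<le> 1"
proof -
  define L where "L = Max (insert 0 (length ` A))"
  have L: "length p \<le> L" if "p \<in> A" for p using that A by (simp add: L_def)
  define E where "E p = (\<lambda>v. p @ v) ` {v :: bool list. length v = L - length p}" for p
  have cE: "card (E p) = 2 ^ (L - length p)" for p
    unfolding E_def by (subst card_image) (auto simp: card_length_eq inj_on_def)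
  have disj: "E p \<inter> E q = {}" if pq: "p \<in> A" "q \<in> A" "p \<noteq> q" for p q
  proof (rule ccontr)
    assume "E p \<inter> E q \<noteq> {}"
    then obtain v w where "p @ v = q @ w" by (auto simp: E_def)
    then have "prefix p q \<or> prefix q p" by (metis prefixI prefix_same_cases)
    then show False using pf pq by (metis strict_prefixI)
  qed
  have "(\<Sum>p\<in>A. 2 ^ (L - length p)) = card (\<Union>p\<in>A. E p)"
    using A disj by (subst card_UN_disjoint) (auto simp: cE, auto simp: E_def finite_length_eq)
  also have "\<dots> \<le> card {x :: bool list. length x = L}"
    using L by (intro card_mono) (auto simp: E_def finite_length_eq)
  finally have "(\<Sum>p\<in>A. 2 ^ (L - length p)) \<le> (2 ^ L :: nat)" by (simp only: card_length_eq)
  then have "real (\<Sum>p\<in>A. 2 ^ (L - length p)) \<le> real (2 ^ L)" by (rule of_nat_mono)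
  then have "(\<Sum>p\<in>A. 2 ^ (L - length p) :: real) \<le> 2 ^ L" by simp
  then have "(\<Sum>p\<in>A. 2 ^ (L - length p) / 2 ^ L :: real) \<le> 1" by (simp flip: sum_divide_distrib)
  moreover have "2 ^ (L - length p) / 2 ^ L = (1 / 2 ^ length p :: real)" if "p \<in> A" for p
    using L[OF that] by (simp add: power_diff)
  ultimately show ?thesis by simp
qed

lemma prefix_machine_turing: "prefix_machine U \<Longrightarrow> turing_machine U"
  by (simp add: prefix_machine_def)

lemma computes_prefix_free:
  "prefix_machine U \<Longrightarrow> computes U p x \<Longrightarrow> computes U q y \<Longrightarrow> \<not> strict_prefix p q"
  unfolding prefix_machine_def computes_def computes_within_def by blast

lemma computes_unique: "computes U p x \<Longrightarrow> computes U p y \<Longrightarrow> x = y"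
  unfolding computes_def using computes_within_unique by blast

lemma finite_sum_programs_le_1:
  "prefix_machine U \<Longrightarrow> finite F \<Longrightarrow> F \<subseteq> {p. computes U p x} \<Longrightarrow> (\<Sum>p\<in>F. 1 / 2 ^ length p :: real) \<le> 1"
  by (rule kraft) (auto dest: computes_prefix_free)

lemma summable_programs:
  assumes "prefix_machine U"
  shows "(\<lambda>p. 1 / 2 ^ length p :: real) summable_on {p. computes U p x}"
  using finite_sum_programs_le_1[OF assms]
  by (intro nonneg_bdd_above_summable_on bdd_aboveI2[where M = 1]) auto

lemma Q_finite_le:
  "prefix_machine U \<Longrightarrow> finite F \<Longrightarrow> F \<subseteq> {p. computes U p x} \<Longrightarrow> (\<Sum>p\<in>F. 1 / 2 ^ length p) \<le> Q U x"
  unfolding Q_def by (intro finite_sum_le_infsum summable_programs) auto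

lemma Q_le_1: "prefix_machine U \<Longrightarrow> Q U x \<le> 1"
  unfolding Q_def
  by (intro infsum_le_finite_sums summable_programs finite_sum_programs_le_1) auto

lemma Q_program_le: "prefix_machine U \<Longrightarrow> computes U p x \<Longrightarrow> 1 / 2 ^ length p \<le> Q U x"
  using Q_finite_le[of U "{p}" x] by simp

text \<open>An infinite sum of nonnegative terms is the supremum of its finite partial sums, so a
  strict lower bound on \<open>Q\<close> shows up after finitely many programs.\<close>

lemma Q_approx:
  assumes U: "prefix_machine U" and c: "c < Q U x"
  obtains F where "finite F" "F \<subseteq> {p. computes U p x}" "c < (\<Sum>p\<in>F. 1 / 2 ^ length p)"
proof (rule ccontr)
  assume "\<not> thesis"
  then have "\<And>F. finite F \<Longrightarrow> F \<subseteq> {p. computes U p x} \<Longrightarrow> (\<Sum>p\<in>F. 1 / 2 ^ length p) \<le> c"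
    using that not_less by blast
  then have "Q U x \<le> c" unfolding Q_def by (intro infsum_le_finite_sums summable_programs[OF U]) auto
  with c show False by simp
qed

section \<open>Decidable approximations of the output probability\<close>

definition programs :: "tm \<Rightarrow> bool list \<Rightarrow> nat \<Rightarrow> bool list set" where
  "programs U y s = {p. length p \<le> s \<and> computes_within U p y s}"

lemma programs_computes: "programs U y s \<subseteq> {p. computes U p y}"
  by (auto simp: programs_def computes_def)

lemma finite_programs: "finite (programs U y s)"
proof (rule finite_subset)
  show "programs U y s \<subseteq> (\<Union>n\<in>{..s}. {p. length p = n})" by (auto simp: programs_def)
qed (simp add: finite_length_eq)

text \<open>The cutoff \<open>length p \<le> s\<close> in \<open>programs\<close> loses nothing
  here: the strict inequality \<open>t (length y) < s\<close> pays for the \<open>Suc\<close> in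
  \<open>prefix_machine_length\<close>.\<close>

lemma Qt_le_programs:
  assumes U: "prefix_machine U" and s: "t (length y) < s"
  shows "Qt U t y \<le> (\<Sum>p\<in>programs U y s. 1 / 2 ^ length p)"
proof -
  have sub: "{p. computes_within U p y (t (length y))} \<subseteq> programs U y s"
  proof
    fix p assume "p \<in> {p. computes_within U p y (t (length y))}"
    then have p: "computes_within U p y (t (length y))" by simp
    then have "length p \<le> Suc (t (length y))"
      using prefix_machine_length[OF U] unfolding computes_within_def by blast
    then show "p \<in> programs U y s"
      using s computes_within_mono[OF p, of s] by (auto simp: programs_def)
  qed
  then have "finite {p. computes_within U p y (t (length y))}" using finite_programs finite_subset by blast
  then have "Qt U t y = (\<Sum>p\<in>{p. computes_within U p y (t (length y))}. 1 / 2 ^ length p)"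
    unfolding Qt_def by (rule infsum_finite)
  also have "\<dots> \<le> (\<Sum>p\<in>programs U y s. 1 / 2 ^ length p)"
    by (rule sum_mono2[OF finite_programs sub]) simp
  finally show ?thesis .
qed

lemma Qt_program_le:
  assumes U: "prefix_machine U" and p: "computes_within U p y (t (length y))"
  shows "1 / 2 ^ length p \<le> Qt U t y"
proof -
  have "{p. computes_within U p y (t (length y))} \<subseteq> {p. computes U p y}" by (auto simp: computes_def)
  then have "(\<lambda>p. 1 / 2 ^ length p :: real) summable_on {p. computes_within U p y (t (length y))}"
    using summable_on_subset_banach summable_programs[OF U] by blast
  from finite_sum_le_infsum[OF this, of "{p}"] p show ?thesis by (simp add: Qt_def)
qed

text \<open>The partial sum of probabilities multiplied by \<open>2 ^ s\<close>. All program lengths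
  are at most \<open>s\<close>, so the denominators vanish and heaviness becomes a comparison of
  natural numbers.\<close>

definition weight :: "tm \<Rightarrow> bool list \<Rightarrow> nat \<Rightarrow> nat" where
  "weight U y s = sum_list (map (\<lambda>p. 2 ^ (s - length p))
     (filter (\<lambda>p. computes_within U p y s) (concat (map strings [0..<Suc s]))))"

lemma weight: "real (weight U y s) = 2 ^ s * (\<Sum>p\<in>programs U y s. 1 / 2 ^ length p)"
proof -
  have "distinct (concat (map strings [0..<k]))" for k
    by (induction k) (auto simp: distinct_strings set_strings)
  moreover have "set (filter (\<lambda>p. computes_within U p y s) (concat (map strings [0..<Suc s]))) = programs U y s"
    by (auto simp: set_strings programs_def)
  ultimately have "weight U y s = (\<Sum>p\<in>programs U y s. 2 ^ (s - length p))"
    unfolding weight_def by (subst sum_list_distinct_conv_sum_set) (simp_all del: upt_Suc)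
  also have "real \<dots> = (\<Sum>p\<in>programs U y s. 2 ^ s * (1 / 2 ^ length p))"
    unfolding of_nat_sum of_nat_power by (rule sum.cong) (auto simp: programs_def power_diff)
  finally show ?thesis by (simp add: sum_distrib_left)
qed

text \<open>
  The first alternative makes level \<open>j = n\<close> contain all strings of length \<open>n\<close>, so that levels
  \<open>j \<le> n\<close> suffice.
\<close>

definition heavy :: "tm \<Rightarrow> nat \<Rightarrow> nat \<Rightarrow> nat \<Rightarrow> bool list \<Rightarrow> bool" where
  "heavy U n j s y \<longleftrightarrow> n \<le> j \<or> 2 ^ s \<le> 2 ^ j * weight U y s"

lemma heavy_iff: "heavy U n j s y \<longleftrightarrow> n \<le> j \<or> (1 / 2 ^ j :: real) \<le> (\<Sum>p\<in>programs U y s. 1 / 2 ^ length p)"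
proof -
  have "2 ^ s \<le> 2 ^ j * weight U y s \<longleftrightarrow> real (2 ^ s) \<le> real (2 ^ j * weight U y s)"
    by (rule of_nat_le_iff[symmetric])
  also have "\<dots> \<longleftrightarrow> (2::real) ^ s * 1 \<le> 2 ^ s * (2 ^ j * (\<Sum>p\<in>programs U y s. 1 / 2 ^ length p))"
    by (simp add: weight mult_ac)
  also have "\<dots> \<longleftrightarrow> 1 \<le> 2 ^ j * (\<Sum>p\<in>programs U y s. 1 / 2 ^ length p :: real)"
    by (subst mult_le_cancel_left_pos) auto
  finally show ?thesis by (simp add: heavy_def field_simps)
qed

text \<open>Below level \<open>n\<close>, each string owns programs of total weight at least
  \<open>1 / 2 ^ j\<close>; their union over \<open>A\<close> is prefix-free and has weight at most
  1. From level \<open>n\<close> on, counting all strings of length \<open>n\<close> is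
  enough.\<close>

lemma card_heavy:
  assumes U: "prefix_machine U" and A: "finite A" "\<And>y. y \<in> A \<Longrightarrow> length y = n \<and> (\<exists>s. heavy U n j s y)"
  shows "card A \<le> 2 ^ j"
proof (cases "n \<le> j")
  case True
  have "card A \<le> card {y :: bool list. length y = n}" using A by (intro card_mono) (auto simp: finite_length_eq)
  also have "\<dots> \<le> 2 ^ j" using True by (simp add: card_length_eq)
  finally show ?thesis .
next
  case False
  \<comment> \<open>Every string may become heavy at a stage of its own, hence a choice
    function.\<close>
  then obtain s where s: "\<And>y. y \<in> A \<Longrightarrow> 1 / 2 ^ j \<le> (\<Sum>p\<in>programs U y (s y). 1 / 2 ^ length p :: real)"
    using A(2) unfolding heavy_iff by metis
  have disj: "programs U y (s y) \<inter> programs U z (s z) = {}" if "y \<noteq> z" for y z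
    using that computes_unique programs_computes by blast
  have "real (card A) * (1 / 2 ^ j) = (\<Sum>y\<in>A. 1 / 2 ^ j)" by simp
  also have "\<dots> \<le> (\<Sum>y\<in>A. \<Sum>p\<in>programs U y (s y). 1 / 2 ^ length p)" by (rule sum_mono) (rule s)
  also have "\<dots> = (\<Sum>p\<in>(\<Union>y\<in>A. programs U y (s y)). 1 / 2 ^ length p)"
    using A(1) disj finite_programs by (intro sum.UNION_disjoint[symmetric]) blast+
  also have "\<dots> \<le> 1"
    using A(1) finite_programs computes_prefix_free[OF U] programs_computes
    by (intro kraft) blast+
  finally have "real (card A) \<le> real (2 ^ j)" by (simp add: field_simps)
  then show ?thesis using of_nat_le_iff by blast
qed

text \<open>Dyadic rounding of -log q, cut off at \<open>n\<close>. Failure of the preceding level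
  gives the factor 2, which later costs one bit; the strict \<open>1 / 2 ^ j < q\<close> leaves room
  for a finite approximation of \<open>q\<close>.\<close>

lemma level_exists:
  fixes q :: real
  assumes "q \<le> 1"
  shows "\<exists>j\<le>n. q \<le> 2 / 2 ^ j \<and> (n \<le> j \<or> 1 / 2 ^ j < q)"
proof -
  define j where "j = (LEAST j. n \<le> j \<or> 1 / 2 ^ j < q)"
  have j: "n \<le> j \<or> 1 / 2 ^ j < q" unfolding j_def by (rule LeastI[of _ n]) simp
  have "j \<le> n" unfolding j_def by (rule Least_le) simp
  moreover have "q \<le> 2 / 2 ^ j"
  proof (cases j)
    case (Suc i)
    then have "\<not> (n \<le> i \<or> 1 / 2 ^ i < q)" using not_less_Least[of i "\<lambda>j. n \<le> j \<or> 1 / 2 ^ j < q"] by (simp add: j_def)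
    then show ?thesis using Suc by simp
  qed (use assms in simp)
  ultimately show ?thesis using j by blast
qed

section \<open>The decoding machine\<close>

definition hdr :: "nat \<Rightarrow> bool list" where
  "hdr a = replicate a True @ [False]"

lemma prefix_hdr: "prefix (hdr a @ x) (hdr b @ y) \<Longrightarrow> a = b \<and> prefix x y"
proof (induction a arbitrary: b)
  case 0
  then show ?case by (cases b) (auto simp: hdr_def)
next
  case (Suc a)
  then show ?case by (cases b) (auto simp: hdr_def)
qed

text \<open>
  Writing a number \<open>n\<close> as a Cantor pair of two unary numbers is self-delimiting and takes only
  \<open>O(sqrt n)\<close> bits, which is within the permitted error \<open>o(n)\<close>.
\<close>

definition codeword :: "nat \<Rightarrow> nat \<Rightarrow> bool list \<Rightarrow> bool list" where
  "codeword n j u = hdr (fst (prod_decode n)) @ hdr (snd (prod_decode n)) @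
     hdr (fst (prod_decode j)) @ hdr (snd (prod_decode j)) @ u"

lemma prod_decode_eqI:
  "fst (prod_decode n) = fst (prod_decode m) \<Longrightarrow> snd (prod_decode n) = snd (prod_decode m) \<Longrightarrow> n = m"
  by (metis prod.expand prod_decode_inverse)

lemma prefix_codeword:
  assumes "prefix (codeword n j u) (codeword n' j' u')"
  shows "n = n' \<and> j = j' \<and> prefix u u'"
proof -
  have *: "fst (prod_decode n) = fst (prod_decode n') \<and> snd (prod_decode n) = snd (prod_decode n') \<and>
    fst (prod_decode j) = fst (prod_decode j') \<and> snd (prod_decode j) = snd (prod_decode j') \<and> prefix u u'"
    using assms unfolding codeword_def by (metis prefix_hdr)
  then show ?thesis by (simp add: prod_decode_eqI)
qed

text \<open>Strings are appended when first seen to be heavy and never move again, so a position in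
  the list is a stage-independent name for the string.\<close>

fun heavy_list :: "tm \<Rightarrow> nat \<Rightarrow> nat \<Rightarrow> nat \<Rightarrow> bool list list" where
  "heavy_list U n j 0 = []"
| "heavy_list U n j (Suc s) = heavy_list U n j s @ filter (\<lambda>y. y \<notin> set (heavy_list U n j s) \<and> heavy U n j s y) (strings n)"

lemma heavy_list_props:
  "distinct (heavy_list U n j s) \<and> (\<forall>y\<in>set (heavy_list U n j s). length y = n \<and> (\<exists>s. heavy U n j s y))"
  by (induction s) (auto simp: distinct_strings set_strings)

lemma length_heavy_list: "prefix_machine U \<Longrightarrow> length (heavy_list U n j s) \<le> 2 ^ j"
  using card_heavy[of U "set (heavy_list U n j s)" n j] heavy_list_props[of U n j s] by (simp add: distinct_card)

lemma heavy_list_mono: "s \<le> s' \<Longrightarrow> prefix (heavy_list U n j s) (heavy_list U n j s')"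
proof (induction s' rule: dec_induct)
  case (step s')
  then show ?case by (auto intro: prefix_order.trans)
qed simp

lemma heavy_in_heavy_list: "heavy U n j s y \<Longrightarrow> length y = n \<Longrightarrow> y \<in> set (heavy_list U n j (Suc s))"
  by (auto simp: set_strings)

text \<open>The i-th string discovered at level \<open>j\<close> is named by the i-th block of
  \<open>j\<close> bits; \<open>length_heavy_list\<close> ensures that \<open>zip\<close> cuts off
  no string.\<close>

definition table :: "tm \<Rightarrow> nat \<Rightarrow> nat \<Rightarrow> nat \<Rightarrow> (bool list \<times> bool list) list" where
  "table U n j s = map (\<lambda>p. (codeword n j (fst p), snd p)) (zip (strings j) (heavy_list U n j s))"

lemma table_iff: "(q, y) \<in> set (table U n j s) \<longleftrightarrow>
    (\<exists>i < length (heavy_list U n j s). i < 2 ^ j \<and> q = codeword n j (strings j ! i) \<and> y = heavy_list U n j s ! i)"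
  by (force simp: table_def set_zip length_strings)

text \<open>The headers fix \<open>n\<close> and \<open>j\<close>, and then blocks of equal length
  \<open>j\<close> are comparable only if equal. Since positions are stable, the decoded string is
  the same at both stages.\<close>

lemma table_prefix_free:
  assumes "(q, y) \<in> set (table U n j s)" "(q', y') \<in> set (table U n' j' s')" "prefix q q'"
  shows "q = q' \<and> y = y'"
proof -
  obtain i where i: "i < length (heavy_list U n j s)" "i < 2 ^ j" "q = codeword n j (strings j ! i)" "y = heavy_list U n j s ! i"
    using assms(1) by (auto simp: table_iff)
  obtain i' where i': "i' < length (heavy_list U n' j' s')" "i' < 2 ^ j'" "q' = codeword n' j' (strings j' ! i')" "y' = heavy_list U n' j' s' ! i'"
    using assms(2) by (auto simp: table_iff)
  have e: "n = n'" "j = j'" "prefix (strings j ! i) (strings j' ! i')"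
    using prefix_codeword assms(3) i(3) i'(3) by blast+
  have "strings j ! i \<in> set (strings j)" "strings j' ! i' \<in> set (strings j')"
    using i(2) i'(2) by (simp_all add: length_strings)
  then have "strings j ! i = strings j ! i'" using e by (auto simp: set_strings prefix_def)
  then have ii: "i = i'" using i(2) i'(2) e(2) distinct_strings[of j] by (simp add: nth_eq_iff_index_eq length_strings)
  have "heavy_list U n j s ! i = heavy_list U n j s' ! i"
  proof (cases "s \<le> s'")
    case True
    from heavy_list_mono[OF this, of U n j] i(1) show ?thesis by (auto simp: prefix_def nth_append)
  next
    case False
    then have "s' \<le> s" by simp
    from heavy_list_mono[OF this, of U n j] i'(1) show ?thesis by (auto simp: prefix_def nth_append ii e)
  qed
  then show ?thesis using e i i' ii by simp
qed

section \<open>Computability of the table and the decoder\<close>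

lemma pr_strings [pr_intros]: "pr n \<Longrightarrow> pr (\<lambda>x. strings (n x))"
  unfolding strings_def by (intro pr_intros)

lemma pr_heavy:
  assumes U: "turing_machine U" and n: "pr n" and j: "pr j" and s: "pr s" and y: "pr y"
  shows "pr (\<lambda>x. heavy U (n x) (j x) (s x) (y x))"
  unfolding heavy_def weight_def by (intro pr_intros U n j s y pr_comp[OF s] pr_comp[OF y])

lemma pr_heavy_list:
  assumes U: "turing_machine U" and n: "pr n" and j: "pr j" and s: "pr s"
  shows "pr (\<lambda>x. heavy_list U (n x) (j x) (s x))"
proof -
  define F where "F x p = (Suc (fst p), snd p @ filter (\<lambda>y. y \<notin> set (snd p) \<and> heavy U (n x) (j x) (fst p) y) (strings (n x)))"
    for x and p :: "nat \<times> bool list list"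
  have "pr (\<lambda>x. snd ((F x ^^ s x) (0, [])))"
    unfolding F_def by (intro pr_intros pr_heavy U n j s pr_comp[OF n] pr_comp[OF j])
  moreover have "(F x ^^ k) (0, []) = (k, heavy_list U (n x) (j x) k)" for x k
    by (induction k) (auto simp: F_def)
  ultimately show ?thesis by simp
qed

lemma pr_prod_decode [pr_intros]: "pr f \<Longrightarrow> pr (\<lambda>x. prod_decode (f x))"
proof -
  have "pr prod_decode" by (rule prI[OF prim_id]) (simp add: enc_prod_def enc_nat_def)
  then show "pr f \<Longrightarrow> pr (\<lambda>x. prod_decode (f x))" by (rule pr_comp)
qed

lemma pr_codeword [pr_intros]:
  "pr n \<Longrightarrow> pr j \<Longrightarrow> pr u \<Longrightarrow> pr (\<lambda>x. codeword (n x) (j x) (u x))"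
  unfolding codeword_def hdr_def by (intro pr_intros)

lemma pr_table:
  assumes U: "turing_machine U" and n: "pr n" and j: "pr j" and s: "pr s"
  shows "pr (\<lambda>x. table U (n x) (j x) (s x))"
  unfolding table_def by (intro pr_intros pr_heavy_list U n j s pr_comp[OF n] pr_comp[OF j])

text \<open>The search variable codes \<open>n\<close>, \<open>j\<close> and the stage together.
  Halting requires that the input occurs in some table, so the domain inherits prefix-freeness from
  the codewords.\<close>

lemma decoding_machine:
  assumes U: "prefix_machine U"
  shows "\<exists>M. prefix_machine M \<and> (\<forall>n j s q y. (q, y) \<in> set (table U n j s) \<longrightarrow> computes M q y)"
proof -
  define tab where "tab z = table U (fst (prod_decode z)) (fst (prod_decode (snd (prod_decode z)))) (snd (prod_decode (snd (prod_decode z))))" for z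
  define P where "P x = (map_of (tab (snd x)) (fst x) \<noteq> None)" for x :: "bool list \<times> nat"
  define g where "g x = (case map_of (tab (snd x)) (fst x) of None \<Rightarrow> [] | Some y \<Rightarrow> y)" for x :: "bool list \<times> nat"
  note tm = prefix_machine_turing[OF U]
  have tab: "pr f \<Longrightarrow> pr (\<lambda>x. tab (f x))" for f :: "bool list \<times> nat \<Rightarrow> nat"
    unfolding tab_def by (intro pr_table tm pr_intros)
  have "pr P" unfolding P_def by (intro pr_intros tab)
  moreover have "pr g" unfolding g_def by (intro pr_intros tab)
  ultimately obtain M where M: "turing_machine M"
    and c: "\<And>q z. P (q, z) \<Longrightarrow> \<forall>z'<z. \<not> P (q, z') \<Longrightarrow> computes M q (g (q, z))"
    and h: "\<And>q s. halts_within M q s \<Longrightarrow> \<exists>z. P (q, z)"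
    using search_machine[of P g] by blast
  have Pin: "\<exists>y. (q, y) \<in> set (tab z) \<and> g (q, z) = y" if "P (q, z)" for q z
    using that by (auto simp: P_def g_def dest: map_of_SomeD)
  have "\<not> strict_prefix p q" if hpq: "halts_within M p s" "halts_within M q s'" for p q s s'
  proof
    assume "strict_prefix p q"
    moreover obtain z y z' y' where "(p, y) \<in> set (tab z)" "(q, y') \<in> set (tab z')"
      using h[OF hpq(1)] h[OF hpq(2)] Pin by blast
    ultimately show False using table_prefix_free unfolding tab_def strict_prefix_def by blast
  qed
  then have "prefix_machine M" using M by (simp add: prefix_machine_def)
  moreover have "computes M q y" if q: "(q, y) \<in> set (table U n j s)" for n j s q y
  proof -
    define z where "z = prod_encode (n, prod_encode (j, s))"
    have "(q, y) \<in> set (tab z)" using q by (simp add: tab_def z_def)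
    then have "P (q, z)" by (force simp: P_def map_of_eq_None_iff)
    \<comment> \<open>The machine stops at the least witness, whose level and stage need not be
      \<open>j\<close> and \<open>s\<close>; \<open>table_prefix_free\<close> shows that the decoded
      string is nevertheless \<open>y\<close>.\<close>
    define l where "l = (LEAST z. P (q, z))"
    have l: "P (q, l)" unfolding l_def by (rule LeastI) fact
    moreover have "\<forall>z'<l. \<not> P (q, z')" unfolding l_def using not_less_Least by blast
    ultimately have "computes M q (g (q, l))" by (rule c)
    moreover have "g (q, l) = y" using Pin[OF l] table_prefix_free[OF _ q, of q] unfolding tab_def by blast
    ultimately show ?thesis by simp
  qed
  ultimately show ?thesis by blast
qed

text \<open>A pair with sum k lies on the k-th antidiagonal, so its code is at least k(k +
  1)/2.\<close>

lemma prod_decode_sum_le: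
  "fst (prod_decode m) + snd (prod_decode m) \<le> floor_sqrt (2 * m)"
proof -
  obtain a b where ab: "prod_decode m = (a, b)" by fastforce
  then have "m = prod_encode (a, b)" by (metis prod_decode_inverse)
  then have "2 * m = 2 * triangle (a + b) + 2 * a" by (simp add: prod_encode_def)
  moreover have "2 * triangle (a + b) = (a + b) * Suc (a + b)" unfolding triangle_def
    by (rule dvd_mult_div_cancel) simp
  ultimately have "(a + b)\<^sup>2 \<le> 2 * m" by (simp add: power2_eq_square)
  then show ?thesis by (simp add: ab le_floor_sqrt_iff)
qed

text \<open>Each of \<open>n\<close> and \<open>j\<close> contributes at most
  \<open>floor_sqrt (2 * n)\<close> ones; the 4 counts the terminating \<open>False\<close> of the
  four headers.\<close>

lemma length_codeword:
  assumes "j \<le> n"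
  shows "length (codeword n j u) \<le> length u + 2 * floor_sqrt (2 * n) + 4"
proof -
  have "floor_sqrt (2 * j) \<le> floor_sqrt (2 * n)" using assms by (intro monoD[OF mono_floor_sqrt]) simp
  then show ?thesis using prod_decode_sum_le[of n] prod_decode_sum_le[of j] by (simp add: codeword_def hdr_def)
qed

lemma significance_sqrt: "significance (\<lambda>n. c + 2 * floor_sqrt (2 * n))"
  unfolding significance_def
proof (rule landau_o.smallI)
  fix e :: real assume e: "e > 0"
  \<comment> \<open>Half of \<open>e * n\<close> is reserved for the constant
    \<open>c + 4 / e\<close>, the other half for the square root.\<close>
  define N where "N = (c + 4 / e) * 2 / e"
  have "norm (real (c + 2 * floor_sqrt (2 * n))) \<le> e * norm (real n)" if n: "real n \<ge> N" for n
  proof -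
    define k where "k = real (floor_sqrt (2 * n))"
    have "(floor_sqrt (2 * n))\<^sup>2 \<le> 2 * n" by (rule floor_sqrt_power2_le)
    then have "real ((floor_sqrt (2 * n))\<^sup>2) \<le> real (2 * n)" by (rule of_nat_mono)
    then have k: "k\<^sup>2 \<le> 2 * n" by (simp add: k_def)
    \<comment> \<open>Completing the square trades the term linear in \<open>k\<close> for one in
      \<open>k^2\<close>, which is at most \<open>2 * n\<close>.\<close>
    have "0 \<le> (e * k - 4)\<^sup>2" by simp
    also have "\<dots> = e\<^sup>2 * k\<^sup>2 - 8 * e * k + 16" by (simp add: power2_eq_square algebra_simps)
    also have "\<dots> \<le> e\<^sup>2 * (2 * n) - 8 * e * k + 16" using k e by (simp add: mult_left_mono)
    finally have "4 * e * (2 * k) \<le> 2 * e\<^sup>2 * n + 16" by simp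
    also have "\<dots> = 4 * e * (e * n / 2 + 4 / e)" using e by (simp add: field_simps power2_eq_square)
    finally have "4 * e * (2 * k) \<le> 4 * e * (e * n / 2 + 4 / e)" .
    then have "2 * k \<le> e * n / 2 + 4 / e" using e by (subst (asm) mult_le_cancel_left_pos) auto
    moreover have "c + 4 / e \<le> e * n / 2" using n e by (simp add: N_def field_simps)
    ultimately show ?thesis by (simp add: k_def)
  qed
  moreover have "\<forall>\<^sub>F n in sequentially. N \<le> real n"
    using filterlim_real_sequentially by (simp add: filterlim_at_top)
  ultimately show "\<forall>\<^sub>F n in sequentially. norm (real (c + 2 * floor_sqrt (2 * n))) \<le> e * norm (real n)"
    by (auto elim: eventually_mono)
qed

text \<open>The word \<open>w\<close> makes \<open>U\<close> imitate the decoder. It does not depend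
  on \<open>n\<close>, so its length is a constant inside \<open>h\<close>.\<close>

lemma heavy_coding:
  assumes U: "universal_prefix_machine U"
  shows "\<exists>w h. significance h \<and>
    (\<forall>n j u. j \<le> n \<longrightarrow> length u = j \<longrightarrow> length (w @ codeword n j u) + 1 \<le> j + h n) \<and>
    (\<forall>n j s y. length y = n \<longrightarrow> heavy U n j s y \<longrightarrow> (\<exists>u\<in>set (strings j). computes U (w @ codeword n j u) y))"
proof -
  have pU: "prefix_machine U" using U by (simp add: universal_prefix_machine_def)
  obtain M where M: "prefix_machine M" and tab: "\<And>n j s q y. (q, y) \<in> set (table U n j s) \<Longrightarrow> computes M q y"
    using decoding_machine[OF pU] by blast
  obtain w where w: "\<And>q x. computes U (w @ q) x \<longleftrightarrow> computes M q x"
    using U M unfolding universal_prefix_machine_def by blast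
  \<comment> \<open>The 5 consists of the four header terminators and one bit for the factor 2 in
    \<open>level_exists\<close>.\<close>
  define h where "h n = (length w + 5) + 2 * floor_sqrt (2 * n)" for n
  have "significance h" unfolding h_def by (rule significance_sqrt)
  moreover have "length (w @ codeword n j u) + 1 \<le> j + h n" if "j \<le> n" "length u = j" for n j u
    using length_codeword[OF that(1), of u] that(2) by (simp add: h_def)
  moreover have "\<exists>u\<in>set (strings j). computes U (w @ codeword n j u) y" if y: "length y = n" "heavy U n j s y" for n j s y
  proof -
    obtain i where i: "i < length (heavy_list U n j (Suc s))" "heavy_list U n j (Suc s) ! i = y"
      using heavy_in_heavy_list[OF y(2,1)] by (auto simp only: in_set_conv_nth)
    then have "i < 2 ^ j" using length_heavy_list[OF pU, of n j "Suc s"] by linarith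
    then have "(codeword n j (strings j ! i), y) \<in> set (table U n j (Suc s))" using i unfolding table_iff by blast
    then have "computes U (w @ codeword n j (strings j ! i)) y" using w tab by blast
    moreover have "strings j ! i \<in> set (strings j)" by (rule nth_mem) (simp add: length_strings \<open>i < 2 ^ j\<close>)
    ultimately show ?thesis by blast
  qed
  ultimately show ?thesis by blast
qed

text \<open>The coding theorem up to an error of \<open>o(n)\<close> instead of \<open>O(1)\<close>, which significance functions absorb.\<close>

lemma coding:
  assumes U: "prefix_machine U"
    and len: "\<And>n j u. j \<le> n \<Longrightarrow> length u = j \<Longrightarrow> length (w @ codeword n j u) + 1 \<le> j + h n"
    and cod: "\<And>n j s y. length y = n \<Longrightarrow> heavy U n j s y \<Longrightarrow> \<exists>u\<in>set (strings j). computes U (w @ codeword n j u) y"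
  shows "\<exists>p. computes U p y \<and> 2 ^ length p * Q U y \<le> 2 ^ h (length y)"
proof -
  let ?n = "length y"
  obtain j where j: "j \<le> ?n" "Q U y \<le> 2 / 2 ^ j" "?n \<le> j \<or> 1 / 2 ^ j < Q U y"
    using level_exists[OF Q_le_1[OF U]] by blast
  have "\<exists>s. heavy U ?n j s y"
  proof (cases "?n \<le> j")
    case True
    then show ?thesis by (simp add: heavy_def)
  next
    case False
    then obtain F where F: "finite F" "F \<subseteq> {p. computes U p y}" "1 / 2 ^ j < (\<Sum>p\<in>F. 1 / 2 ^ length p :: real)"
      using Q_approx[OF U] j(3) by metis
    have "\<forall>p\<in>F. \<exists>s. computes_within U p y s" using F(2) by (auto simp: computes_def)
    then obtain \<tau> where \<tau>: "\<And>p. p \<in> F \<Longrightarrow> computes_within U p y (\<tau> p)" by metis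
    \<comment> \<open>A stage at which all programs in the finite set \<open>F\<close> have halted
      and that bounds their lengths, so that \<open>F\<close> is contained in
      \<open>programs U y s\<close>.\<close>
    define s where "s = Max (insert 0 ((\<lambda>p. max (\<tau> p) (length p)) ` F))"
    have "max (\<tau> p) (length p) \<le> s" if "p \<in> F" for p
      unfolding s_def using F(1) that by (intro Max_ge) auto
    then have "F \<subseteq> programs U y s" using \<tau> computes_within_mono by (force simp: programs_def)
    then have "(\<Sum>p\<in>F. 1 / 2 ^ length p :: real) \<le> (\<Sum>p\<in>programs U y s. 1 / 2 ^ length p)"
      by (intro sum_mono2 finite_programs) auto
    then show ?thesis using F(3) by (intro exI[of _ s]) (simp add: heavy_iff)
  qed
  then obtain u where u: "u \<in> set (strings j)" "computes U (w @ codeword ?n j u) y" using cod by blast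
  let ?p = "w @ codeword ?n j u"
  have "length ?p + 1 \<le> j + h ?n" using len j(1) u(1) by (simp add: set_strings)
  then have "(2::real) ^ (length ?p + 1) \<le> 2 ^ (j + h ?n)" by (intro power_increasing) auto
  then have "2 ^ length ?p * (2 / 2 ^ j) \<le> (2 ^ h ?n :: real)" by (simp add: power_add field_simps)
  moreover have "2 ^ length ?p * Q U y \<le> 2 ^ length ?p * (2 / 2 ^ j)" using j(2) by (intro mult_left_mono) auto
  ultimately show ?thesis using u(2) by (intro exI[of _ ?p]) linarith
qed

text \<open>The search predicate asks for a stage \<open>s\<close> by which the clock
  \<open>M\<close> has stopped on \<open>n\<close> ones. This certifies that \<open>s\<close> is at
  least \<open>t n\<close> without evaluating \<open>t\<close>, and all strings heavy at that stage
  are then awaited.\<close>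

lemma time_bounded_coding:
  assumes U: "prefix_machine U"
    and len: "\<And>n j u. j \<le> n \<Longrightarrow> length u = j \<Longrightarrow> length (w @ codeword n j u) + 1 \<le> j + h n"
    and cod: "\<And>n j s y. length y = n \<Longrightarrow> heavy U n j s y \<Longrightarrow> \<exists>u\<in>set (strings j). computes U (w @ codeword n j u) y"
    and t: "recursive t"
  shows "\<exists>T. recursive T \<and> (\<forall>y. \<exists>p. computes_within U p y (T (length y)) \<and>
    2 ^ length p * Qt U t y \<le> 2 ^ h (length y))"
proof -
  obtain M T0 where M: "turing_machine M" "\<And>n. t n \<le> T0 n" "\<And>p. halts_in_exactly M p (T0 (length p))"
    using recursive_padded[OF t] by blast
  \<comment> \<open>Stage \<open>Suc s\<close> meets the strict inequality of
    \<open>Qt_le_programs\<close>, and by \<open>level_exists\<close> no level beyond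
    \<open>n\<close> is needed.\<close>
  define good where "good n s z \<longleftrightarrow> (\<forall>y\<in>set (strings n). \<forall>j\<in>set [0..<Suc n]. heavy U n j (Suc s) y \<longrightarrow>
      (\<exists>u\<in>set (strings j). computes_within U (w @ codeword n j u) y z))" for n s z
  define P where "P x \<longleftrightarrow> (\<exists>s\<in>set [0..<Suc (snd x)]. halts_within M (replicate (length (fst x)) True) s \<and>
      good (length (fst x)) s (snd x))" for x :: "bool list \<times> nat"
  \<comment> \<open>The output is the search index itself in unary, as the definition of
    \<open>recursive\<close> requires.\<close>
  define g where "g x = replicate (snd x) True" for x :: "bool list \<times> nat"
  have "pr P" unfolding P_def good_def
    by (intro pr_intros pr_heavy prefix_machine_turing[OF U] M(1))
  moreover have "pr g" unfolding g_def by (intro pr_intros)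
  ultimately obtain N where N: "turing_machine N"
    "\<And>q z. P (q, z) \<Longrightarrow> \<forall>z'<z. \<not> P (q, z') \<Longrightarrow> computes N q (g (q, z))"
    using search_machine[of P g] by blast
  define T where "T n = (LEAST z. P (replicate n True, z))" for n
  have "\<exists>z. P (replicate n True, z)" for n
  proof -
    define s where "s = T0 n"
    have h: "halts_within M (replicate n True) s" using M(3)[of "replicate n True"] by (simp add: halts_in_exactly_def s_def)
    define H where "H = {x \<in> set (strings n) \<times> {..n}. heavy U n (snd x) (Suc s) (fst x)}"
    have "\<forall>x\<in>H. \<exists>z. \<exists>u\<in>set (strings (snd x)). computes_within U (w @ codeword n (snd x) u) (fst x) z"
    proof
      fix x assume "x \<in> H"
      then have "length (fst x) = n" "heavy U n (snd x) (Suc s) (fst x)" by (auto simp: H_def set_strings)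
      from cod[OF this] show "\<exists>z. \<exists>u\<in>set (strings (snd x)). computes_within U (w @ codeword n (snd x) u) (fst x) z"
        unfolding computes_def by blast
    qed
    then obtain \<tau> where \<tau>: "\<And>x. x \<in> H \<Longrightarrow> \<exists>u\<in>set (strings (snd x)). computes_within U (w @ codeword n (snd x) u) (fst x) (\<tau> x)"
      by metis
    \<comment> \<open>Only finitely many pairs of a string and a level are awaited, so one time
      serves them all.\<close>
    define z where "z = Max (insert s (\<tau> ` H))"
    have "finite H" unfolding H_def by (intro finite_Collect_conjI disjI1) auto
    then have z: "s \<le> z" "\<And>x. x \<in> H \<Longrightarrow> \<tau> x \<le> z" by (simp_all add: z_def)
    have "good n s z"
      unfolding good_def
    proof (intro ballI impI)
      fix y j assume "y \<in> set (strings n)" "j \<in> set [0..<Suc n]" "heavy U n j (Suc s) y"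
      then have "(y, j) \<in> H" by (auto simp: H_def)
      then show "\<exists>u\<in>set (strings j). computes_within U (w @ codeword n j u) y z"
        using \<tau>[of "(y, j)"] z(2)[of "(y, j)"] computes_within_mono by fastforce
    qed
    then have "P (replicate n True, z)" using h z(1) unfolding P_def by force
    then show ?thesis by blast
  qed
  then have PT: "P (replicate n True, T n)" for n unfolding T_def by (rule LeastI_ex)
  have "computes N (replicate n True) (replicate (T n) True)" for n
  proof -
    have "\<forall>z'<T n. \<not> P (replicate n True, z')" unfolding T_def using not_less_Least by blast
    from N(2)[OF PT this] show ?thesis by (simp add: g_def)
  qed
  then have "recursive T" unfolding recursive_def using N(1) by blast
  moreover have "\<exists>p. computes_within U p y (T (length y)) \<and> 2 ^ length p * Qt U t y \<le> 2 ^ h (length y)" for y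
  proof -
    let ?n = "length y"
    obtain s where s: "halts_within M (replicate ?n True) s" "good ?n s (T ?n)"
      using PT[of ?n] unfolding P_def by auto
    have "\<not> s < T0 ?n" using s(1) M(3)[of "replicate ?n True"] by (auto simp: halts_in_exactly_def)
    then have ts: "t ?n < Suc s" using M(2)[of ?n] by linarith
    define q where "q = (\<Sum>p\<in>programs U y (Suc s). 1 / 2 ^ length p :: real)"
    have "q \<le> 1" unfolding q_def by (rule finite_sum_programs_le_1[OF U finite_programs programs_computes])
    then obtain j where j: "j \<le> ?n" "q \<le> 2 / 2 ^ j" "?n \<le> j \<or> 1 / 2 ^ j < q" using level_exists by blast
    then have "heavy U ?n j (Suc s) y" unfolding heavy_iff q_def[symmetric] by auto
    moreover have "y \<in> set (strings ?n)" "j \<in> set [0..<Suc ?n]" using j(1) by (auto simp: set_strings)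
    ultimately obtain u where u: "u \<in> set (strings j)" "computes_within U (w @ codeword ?n j u) y (T ?n)"
      using s(2) unfolding good_def by blast
    let ?p = "w @ codeword ?n j u"
    have "length ?p + 1 \<le> j + h ?n" using len j(1) u(1) by (simp add: set_strings)
    then have "(2::real) ^ (length ?p + 1) \<le> 2 ^ (j + h ?n)" by (intro power_increasing) auto
    then have "2 ^ length ?p * (2 / 2 ^ j) \<le> (2 ^ h ?n :: real)" by (simp add: power_add field_simps)
    moreover have "Qt U t y \<le> 2 / 2 ^ j" using Qt_le_programs[where t = t, OF U ts] j(2) by (simp add: q_def)
    then have "2 ^ length ?p * Qt U t y \<le> 2 ^ length ?p * (2 / 2 ^ j)" by (intro mult_left_mono) auto
    ultimately show ?thesis using u(2) by (intro exI[of _ ?p]) linarith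
  qed
  ultimately show ?thesis by blast
qed

section \<open>The three characterisations\<close>

lemma summable_Qt:
  "prefix_machine U \<Longrightarrow> (\<lambda>p. 1 / 2 ^ length p :: real) summable_on {p. computes_within U p x s}"
  using summable_on_subset_banach[OF summable_programs, of U "{p. computes_within U p x s}" x]
  by (auto simp: computes_def)

lemma Qt_mono:
  assumes "prefix_machine U" "t (length x) \<le> t' (length x)"
  shows "Qt U t x \<le> Qt U t' x"
  unfolding Qt_def using assms
  by (intro infsum_mono2 summable_Qt) (auto intro: computes_within_mono)

section \<open>Minima in \<open>enat\<close> and significance functions\<close>

lemma Inf_enat_in: "A \<noteq> {} \<Longrightarrow> Inf A \<in> (A :: enat set)"
  by (meson ex_in_conv wellorder_InfI)

lemma K_attained:
  assumes "computes U p x"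
  obtains q where "computes U q x" "K U x = enat (length q)"
proof -
  have "(\<lambda>p. enat (length p)) ` {p. computes U p x} \<noteq> {}" using assms by blast
  from Inf_enat_in[OF this] show thesis using that unfolding K_def by auto
qed

lemma K_le: "computes U p x \<Longrightarrow> K U x \<le> enat (length p)"
  unfolding K_def by (rule INF_lower) simp

lemma Kt_le: "computes_within U p x (t (length x)) \<Longrightarrow> Kt U t x \<le> enat (length p)"
  unfolding Kt_def by (rule INF_lower) simp

lemma Kt_cases:
  obtains "Kt U t x = \<infinity>"
  | p where "computes_within U p x (t (length x))" "Kt U t x = enat (length p)"
proof (cases "{p. computes_within U p x (t (length x))} = {}")
  case True
  then have "Kt U t x = \<infinity>" unfolding Kt_def by (simp only: image_empty Inf_empty top_enat_def)
  then show ?thesis by (rule that(1))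
next
  case False
  then have "(\<lambda>p. enat (length p)) ` {p. computes_within U p x (t (length x))} \<noteq> {}" by blast
  from Inf_enat_in[OF this] obtain p where "computes_within U p x (t (length x))" "Kt U t x = enat (length p)"
    unfolding Kt_def by (elim imageE) simp
  then show ?thesis by (rule that(2))
qed

text \<open>Strictness survives the infimum because \<open>enat\<close> is well-ordered: a nonempty
  set attains it, and the empty set has infimum \<infinity>, above every finite
  \<open>k\<close>.\<close>

lemma less_Inf_enat_iff: "enat k < Inf A \<longleftrightarrow> (\<forall>a\<in>A. enat k < a)"
proof
  assume "enat k < Inf A"
  then show "\<forall>a\<in>A. enat k < a" by (auto intro: less_le_trans Inf_lower)
next
  assume a: "\<forall>a\<in>A. enat k < a"
  show "enat k < Inf A"
  proof (cases "A = {}")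
    case True
    then show ?thesis by (simp add: top_enat_def)
  next
    case False
    from Inf_enat_in[OF this] show ?thesis using a by blast
  qed
qed

lemma ldepth_greater_iff:
  "ldepth U b x > enat k \<longleftrightarrow>
    (\<forall>t. time_constructible t \<longrightarrow> Qt U t x / Q U x \<ge> 1 / 2 ^ b \<longrightarrow> k < t (length x))"
  unfolding ldepth_def less_Inf_enat_iff by auto

lemma significance_add: "significance f \<Longrightarrow> significance g \<Longrightarrow> significance (\<lambda>n. f n + g n)"
  unfolding significance_def by (simp add: sum_in_smallo)

lemma significance_const: "significance (\<lambda>_. c)"
proof -
  have "((\<lambda>n. real c / real n) \<longlongrightarrow> 0) sequentially" by (rule lim_const_over_n)
  then show ?thesis unfolding significance_def
    by (intro smalloI_tendsto) (auto intro: eventually_mono[OF eventually_gt_at_top[of 0]])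
qed

lemma length_seq_prefix [simp]: "length (seq_prefix \<alpha> n) = n"
  by (simp add: seq_prefix_def)

theorem theorem6:
  fixes U :: tm and \<alpha> :: "nat \<Rightarrow> bool"
  assumes "universal_prefix_machine U"
  shows "(super_deep U \<alpha> \<longleftrightarrow>
            (\<forall>t g. recursive t \<longrightarrow> significance g \<longrightarrow>
               (\<forall>\<^sub>F n in sequentially. depth U t (seq_prefix \<alpha> n) > enat (g n))))
       \<and> (super_deep U \<alpha> \<longleftrightarrow>
            (\<forall>t g. recursive t \<longrightarrow> significance g \<longrightarrow>
               (\<forall>\<^sub>F n in sequentially.
                  Q U (seq_prefix \<alpha> n) \<ge> 2 ^ g n * Qt U t (seq_prefix \<alpha> n))))"
proof -
  let ?x = "seq_prefix \<alpha>"
  \<comment> \<open>These are (2) and (3). Four implications follow, each with \<open>?R\<close> at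
    one end.\<close>
  let ?D = "\<forall>t g. recursive t \<longrightarrow> significance g \<longrightarrow> (\<forall>\<^sub>F n in sequentially. depth U t (?x n) > enat (g n))"
  let ?R = "\<forall>t g. recursive t \<longrightarrow> significance g \<longrightarrow>
    (\<forall>\<^sub>F n in sequentially. Q U (?x n) \<ge> 2 ^ g n * Qt U t (?x n))"
  have U: "prefix_machine U" using assms by (simp add: universal_prefix_machine_def)
  obtain w h where h: "significance h"
    and len: "\<And>n j u. j \<le> n \<Longrightarrow> length u = j \<Longrightarrow> length (w @ codeword n j u) + 1 \<le> j + h n"
    and cod: "\<And>n j s y. length y = n \<Longrightarrow> heavy U n j s y \<Longrightarrow> \<exists>u\<in>set (strings j). computes U (w @ codeword n j u) y"
    using heavy_coding[OF assms] by blast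
  have coding: "\<exists>p. computes U p y \<and> 2 ^ length p * Q U y \<le> 2 ^ h (length y)" for y
    by (rule coding[where w = w and h = h, OF U]) (erule (1) len, erule (1) cod)
  have Q_pos: "0 < Q U y" for y
  proof -
    obtain p where "computes U p y" using coding by blast
    from Q_program_le[OF U this] show ?thesis by (rule less_le_trans[rotated]) simp
  qed
  have "?R" if S: "super_deep U \<alpha>"
  proof (intro allI impI)
    fix t g assume t: "recursive t" and g: "significance g"
    obtain M T where T: "turing_machine M" "\<And>n. t n \<le> T n" "\<And>p. halts_in_exactly M p (T (length p))" "recursive T"
      using recursive_padded[OF t] by blast
    then have tc: "time_constructible T" unfolding time_constructible_def by blast
    \<comment> \<open>\<open>T\<close> is at once the recursive bound and a competitor in the
      minimum defining \<open>ldepth\<close>: if its ratio reached \<open>1 / 2 ^ g n\<close>, the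
      logical depth would be at most \<open>T n\<close>.\<close>
    have "\<forall>\<^sub>F n in sequentially. ldepth U (g n) (?x n) > enat (T n)"
      using S g T(4) unfolding super_deep_def by blast
    then show "\<forall>\<^sub>F n in sequentially. Q U (?x n) \<ge> 2 ^ g n * Qt U t (?x n)"
    proof (rule eventually_mono)
      fix n assume "ldepth U (g n) (?x n) > enat (T n)"
      then have "\<not> Qt U T (?x n) / Q U (?x n) \<ge> 1 / 2 ^ g n"
        using tc unfolding ldepth_greater_iff by fastforce
      then have "2 ^ g n * Qt U T (?x n) \<le> Q U (?x n)" using Q_pos[of "?x n"] by (simp add: field_simps)
      moreover have "Qt U t (?x n) \<le> Qt U T (?x n)" by (rule Qt_mono[OF U]) (simp add: T(2))
      then have "2 ^ g n * Qt U t (?x n) \<le> 2 ^ g n * Qt U T (?x n)" by (intro mult_left_mono) auto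
      ultimately show "2 ^ g n * Qt U t (?x n) \<le> Q U (?x n)" by linarith
    qed
  qed
  moreover have "super_deep U \<alpha>" if R: "?R"
    unfolding super_deep_def
  proof (intro allI impI)
    fix s t assume s: "significance s" and t: "recursive t"
    \<comment> \<open>Condition (3) is a non-strict inequality; the extra bit keeps the ratio
      strictly below \<open>1 / 2 ^ s n\<close>.\<close>
    have "significance (\<lambda>n. s n + 1)" by (rule significance_add[OF s significance_const])
    then have "\<forall>\<^sub>F n in sequentially. Q U (?x n) \<ge> 2 ^ (s n + 1) * Qt U t (?x n)" using R t by blast
    then show "\<forall>\<^sub>F n in sequentially. ldepth U (s n) (?x n) > enat (t n)"
    proof (rule eventually_mono)
      fix n assume q: "Q U (?x n) \<ge> 2 ^ (s n + 1) * Qt U t (?x n)"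
      have "t n < t' n" if t': "Qt U t' (?x n) / Q U (?x n) \<ge> 1 / 2 ^ s n" for t'
      proof (rule ccontr)
        assume "\<not> t n < t' n"
        then have "Qt U t' (?x n) \<le> Qt U t (?x n)" by (intro Qt_mono[OF U]) simp
        then have "2 ^ (s n + 1) * Qt U t' (?x n) \<le> 2 ^ (s n + 1) * Qt U t (?x n)" by (intro mult_left_mono) auto
        from order_trans[OF this q] have "2 * (2 ^ s n * Qt U t' (?x n)) \<le> Q U (?x n)" by (simp add: mult.assoc)
        moreover have "Q U (?x n) \<le> 2 ^ s n * Qt U t' (?x n)" using t' Q_pos[of "?x n"] by (simp add: field_simps)
        ultimately show False using Q_pos[of "?x n"] by linarith
      qed
      then show "ldepth U (s n) (?x n) > enat (t n)" unfolding ldepth_greater_iff by simp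
    qed
  qed
  moreover have "?D" if R: "?R"
  proof (intro allI impI)
    fix t g assume t: "recursive t" and g: "significance g"
    \<comment> \<open>Here \<open>h\<close> pays for the coding theorem and the 1 makes the
      resulting inequality for depth strict.\<close>
    have "significance (\<lambda>n. g n + h n + 1)" by (intro significance_add g h significance_const)
    then have "\<forall>\<^sub>F n in sequentially. Q U (?x n) \<ge> 2 ^ (g n + h n + 1) * Qt U t (?x n)" using R t by blast
    then show "\<forall>\<^sub>F n in sequentially. depth U t (?x n) > enat (g n)"
    proof (rule eventually_mono)
      fix n assume q: "Q U (?x n) \<ge> 2 ^ (g n + h n + 1) * Qt U t (?x n)"
      obtain r where r: "computes U r (?x n)" "2 ^ length r * Q U (?x n) \<le> 2 ^ h n" using coding[of "?x n"] by auto
      obtain k where k: "K U (?x n) = enat k" "k \<le> length r" using K_attained[OF r(1)] K_le[OF r(1)] by (metis enat_ord_simps(1))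
      show "depth U t (?x n) > enat (g n)"
      proof (cases rule: Kt_cases[of U t "?x n"])
        case 1
        \<comment> \<open>No program is fast enough; \<open>K\<close> is finite, so the depth is
          infinite.\<close>
        then show ?thesis using k by (simp add: depth_def)
      next
        case (2 p)
        have "2 ^ length r * (2 ^ (g n + h n + 1) * (1 / 2 ^ length p)) \<le> 2 ^ length r * (2 ^ (g n + h n + 1) * Qt U t (?x n))"
          using Qt_program_le[where t = t, OF U 2(1)] by (intro mult_left_mono) auto
        also have "\<dots> \<le> 2 ^ length r * Q U (?x n)" using q by (intro mult_left_mono) auto
        also have "\<dots> \<le> 2 ^ h n" by (rule r(2))
        finally have "(2::real) ^ (length r + (g n + h n + 1)) \<le> 2 ^ (h n + length p)"
          by (simp add: power_add field_simps)
        then have "length r + (g n + h n + 1) \<le> h n + length p" by (subst (asm) power_increasing_iff) simp_all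
        then show ?thesis using 2(2) k by (simp add: depth_def)
      qed
    qed
  qed
  moreover have "?R" if D: "?D"
  proof (intro allI impI)
    fix t g assume t: "recursive t" and g: "significance g"
    have "\<exists>T. recursive T \<and> (\<forall>y. \<exists>p. computes_within U p y (T (length y)) \<and>
        2 ^ length p * Qt U t y \<le> 2 ^ h (length y))"
      by (rule time_bounded_coding[where w = w and h = h, OF U]) (erule (1) len, erule (1) cod, rule t)
    then obtain T where T: "recursive T"
      "\<And>y. \<exists>p. computes_within U p y (T (length y)) \<and> 2 ^ length p * Qt U t y \<le> 2 ^ h (length y)"
      by blast
    \<comment> \<open>Depth is used for \<open>T\<close> instead of \<open>t\<close>: within time
      \<open>T\<close> some program has halted whose length exceeds -log of \<open>Qt U t\<close> by
      at most \<open>h\<close>, and adding \<open>h\<close> to \<open>g\<close> compensates for this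
      excess.\<close>
    have "\<forall>\<^sub>F n in sequentially. depth U T (?x n) > enat (g n + h n)"
      using D T(1) significance_add[OF g h] by blast
    then show "\<forall>\<^sub>F n in sequentially. Q U (?x n) \<ge> 2 ^ g n * Qt U t (?x n)"
    proof (rule eventually_mono)
      fix n assume d: "depth U T (?x n) > enat (g n + h n)"
      obtain p where p: "computes_within U p (?x n) (T n)" "2 ^ length p * Qt U t (?x n) \<le> 2 ^ h n"
        using T(2)[of "?x n"] by auto
      then have "computes U p (?x n)" by (auto simp: computes_def)
      then obtain r where r: "computes U r (?x n)" "K U (?x n) = enat (length r)" using K_attained by blast
      have "Kt U T (?x n) \<le> enat (length p)" using Kt_le[of U p "?x n" T] p(1) by simp
      then obtain k where k: "Kt U T (?x n) = enat k" "k \<le> length p" by (cases "Kt U T (?x n)") auto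
      have "g n + h n < k - length r" using d by (simp add: depth_def k r(2))
      then have "g n + h n + length r \<le> length p" using k(2) by simp
      then have "(2::real) ^ (g n + h n + length r) \<le> 2 ^ length p" by (intro power_increasing) auto
      moreover have "0 \<le> Qt U t (?x n)" unfolding Qt_def by (intro infsum_nonneg) simp
      ultimately have "2 ^ (g n + h n + length r) * Qt U t (?x n) \<le> 2 ^ length p * Qt U t (?x n)"
        by (intro mult_right_mono)
      also have "\<dots> \<le> 2 ^ h n" by (rule p(2))
      finally have "2 ^ h n * (2 ^ g n * Qt U t (?x n)) \<le> 2 ^ h n * (1 / 2 ^ length r)"
        by (simp add: power_add field_simps)
      then have "2 ^ g n * Qt U t (?x n) \<le> 1 / 2 ^ length r" by (subst (asm) mult_le_cancel_left_pos) auto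
      also have "\<dots> \<le> Q U (?x n)" by (rule Q_program_le[OF U r(1)])
      finally show "2 ^ g n * Qt U t (?x n) \<le> Q U (?x n)" .
    qed
  qed
  ultimately show ?thesis by blast
qed

end
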